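(* Let $\mathcal{A}$ be a unital $C^*$-algebra and let $\mathcal{B}\subseteq\mathscr{B}(G)$ be a von Neumann algebra. Then the Bures distance $\beta$ is a metric on the set $CP(\mathcal{A},\mathcal{B})$ of all nonzero completely positive maps from $\mathcal{A}$ to $\mathcal{B}$.
   Context: $\mathscr{B}(G)$ is the algebra of bounded operators on a Hilbert space $G$. Inner products are linear in the second variable. For unital $C^*$-algebras $\mathcal{A},\mathcal{B}$, a Hilbert $\mathcal{B}$-module is a right $\mathcal{B}$-module with $\mathcal{B}$-valued inner product, complete in the norm $\|x\|=\|\langle x,x\rangle\|^{1/2}$; a Hilbert $\mathcal{A}$-$\mathcal{B}$-module is a Hilbert $\mathcal{B}$-module $E$ together with a unital $*$-homomorphism from $\mathcal{A}$ into the adjointable operators on $E$ (written as a left action $ax$). $CP(\mathcal{A},\mathcal{B})$ is the set of nonzero completely positive (CP) maps $\mathcal{A}\to\mathcal{B}$ (no normality assumed). A common representation module for $\varphi_1,\varphi_2\in CP(\mathcal{A},\mathcal{B})$ is a Hilbert $\mathcal{A}$-$\mathcal{B}$-module $E$ such that both sets $S(E,\varphi_i):=\{x\in E:\varphi_i(a)=\langle x,ax\rangle\ \forall a\in\mathcal{A}\}$, $i=1,2$, are nonempty. Put $$\beta_E(\varphi_1,\varphi_2):=\inf\{\|x_1-x_2\|: x_i\in S(E,\varphi_i),\ i=1,2\},$$ and define the Bures distance $\beta(\varphi_1,\varphi_2):=\inf_E\beta_E(\varphi_1,\varphi_2)$, the infimum being over all common representation modules $E$. (When $\mathcal{B}$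 is a von Neumann algebra, restricting to common representation modules that are von Neumann $\mathcal{A}$-$\mathcal{B}$-modules gives the same value.) *)

theory Defs
  imports "HOL-Analysis.Analysis" "HOL-Algebra.Ring"
begin

section \<open>Complex Hilbert spaces\<close>

class complex_normed_vector = real_normed_vector +
  fixes scaleC :: "complex \<Rightarrow> 'a \<Rightarrow> 'a"  (infixr \<open>*\<^sub>C\<close> 75)
  assumes scaleC_add_right: "c *\<^sub>C (x + y) = c *\<^sub>C x + c *\<^sub>C y"
    and scaleC_add_left: "(c + d) *\<^sub>C x = c *\<^sub>C x + d *\<^sub>C x"
    and scaleC_scaleC: "c *\<^sub>C d *\<^sub>C x = (c * d) *\<^sub>C x"
    and scaleC_of_real: "complex_of_real r *\<^sub>C x = r *\<^sub>R x"
    and norm_scaleC: "norm (c *\<^sub>C x) = cmod c * norm x"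

text \<open>The class \<^class>\<open>real_inner\<close> makes the norm come from the real inner product
  \<open>x \<bullet> y\<close>, which is tied to the complex one by \<open>Re_cinner\<close>; this is no restriction,
  since the real part of a complex inner product is a real inner product inducing the same norm.
  The complex inner product is linear in the second variable.\<close>

class chilbert_space = complex_normed_vector + real_inner + complete_space +
  fixes cinner :: "'a \<Rightarrow> 'a \<Rightarrow> complex"
  assumes cinner_commute: "cinner x y = cnj (cinner y x)"
    and cinner_add_right: "cinner x (y + z) = cinner x y + cinner x z"
    and cinner_scaleC_right: "cinner x (c *\<^sub>C y) = c * cinner x y"
    and Re_cinner: "Re (cinner x y) = inner x y"

subclass (in chilbert_space) banach ..

section \<open>Unital C*-algebras\<close>

text \<open>The zero algebra is not excluded, so \<^class>\<open>monoid_mult\<close> is used instead of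
  \<^class>\<open>ring_1\<close>.\<close>

class unital_cstar_algebra =
    complex_normed_vector + real_normed_algebra + complete_space + monoid_mult +
  fixes star :: "'a \<Rightarrow> 'a"
  assumes scaleC_mult_left: "(c *\<^sub>C x) * y = c *\<^sub>C (x * y)"
    and scaleC_mult_right: "x * (c *\<^sub>C y) = c *\<^sub>C (x * y)"
    and star_add: "star (x + y) = star x + star y"
    and star_scaleC: "star (c *\<^sub>C x) = cnj c *\<^sub>C star x"
    and star_mult: "star (x * y) = star y * star x"
    and star_star: "star (star x) = x"
    and cstar_identity: "norm (star x * x) = (norm x)\<^sup>2"

subclass (in unital_cstar_algebra) banach ..

definition cstar_subalgebra :: "'b::unital_cstar_algebra set \<Rightarrow> bool" where
  "cstar_subalgebra B \<longleftrightarrow> 1 \<in> B \<and> closed B \<and>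
     (\<forall>x\<in>B. \<forall>y\<in>B. x + y \<in> B \<and> x * y \<in> B) \<and> (\<forall>c. \<forall>x\<in>B. c *\<^sub>C x \<in> B \<and> star x \<in> B)"

section \<open>Bounded operators on a Hilbert space\<close>

lemma scaleC_minus_right: "c *\<^sub>C (- x) = - (c *\<^sub>C (x::'g::complex_normed_vector))"
proof -
  have "c *\<^sub>C (x + - x) = c *\<^sub>C x + c *\<^sub>C (- x)" by (rule scaleC_add_right)
  moreover have "c *\<^sub>C (0::'g) = 0" using norm_scaleC[of c "0::'g"] by simp
  ultimately show ?thesis by (simp add: eq_neg_iff_add_eq_0 add.commute)
qed

lemma scaleC_zero_right [simp]: "c *\<^sub>C (0::'g::complex_normed_vector) = 0"
  using norm_scaleC[of c "0::'g"] by simp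

lemma scaleC_diff_right: "c *\<^sub>C (x - y) = c *\<^sub>C x - c *\<^sub>C (y::'g::complex_normed_vector)"
  using scaleC_add_right[of c x "- y"] by (simp add: scaleC_minus_right)

lemma scaleC_one [simp]: "1 *\<^sub>C (x::'g::complex_normed_vector) = x"
  using scaleC_of_real[of 1 x] by simp

lemma scaleC_scaleR: "c *\<^sub>C (r *\<^sub>R x) = r *\<^sub>R (c *\<^sub>C (x::'g::complex_normed_vector))"
  by (simp add: scaleC_of_real[symmetric] scaleC_scaleC mult.commute)

lemma bounded_linear_scaleC: "bounded_linear (\<lambda>x::'g::complex_normed_vector. c *\<^sub>C x)"
  by (rule bounded_linear_intro[where K = "cmod c"])
     (auto simp: scaleC_add_right scaleC_scaleR norm_scaleC)

lemma cinner_add_left: "cinner (x + y) (z::'g::chilbert_space) = cinner x z + cinner y z"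
  by (metis cinner_add_right cinner_commute complex_cnj_add)

lemma cinner_scaleC_left: "cinner (c *\<^sub>C x) (y::'g::chilbert_space) = cnj c * cinner x y"
  by (metis cinner_scaleC_right cinner_commute complex_cnj_mult)

lemma cinner_zero_right [simp]: "cinner x (0::'g::chilbert_space) = 0"
  using cinner_add_right[of x 0 0] by simp

lemma cinner_zero_left [simp]: "cinner (0::'g::chilbert_space) x = 0"
  using cinner_add_left[of 0 0 x] by simp

lemma cinner_minus_right: "cinner x (- y) = - cinner x (y::'g::chilbert_space)"
  using cinner_add_right[of x y "- y"] by (simp add: eq_neg_iff_add_eq_0 add.commute)

lemma cinner_minus_left: "cinner (- x) y = - cinner x (y::'g::chilbert_space)"
  using cinner_add_left[of x "- x" y] by (simp add: eq_neg_iff_add_eq_0 add.commute)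

lemma cinner_diff_right: "cinner x (y - z) = cinner x y - cinner x (z::'g::chilbert_space)"
  using cinner_add_right[of x y "- z"] by (simp add: cinner_minus_right)

lemma cinner_diff_left: "cinner (x - y) z = cinner x z - cinner y (z::'g::chilbert_space)"
  using cinner_add_left[of x "- y" z] by (simp add: cinner_minus_left)

lemma cinner_self: "cinner x (x::'g::chilbert_space) = complex_of_real ((norm x)\<^sup>2)"
proof (rule complex_eqI)
  show "Re (cinner x x) = Re (complex_of_real ((norm x)\<^sup>2))"
    by (simp add: Re_cinner power2_norm_eq_inner)
  have "Im (cinner x x) = - Im (cinner x x)"
    using cinner_commute[of x x] by (metis cnj.sel(2))
  then show "Im (cinner x x) = Im (complex_of_real ((norm x)\<^sup>2))" by simp
qed

lemma cinner_eqI: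
  fixes x y :: "'g::chilbert_space"
  assumes "\<And>z. cinner z x = cinner z y"
  shows "x = y"
  using assms[of "x - y"] cinner_self[of "x - y"] by (simp add: cinner_diff_right)

lemma cmod_cinner_le: "cmod (cinner x y) \<le> norm x * norm (y::'g::chilbert_space)"
proof (cases "cinner x y = 0")
  case False
  define c where "c = cnj (cinner x y) / cmod (cinner x y)"
  have cm: "cmod c = 1" using False by (simp add: c_def norm_divide)
  have "c * cinner x y = complex_of_real (cmod (cinner x y))"
    using False by (simp add: c_def complex_norm_square[symmetric] power2_eq_square mult.commute)
  then have "cmod (cinner x y) = Re (cinner x (c *\<^sub>C y))" by (simp add: cinner_scaleC_right)
  also have "\<dots> \<le> norm x * norm (c *\<^sub>C y)" by (simp add: Re_cinner norm_cauchy_schwarz)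
  finally show ?thesis by (simp add: norm_scaleC cm)
qed simp

text \<open>The bounded linear maps of \<^typ>\<open>'g \<Rightarrow>\<^sub>L 'g\<close> are only real-linear.\<close>

typedef (overloaded) ('g::chilbert_space) bop = "{T :: 'g \<Rightarrow>\<^sub>L 'g. \<forall>c x. T (c *\<^sub>C x) = c *\<^sub>C T x}"
  morphisms blinfun_of_bop bop_of_blinfun
  by (rule exI[of _ 0]) simp

setup_lifting type_definition_bop

definition app :: "'g::chilbert_space bop \<Rightarrow> 'g \<Rightarrow> 'g" where
  "app T = blinfun_apply (blinfun_of_bop T)"

lemma app_transfer [transfer_rule]: "rel_fun cr_bop (=) blinfun_apply app"
  by (auto simp: rel_fun_def cr_bop_def app_def)

lemma bop_eqI: "(\<And>x. app S x = app T x) \<Longrightarrow> S = T"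
  by transfer (rule blinfun_eqI)

lemma app_scaleC: "app T (c *\<^sub>C x) = c *\<^sub>C app T x"
  by transfer simp

lemma app_add: "app T (x + y) = app T x + app T y"
  by transfer (simp add: blinfun.add_right)

lemma app_diff: "app T (x - y) = app T x - app T y"
  by transfer (simp add: blinfun.diff_right)

lemma app_zero [simp]: "app T 0 = 0"
  by transfer simp

instantiation bop :: (chilbert_space) complex_normed_vector
begin

lift_definition zero_bop :: "'a bop" is 0 by simp
lift_definition plus_bop :: "'a bop \<Rightarrow> 'a bop \<Rightarrow> 'a bop" is "(+)"
  by (simp add: blinfun.add_left scaleC_add_right)
lift_definition minus_bop :: "'a bop \<Rightarrow> 'a bop \<Rightarrow> 'a bop" is "(-)"
  by (simp add: blinfun.diff_left scaleC_diff_right)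
lift_definition uminus_bop :: "'a bop \<Rightarrow> 'a bop" is "uminus"
  by (simp add: blinfun.minus_left scaleC_minus_right)
lift_definition scaleR_bop :: "real \<Rightarrow> 'a bop \<Rightarrow> 'a bop" is "scaleR"
  by (simp add: blinfun.scaleR_left scaleC_scaleR)
lift_definition scaleC_bop :: "complex \<Rightarrow> 'a bop \<Rightarrow> 'a bop"
  is "\<lambda>c (T :: 'a \<Rightarrow>\<^sub>L 'a). Blinfun (\<lambda>x. c *\<^sub>C T x)"
  by (simp add: bounded_linear_Blinfun_apply scaleC_scaleC mult.commute
      bounded_linear_compose[OF bounded_linear_scaleC blinfun.bounded_linear_right])
lift_definition norm_bop :: "'a bop \<Rightarrow> real" is norm .
definition dist_bop :: "'a bop \<Rightarrow> 'a bop \<Rightarrow> real" where "dist_bop S T = norm (S - T)"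
definition sgn_bop :: "'a bop \<Rightarrow> 'a bop" where "sgn_bop T = inverse (norm T) *\<^sub>R T"
definition uniformity_bop :: "('a bop \<times> 'a bop) filter" where
  "uniformity_bop = (INF e\<in>{0<..}. principal {(x, y). dist x y < e})"
definition open_bop :: "'a bop set \<Rightarrow> bool" where
  "open_bop U = (\<forall>x\<in>U. \<forall>\<^sub>F (x', y) in uniformity. x' = x \<longrightarrow> y \<in> U)"

lemma blinfun_scaleC_apply:
  fixes T :: "'g::chilbert_space \<Rightarrow>\<^sub>L 'g"
  shows "blinfun_apply (Blinfun (\<lambda>x. c *\<^sub>C T x)) x = c *\<^sub>C T x"
  by (simp add: bounded_linear_Blinfun_apply
      bounded_linear_compose[OF bounded_linear_scaleC blinfun.bounded_linear_right])

instance
proof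
  fix x y :: "'a bop" and r s :: real and c d :: complex
  show "norm (c *\<^sub>C x) = cmod c * norm x"
  proof transfer
    fix c and T :: "'a \<Rightarrow>\<^sub>L 'a"
    let ?S = "Blinfun (\<lambda>x. c *\<^sub>C T x)"
    have le: "norm ?S \<le> cmod c * norm T"
      by (rule norm_blinfun_bound)
         (auto simp: blinfun_scaleC_apply norm_scaleC mult.assoc intro!: mult_left_mono norm_blinfun)
    have "norm T \<le> norm ?S / cmod c" if "c \<noteq> 0"
    proof (rule norm_blinfun_bound)
      fix x
      have "cmod c * norm (T x) \<le> norm ?S * norm x"
        using norm_blinfun[of ?S x] by (simp add: blinfun_scaleC_apply norm_scaleC)
      then show "norm (T x) \<le> norm ?S / cmod c * norm x"
        using that by (simp add: field_simps)
    qed simp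
    with le show "norm ?S = cmod c * norm T"
      by (cases "c = 0") (auto simp: field_simps)
  qed
  show "c *\<^sub>C (x + y) = c *\<^sub>C x + c *\<^sub>C y"
  proof transfer
    fix c and S T :: "'a \<Rightarrow>\<^sub>L 'a"
    show "Blinfun (\<lambda>x. c *\<^sub>C (S + T) x) = Blinfun (\<lambda>x. c *\<^sub>C S x) + Blinfun (\<lambda>x. c *\<^sub>C T x)"
      by (rule blinfun_eqI, subst blinfun_scaleC_apply)
         (simp add: blinfun_scaleC_apply blinfun.add_left scaleC_add_right)
  qed
  show "(c + d) *\<^sub>C x = c *\<^sub>C x + d *\<^sub>C x"
  proof transfer
    fix c d and T :: "'a \<Rightarrow>\<^sub>L 'a"
    show "Blinfun (\<lambda>x. (c + d) *\<^sub>C T x) = Blinfun (\<lambda>x. c *\<^sub>C T x) + Blinfun (\<lambda>x. d *\<^sub>C T x)"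
      by (rule blinfun_eqI, subst blinfun_scaleC_apply)
         (simp add: blinfun_scaleC_apply blinfun.add_left scaleC_add_left)
  qed
  show "c *\<^sub>C d *\<^sub>C x = (c * d) *\<^sub>C x"
    by transfer (rule blinfun_eqI, simp add: blinfun_scaleC_apply scaleC_scaleC)
  show "complex_of_real r *\<^sub>C x = r *\<^sub>R x"
  proof transfer
    fix r and T :: "'a \<Rightarrow>\<^sub>L 'a"
    show "Blinfun (\<lambda>x. complex_of_real r *\<^sub>C T x) = r *\<^sub>R T"
      by (rule blinfun_eqI, subst blinfun_scaleC_apply) (simp add: scaleC_of_real blinfun.scaleR_left)
  qed
qed (unfold dist_bop_def sgn_bop_def uniformity_bop_def open_bop_def,
     (rule refl | (transfer, simp add: algebra_simps norm_triangle_ineq))+)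

end

lemma app_simps [simp]:
  "app (S + T) x = app S x + app T x" "app (S - T) x = app S x - app T x"
  "app (- T) x = - app T x" "app 0 x = 0" "app (r *\<^sub>R T) x = r *\<^sub>R app T x"
  "app (c *\<^sub>C T) x = c *\<^sub>C app T x"
  by (transfer; simp add: blinfun.add_left blinfun.diff_left blinfun.minus_left
      blinfun.scaleR_left blinfun_scaleC_apply)+

lemma norm_app: "norm (app T x) \<le> norm T * norm x"
  by transfer (rule norm_blinfun)

lemma norm_bop_bound: "0 \<le> b \<Longrightarrow> (\<And>x. norm (app T x) \<le> b * norm x) \<Longrightarrow> norm T \<le> b"
  by transfer (rule norm_blinfun_bound)

instance bop :: (chilbert_space) complete_space
proof
  fix X :: "nat \<Rightarrow> 'a bop"
  assume X: "Cauchy X"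
  have d: "dist (blinfun_of_bop S) (blinfun_of_bop T) = dist S T" for S T :: "'a bop"
    by (simp add: dist_norm norm_bop.rep_eq minus_bop.rep_eq)
  have "Cauchy (\<lambda>n. blinfun_of_bop (X n))"
    using X by (simp add: Cauchy_def d)
  then obtain L where L: "(\<lambda>n. blinfun_of_bop (X n)) \<longlonglongrightarrow> L"
    by (auto simp: Cauchy_convergent_iff convergent_def)
  have "L (c *\<^sub>C x) = c *\<^sub>C L x" for c x
  proof (rule LIMSEQ_unique)
    have ap: "(\<lambda>n. blinfun_of_bop (X n) y) \<longlonglongrightarrow> L y" for y
      by (intro tendsto_intros L)
    show "(\<lambda>n. blinfun_of_bop (X n) (c *\<^sub>C x)) \<longlonglongrightarrow> L (c *\<^sub>C x)" by (rule ap)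
    show "(\<lambda>n. blinfun_of_bop (X n) (c *\<^sub>C x)) \<longlonglongrightarrow> c *\<^sub>C L x"
    proof -
      have "blinfun_of_bop (X n) (c *\<^sub>C x) = c *\<^sub>C blinfun_of_bop (X n) x" for n
        using blinfun_of_bop[of "X n"] by simp
      then show ?thesis
        using bounded_linear.tendsto[OF bounded_linear_scaleC ap[of x], of c] by simp
    qed
  qed
  then have "blinfun_of_bop (bop_of_blinfun L) = L" by (simp add: bop_of_blinfun_inverse)
  then have "X \<longlonglongrightarrow> bop_of_blinfun L"
    using L by (simp add: tendsto_iff d[symmetric])
  then show "convergent X" by (auto simp: convergent_def)
qed

lemma riesz_representation_real:
  fixes f :: "'g::{real_inner, complete_space} \<Rightarrow> real"
  assumes "bounded_linear f"
  shows "\<exists>y. \<forall>x. f x = inner y x"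
proof -
  interpret f: bounded_linear f by fact
  obtain K where K: "\<And>x. \<bar>f x\<bar> \<le> norm x * K"
    using f.bounded by (auto simp: real_norm_def)
  define J where "J x = (norm x)\<^sup>2 - 2 * f x" for x
  have low: "- K\<^sup>2 \<le> J x" for x
  proof -
    have "0 \<le> (norm x - K)\<^sup>2" by simp
    then show ?thesis using K[of x] by (simp add: J_def power2_diff)
  qed
  define m where "m = Inf (range J)"
  have bdd: "bdd_below (range J)" using low by (auto intro!: bdd_belowI)
  have m_le: "m \<le> J x" for x unfolding m_def by (intro cInf_lower bdd) simp
  have "\<exists>x. J x < m + 1 / Suc n" for n
    using cInf_lessD[of "range J" "m + 1 / Suc n"] unfolding m_def by auto
  then obtain X where X: "\<And>n. J (X n) < m + 1 / Suc n" by metis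
  have par: "(norm (x - y))\<^sup>2 \<le> 2 * (J x - m) + 2 * (J y - m)" for x y
  proof -
    have "(norm (x - y))\<^sup>2 = 2 * J x + 2 * J y - 4 * J ((1/2) *\<^sub>R (x + y))"
      by (simp add: J_def f.add f.scaleR power2_norm_eq_inner inner_add_left inner_add_right
          inner_diff_left inner_diff_right inner_commute[of y x] algebra_simps)
    then show ?thesis using m_le[of "(1/2) *\<^sub>R (x + y)"] by simp
  qed
  have "Cauchy X"
  proof (rule metric_CauchyI)
    fix e :: real assume e: "0 < e"
    obtain N where N: "1 / Suc N < e\<^sup>2 / 4"
      using reals_Archimedean[of "e\<^sup>2 / 4"] e by (auto simp: inverse_eq_divide)
    have "dist (X i) (X j) < e" if "N \<le> i" "N \<le> j" for i j
    proof -
      have le: "1 / real (Suc k) \<le> 1 / real (Suc N)" if "N \<le> k" for k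
        using that by (auto intro!: divide_left_mono)
      have J: "J (X k) - m \<le> e\<^sup>2 / 4" if "N \<le> k" for k
        using X[of k] le[OF that] N by linarith
      have "J (X i) - m < e\<^sup>2 / 4"
        using X[of i] le[OF \<open>N \<le> i\<close>] N by linarith
      then have "(norm (X i - X j))\<^sup>2 < e\<^sup>2"
        using par[of "X i" "X j"] J[OF \<open>N \<le> j\<close>] by argo
      then show ?thesis using e by (simp add: dist_norm power2_less_imp_less)
    qed
    then show "\<exists>M. \<forall>i\<ge>M. \<forall>j\<ge>M. dist (X i) (X j) < e" by blast
  qed
  then obtain y where y: "X \<longlonglongrightarrow> y" by (auto simp: Cauchy_convergent_iff convergent_def)
  have "(\<lambda>n. J (X n)) \<longlonglongrightarrow> J y" unfolding J_def by (intro tendsto_intros y f.tendsto)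
  moreover have "(\<lambda>n. m + 1 / Suc n) \<longlonglongrightarrow> m + 0"
    by (intro tendsto_intros LIMSEQ_Suc lim_1_over_n)
  ultimately have Jy: "J y \<le> m"
    using LIMSEQ_le[of "\<lambda>n. J (X n)" "J y" "\<lambda>n. m + 1 / Suc n" m] X by (auto intro: less_imp_le)
  have "f x = inner y x" for x
  proof (rule ccontr)
    assume ne: "f x \<noteq> inner y x"
    define a where "a = f x - inner y x"
    have q: "2 * t * a \<le> t\<^sup>2 * (norm x)\<^sup>2" for t
    proof -
      have "J (y + t *\<^sub>R x) = J y - 2 * t * a + t\<^sup>2 * (norm x)\<^sup>2"
      proof -
        have "(norm (y + t *\<^sub>R x))\<^sup>2 = (norm y)\<^sup>2 + 2 * t * inner y x + t\<^sup>2 * (norm x)\<^sup>2"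
          unfolding power2_norm_eq_inner
          by (simp add: inner_add_left inner_add_right inner_commute[of x y] algebra_simps
              power2_eq_square)
        then show ?thesis by (simp add: J_def a_def f.add f.scaleR algebra_simps)
      qed
      then show ?thesis using m_le[of "y + t *\<^sub>R x"] Jy by linarith
    qed
    define t where "t = a / ((norm x)\<^sup>2 + 1)"
    have p: "0 < (norm x)\<^sup>2 + 1" by (simp add: add_nonneg_pos)
    have "a = t * ((norm x)\<^sup>2 + 1)" using p by (simp add: t_def)
    then have "2 * t * a = 2 * (t\<^sup>2 * (norm x)\<^sup>2) + 2 * t\<^sup>2"
      by (simp add: power2_eq_square algebra_simps)
    moreover have "0 \<le> t\<^sup>2 * (norm x)\<^sup>2" by simp
    moreover have "0 < t\<^sup>2" using ne p by (simp add: t_def a_def)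
    ultimately show False using q[of t] by linarith
  qed
  then show ?thesis by blast
qed

lemma ex_adjoint:
  fixes T :: "'g::chilbert_space bop"
  shows "\<exists>S. \<forall>x y. cinner (app S x) y = cinner x (app T y)"
proof -
  have bl: "bounded_linear (\<lambda>y. inner x (app T y))" for x
    by (rule bounded_linear_compose[OF bounded_linear_inner_right])
       (transfer, rule blinfun.bounded_linear_right)
  define S where "S x = (SOME z. \<forall>y. inner x (app T y) = inner z y)" for x
  have S: "inner x (app T y) = inner (S x) y" for x y
    using someI_ex[OF riesz_representation_real[OF bl]] unfolding S_def by blast
  have cS: "cinner (S x) y = cinner x (app T y)" for x y
  proof (rule complex_eqI)
    show "Re (cinner (S x) y) = Re (cinner x (app T y))" by (simp add: Re_cinner S)
    have "Re (cinner (S x) (\<i> *\<^sub>C y)) = Re (cinner x (app T (\<i> *\<^sub>C y)))" by (simp add: Re_cinner S)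
    then show "Im (cinner (S x) y) = Im (cinner x (app T y))"
      by (simp add: app_scaleC cinner_scaleC_right)
  qed
  have eqI: "u = v" if "\<And>y. cinner u y = cinner v y" for u v :: 'g
  proof (rule cinner_eqI)
    show "cinner z u = cinner z v" for z
      using that[of z] cinner_commute[of z u] cinner_commute[of z v] by simp
  qed
  have add: "S (x + y) = S x + S y" for x y
    by (rule eqI) (simp add: cS cinner_add_left)
  have scC: "S (c *\<^sub>C x) = c *\<^sub>C S x" for c x
    by (rule eqI) (simp add: cS cinner_scaleC_left)
  have scR: "S (r *\<^sub>R x) = r *\<^sub>R S x" for r x
    using scC[of "complex_of_real r" x] by (simp add: scaleC_of_real)
  have bd: "norm (S x) \<le> norm x * norm T" for x
  proof (cases "S x = 0")
    case False
    have "norm (S x) * norm (S x) = inner (S x) (S x)"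
      by (simp add: power2_norm_eq_inner[symmetric] power2_eq_square)
    also have "\<dots> = inner x (app T (S x))" by (simp add: S)
    also have "\<dots> \<le> norm x * norm (app T (S x))" by (rule norm_cauchy_schwarz)
    also have "\<dots> \<le> norm x * (norm T * norm (S x))" by (intro mult_left_mono norm_app) simp
    finally show ?thesis using False by (simp add: mult.assoc[symmetric])
  qed simp
  have "bounded_linear S" by (rule bounded_linear_intro[OF add scR bd])
  then have "app (bop_of_blinfun (Blinfun S)) x = S x" for x
    by (simp add: app_def bop_of_blinfun_inverse bounded_linear_Blinfun_apply scC)
  then show ?thesis using cS by metis
qed

text \<open>The adjoint \<open>star T\<close> is characterized by \<open>\<langle>T\<^sup>* x, y\<rangle> = \<langle>x, T y\<rangle>\<close>.\<close>

instantiation bop :: (chilbert_space) unital_cstar_algebra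
begin

lift_definition one_bop :: "'a bop" is id_blinfun by simp
lift_definition times_bop :: "'a bop \<Rightarrow> 'a bop \<Rightarrow> 'a bop" is "(o\<^sub>L)" by simp
definition star_bop :: "'a bop \<Rightarrow> 'a bop" where
  "star_bop T = (THE S. \<forall>x y. cinner (app S x) y = cinner x (app T y))"

lemma app_one [simp]: "app 1 x = (x::'a)"
  by transfer simp

lemma app_mult [simp]: "app (S * T) x = app S (app T (x::'a))"
  by transfer simp

lemma cinner_star_left: "cinner (app (star T) x) y = cinner x (app T (y::'a))"
proof -
  obtain S where S: "\<forall>x y. cinner (app S x) y = cinner x (app T y)" using ex_adjoint by blast
  have "(THE S. \<forall>x y. cinner (app S x) y = cinner x (app T y)) = S"
  proof (rule the_equality)
    show "\<forall>x y. cinner (app S x) y = cinner x (app T y)" by (rule S)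
  next
    fix S' assume S': "\<forall>x y. cinner (app S' x) y = cinner x (app T y)"
    show "S' = S"
    proof (rule bop_eqI, rule cinner_eqI)
      fix x z
      show "cinner z (app S' x) = cinner z (app S x)"
        using S S' cinner_commute[of z "app S' x"] cinner_commute[of z "app S x"] by simp
    qed
  qed
  then have "star T = S" by (simp only: star_bop_def)
  then show ?thesis using S by simp
qed

lemma cinner_star_right: "cinner x (app (star T) y) = cinner (app T x) (y::'a)"
proof -
  have "cinner x (app (star T) y) = cnj (cinner (app (star T) y) x)" by (rule cinner_commute)
  also have "\<dots> = cnj (cinner y (app T x))" by (simp only: cinner_star_left)
  also have "\<dots> = cinner (app T x) y" by (rule cinner_commute[symmetric])
  finally show ?thesis .
qed

instance
proof
  fix x y z :: "'a bop" and c :: complex and r :: real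
  show "x * y * z = x * (y * z)" "(x + y) * z = x * z + y * z" "x * (y + z) = x * y + x * z"
       "1 * x = x" "x * 1 = x"
    by (rule bop_eqI, simp add: app_add)+
  show "(r *\<^sub>R x) * y = r *\<^sub>R (x * y)" by (rule bop_eqI) simp
  show "x * (r *\<^sub>R y) = r *\<^sub>R (x * y)"
    by (rule bop_eqI) (simp add: scaleC_of_real[symmetric] app_scaleC)
  show "norm (x * y) \<le> norm x * norm y"
  proof (rule norm_bop_bound)
    fix v
    have "norm (app x (app y v)) \<le> norm x * norm (app y v)" by (rule norm_app)
    also have "\<dots> \<le> norm x * (norm y * norm v)" by (intro mult_left_mono norm_app) simp
    finally show "norm (app (x * y) v) \<le> norm x * norm y * norm v" by (simp add: mult.assoc)
  qed simp
  show "(c *\<^sub>C x) * y = c *\<^sub>C (x * y)" by (rule bop_eqI) simp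
  show "x * (c *\<^sub>C y) = c *\<^sub>C (x * y)" by (rule bop_eqI) (simp add: app_scaleC)
  have eqI: "S = T" if "\<And>v w. cinner v (app S w) = cinner v (app T w)" for S T :: "'a bop"
    by (rule bop_eqI, rule cinner_eqI) (rule that)
  show "star (x + y) = star x + star y"
    by (rule eqI) (simp add: cinner_star_right cinner_add_left cinner_add_right)
  show "star (c *\<^sub>C x) = cnj c *\<^sub>C star x"
    by (rule eqI) (simp add: cinner_star_right cinner_scaleC_left cinner_scaleC_right)
  show "star (x * y) = star y * star x" by (rule eqI) (simp add: cinner_star_right)
  show ss: "star (star x) = x" for x :: "'a bop"
    by (rule eqI) (simp add: cinner_star_right cinner_star_left)
  have le: "(norm x)\<^sup>2 \<le> norm (star x * x)" for x :: "'a bop"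
  proof -
    have "norm x \<le> sqrt (norm (star x * x))"
    proof (rule norm_bop_bound)
      fix v
      have h: "complex_of_real ((norm (app x v))\<^sup>2) = cinner v (app (star x * x) v)"
        by (simp only: cinner_self[symmetric] cinner_star_right app_mult)
      have "(norm (app x v))\<^sup>2 = cmod (cinner v (app (star x * x) v))"
        by (simp only: h[symmetric] norm_of_real abs_power2)
      also have "\<dots> \<le> norm v * norm (app (star x * x) v)" by (rule cmod_cinner_le)
      also have "\<dots> \<le> norm v * (norm (star x * x) * norm v)" by (intro mult_left_mono norm_app) simp
      finally have "(norm (app x v))\<^sup>2 \<le> (sqrt (norm (star x * x)) * norm v)\<^sup>2"
        by (simp add: power_mult_distrib power2_eq_square mult_ac)
      then show "norm (app x v) \<le> sqrt (norm (star x * x)) * norm v"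
        by (rule power2_le_imp_le) simp
    qed simp
    then have "(norm x)\<^sup>2 \<le> (sqrt (norm (star x * x)))\<^sup>2" by (intro power_mono) auto
    then show ?thesis by simp
  qed
  have sub: "norm (a * b) \<le> norm a * norm b" for a b :: "'a bop"
  proof (rule norm_bop_bound)
    fix v
    have "norm (app a (app b v)) \<le> norm a * norm (app b v)" by (rule norm_app)
    also have "\<dots> \<le> norm a * (norm b * norm v)" by (intro mult_left_mono norm_app) simp
    finally show "norm (app (a * b) v) \<le> norm a * norm b * norm v" by (simp add: mult.assoc)
  qed simp
  have le': "norm x \<le> norm (star x)" for x :: "'a bop"
  proof (cases "norm x = 0")
    case False
    have "norm x * norm x \<le> norm (star x) * norm x"
      using le[of x] sub[of "star x" x] by (simp add: power2_eq_square)
    then show ?thesis using False by simp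
  qed simp
  have eq: "norm (star x) = norm x" for x :: "'a bop"
    using le'[of x] le'[of "star x"] ss[of x] by simp
  show "norm (star x * x) = (norm x)\<^sup>2"
    using le[of x] sub[of "star x" x] eq[of x] by (simp add: power2_eq_square)
qed

end

section \<open>Von Neumann algebras\<close>

definition commutant :: "'g::chilbert_space bop set \<Rightarrow> 'g bop set" where
  "commutant S = {T. \<forall>X\<in>S. T * X = X * T}"

definition von_neumann_algebra :: "'g::chilbert_space bop set \<Rightarrow> bool" where
  "von_neumann_algebra B \<longleftrightarrow> (\<forall>b\<in>B. star b \<in> B) \<and> commutant (commutant B) = B"

lemma closed_commutant: "closed (commutant S)"
proof -
  have "closed {T. T * X - X * T = 0}" for X :: "'a bop"
    by (intro closed_Collect_eq continuous_intros)
  then have "closed (\<Inter>X\<in>S. {T. T * X - X * T = 0})" by (intro closed_INT ballI)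
  moreover have "(\<Inter>X\<in>S. {T. T * X - X * T = 0}) = commutant S"
    by (auto simp: commutant_def)
  ultimately show ?thesis by simp
qed

lemma von_neumann_algebra_cstar:
  assumes "von_neumann_algebra B"
  shows "cstar_subalgebra B"
proof -
  define C where "C = commutant B"
  have B: "B = commutant C" and st: "\<forall>b\<in>B. star b \<in> B"
    using assms by (auto simp: von_neumann_algebra_def C_def)
  have "1 \<in> commutant C" by (simp add: commutant_def)
  moreover have "x + y \<in> commutant C" "x * y \<in> commutant C"
    if "x \<in> commutant C" "y \<in> commutant C" for x y
  proof -
    have x: "x * X = X * x" and y: "y * X = X * y" if "X \<in> C" for X
      using \<open>x \<in> commutant C\<close> \<open>y \<in> commutant C\<close> that by (auto simp: commutant_def)
    have "x * y * X = X * (x * y)" if "X \<in> C" for X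
      using x[OF that] y[OF that] by (metis mult.assoc)
    then show "x * y \<in> commutant C" by (simp add: commutant_def)
    show "x + y \<in> commutant C"
      using x y by (simp add: commutant_def distrib_left distrib_right)
  qed
  moreover have "c *\<^sub>C x \<in> commutant C" if "x \<in> commutant C" for c x
    using that by (auto simp: commutant_def scaleC_mult_left scaleC_mult_right)
  ultimately show ?thesis
    unfolding cstar_subalgebra_def using B st closed_commutant[of C] by auto
qed

section \<open>Completely positive maps\<close>

definition positive_element :: "'b::unital_cstar_algebra set \<Rightarrow> 'b \<Rightarrow> bool" where
  "positive_element B b \<longleftrightarrow> (\<exists>c\<in>B. b = star c * c)"

text \<open>Positivity in the C*-algebra \<open>M\<^sub>n(B)\<close>: the matrix \<open>X\<close> has the form \<open>Y\<^sup>* Y\<close>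
  with \<open>Y \<in> M\<^sub>n(B)\<close>. Only the entries with indices below \<open>n\<close> matter.\<close>

definition positive_matrix ::
    "nat \<Rightarrow> 'b::unital_cstar_algebra set \<Rightarrow> (nat \<Rightarrow> nat \<Rightarrow> 'b) \<Rightarrow> bool" where
  "positive_matrix n B X \<longleftrightarrow>
     (\<exists>Y. (\<forall>i<n. \<forall>j<n. Y i j \<in> B) \<and> (\<forall>i<n. \<forall>j<n. X i j = (\<Sum>k<n. star (Y k i) * Y k j)))"

definition completely_positive ::
    "'b::unital_cstar_algebra set \<Rightarrow> ('a::unital_cstar_algebra \<Rightarrow> 'b) \<Rightarrow> bool" where
  "completely_positive B \<phi> \<longleftrightarrow>
     (\<forall>a a'. \<phi> (a + a') = \<phi> a + \<phi> a') \<and> (\<forall>c a. \<phi> (c *\<^sub>C a) = c *\<^sub>C \<phi> a) \<and> (\<forall>a. \<phi> a \<in> B) \<and>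
     (\<forall>n X. positive_matrix n UNIV X \<longrightarrow> positive_matrix n B (\<lambda>i j. \<phi> (X i j)))"

definition CP ::
    "'b::unital_cstar_algebra set \<Rightarrow> ('a::unital_cstar_algebra \<Rightarrow> 'b) set" where
  "CP B = {\<phi>. completely_positive B \<phi> \<and> \<phi> \<noteq> (\<lambda>a. 0)}"

section \<open>Hilbert modules\<close>

text \<open>As for the modules of HOL-Algebra, the additive group of a module is represented by
  extending the record type of rings, whose fields \<^const>\<open>monoid.mult\<close> and
  \<^const>\<open>monoid.one\<close> are not used. There is no separate scalar multiplication:
  as the coefficient algebra is unital, it is \<open>x \<mapsto> x (c 1)\<close>.\<close>

record ('a, 'b, 'e) bimodule = "'e ring" +
  ip :: "'e \<Rightarrow> 'e \<Rightarrow> 'b"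
  ract :: "'e \<Rightarrow> 'b \<Rightarrow> 'e"
  lact :: "'a \<Rightarrow> 'e \<Rightarrow> 'e"

definition mnorm :: "('a, 'b::unital_cstar_algebra, 'e) bimodule \<Rightarrow> 'e \<Rightarrow> real" where
  "mnorm E x = sqrt (norm (ip E x x))"

locale hilbert_module = abelian_group E
  for E :: "('a, 'b::unital_cstar_algebra, 'e) bimodule" (structure) and B :: "'b set" +
  assumes coefficients: "cstar_subalgebra B"
    and ract_closed: "\<lbrakk>x \<in> carrier E; b \<in> B\<rbrakk> \<Longrightarrow> ract E x b \<in> carrier E"
    and ract_add_left: "\<lbrakk>x \<in> carrier E; y \<in> carrier E; b \<in> B\<rbrakk> \<Longrightarrow>
          ract E (x \<oplus> y) b = ract E x b \<oplus> ract E y b"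
    and ract_add_right: "\<lbrakk>x \<in> carrier E; b \<in> B; c \<in> B\<rbrakk> \<Longrightarrow>
          ract E x (b + c) = ract E x b \<oplus> ract E x c"
    and ract_mult: "\<lbrakk>x \<in> carrier E; b \<in> B; c \<in> B\<rbrakk> \<Longrightarrow> ract E x (b * c) = ract E (ract E x b) c"
    and ract_one: "x \<in> carrier E \<Longrightarrow> ract E x 1 = x"
    and ip_closed: "\<lbrakk>x \<in> carrier E; y \<in> carrier E\<rbrakk> \<Longrightarrow> ip E x y \<in> B"
    and ip_add_right: "\<lbrakk>x \<in> carrier E; y \<in> carrier E; z \<in> carrier E\<rbrakk> \<Longrightarrow>
          ip E x (y \<oplus> z) = ip E x y + ip E x z"
    and ip_ract_right: "\<lbrakk>x \<in> carrier E; y \<in> carrier E; b \<in> B\<rbrakk> \<Longrightarrow> ip E x (ract E y b) = ip E x y * b"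
    and ip_star: "\<lbrakk>x \<in> carrier E; y \<in> carrier E\<rbrakk> \<Longrightarrow> star (ip E x y) = ip E y x"
    and ip_positive: "x \<in> carrier E \<Longrightarrow> positive_element B (ip E x x)"
    and ip_definite: "\<lbrakk>x \<in> carrier E; ip E x x = 0\<rbrakk> \<Longrightarrow> x = \<zero>"
    and complete: "\<lbrakk>\<And>n. X n \<in> carrier E;
            \<And>e. e > 0 \<Longrightarrow> \<exists>N. \<forall>m\<ge>N. \<forall>n\<ge>N. mnorm E (X m \<ominus> X n) < e\<rbrakk> \<Longrightarrow>
          \<exists>x\<in>carrier E. (\<lambda>n. mnorm E (X n \<ominus> x)) \<longlonglongrightarrow> 0"

text \<open>By \<open>lact_star\<close>, \<open>x \<mapsto> a x\<close> is adjointable with adjoint \<open>x \<mapsto> a\<^sup>* x\<close>; hence the left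
  action is a unital *-homomorphism into the algebra of adjointable operators. (Adjointable maps
  are automatically additive, right linear and bounded.)\<close>

locale hilbert_bimodule = hilbert_module E B
  for E :: "('a::unital_cstar_algebra, 'b::unital_cstar_algebra, 'e) bimodule" (structure)
    and B :: "'b set" +
  assumes lact_closed: "x \<in> carrier E \<Longrightarrow> lact E a x \<in> carrier E"
    and lact_star: "\<lbrakk>x \<in> carrier E; y \<in> carrier E\<rbrakk> \<Longrightarrow> ip E (lact E a x) y = ip E x (lact E (star a) y)"
    and lact_add: "x \<in> carrier E \<Longrightarrow> lact E (a + a') x = lact E a x \<oplus> lact E a' x"
    and lact_scaleC: "x \<in> carrier E \<Longrightarrow> lact E (c *\<^sub>C a) x = ract E (lact E a x) (c *\<^sub>C 1)"
    and lact_mult: "x \<in> carrier E \<Longrightarrow> lact E (a * a') x = lact E a (lact E a' x)"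
    and lact_one: "x \<in> carrier E \<Longrightarrow> lact E 1 x = x"

section \<open>The Bures distance\<close>

definition rep_vectors ::
    "('a::unital_cstar_algebra, 'b::unital_cstar_algebra, 'e) bimodule \<Rightarrow> ('a \<Rightarrow> 'b) \<Rightarrow> 'e set" where
  "rep_vectors E \<phi> = {x \<in> carrier E. \<forall>a. \<phi> a = ip E x (lact E a x)}"

definition common_rep_modules ::
    "'b::unital_cstar_algebra set \<Rightarrow> ('a::unital_cstar_algebra \<Rightarrow> 'b) \<Rightarrow> ('a \<Rightarrow> 'b)
      \<Rightarrow> ('a, 'b, 'e) bimodule set" where
  "common_rep_modules B \<phi> \<psi> =
     {E. hilbert_bimodule E B \<and> rep_vectors E \<phi> \<noteq> {} \<and> rep_vectors E \<psi> \<noteq> {}}"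

definition bures_dist_in ::
    "('a::unital_cstar_algebra, 'b::unital_cstar_algebra, 'e) bimodule \<Rightarrow> ('a \<Rightarrow> 'b) \<Rightarrow> ('a \<Rightarrow> 'b) \<Rightarrow> real" where
  "bures_dist_in E \<phi> \<psi> =
     Inf {mnorm E (x \<ominus>\<^bsub>E\<^esub> y) | x y. x \<in> rep_vectors E \<phi> \<and> y \<in> rep_vectors E \<psi>}"

text \<open>The modules over which the infimum is taken form a proper class, whereas a HOL formula can
  only range over modules with elements in a given type. The type \<open>'a \<Rightarrow> 'b \<times> 'b\<close> is
  large enough: a module generated by two vectors \<open>x\<^sub>1\<close>, \<open>x\<^sub>2\<close> embeds into it by
  \<open>x \<mapsto> (\<lambda>a. (\<langle>x\<^sub>1, a x\<rangle>, \<langle>x\<^sub>2, a x\<rangle>))\<close>. The theorem \<open>bures_dist_le\<close> below shows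
  that common representation modules in all other types have been accounted for.

  The distance is meaningful on \<open>CP B\<close> only; elsewhere it gets the dummy value \<open>0\<close>,
  because the locale \<^locale>\<open>Metric_space\<close> demands a nonnegative symmetric function on the whole
  type.\<close>

definition bures_dist ::
    "'b::unital_cstar_algebra set \<Rightarrow> ('a::unital_cstar_algebra \<Rightarrow> 'b) \<Rightarrow> ('a \<Rightarrow> 'b) \<Rightarrow> real" where
  "bures_dist B \<phi> \<psi> =
     (if \<phi> \<in> CP B \<and> \<psi> \<in> CP B
      then INF E \<in> (common_rep_modules B \<phi> \<psi> :: ('a, 'b, 'a \<Rightarrow> 'b \<times> 'b) bimodule set).
             bures_dist_in E \<phi> \<psi>
      else 0)"

lemma mnorm_nonneg [simp]: "0 \<le> mnorm E x"
  by (simp add: mnorm_def)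

lemma mnorm_power2: "(mnorm E x)\<^sup>2 = norm (ip E x x)"
  by (simp add: mnorm_def)

lemma star_zero [simp]: "star (0::'b::unital_cstar_algebra) = 0"
  using star_add[of "0::'b" 0] by simp

lemma star_one [simp]: "star (1::'b::unital_cstar_algebra) = 1"
  by (metis star_star star_mult mult_1_right mult_1_left)

lemma star_minus: "star (- x) = - star (x::'b::unital_cstar_algebra)"
  using star_add[of x "- x"] by (simp add: eq_neg_iff_add_eq_0 add.commute)

lemma cstar_subalgebra_scaleR:
  assumes "cstar_subalgebra B" "b \<in> B"
  shows "r *\<^sub>R b \<in> B"
proof -
  have "complex_of_real r *\<^sub>C b \<in> B" using assms by (simp add: cstar_subalgebra_def)
  then show ?thesis by (simp only: scaleC_of_real)
qed

lemma cstar_subalgebra_uminus: "cstar_subalgebra B \<Longrightarrow> b \<in> B \<Longrightarrow> - b \<in> B"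
  using cstar_subalgebra_scaleR[of B b "- 1"] by simp

lemma cstar_subalgebra_zero: "cstar_subalgebra B \<Longrightarrow> 0 \<in> B"
  using cstar_subalgebra_scaleR[of B 1 0] unfolding cstar_subalgebra_def by simp

context hilbert_module
begin

lemma ip_add_left: "\<lbrakk>x \<in> carrier E; y \<in> carrier E; z \<in> carrier E\<rbrakk> \<Longrightarrow>
    ip E (x \<oplus> y) z = ip E x z + ip E y z"
  using ip_star[of z "x \<oplus> y"] by (simp add: ip_add_right star_add ip_star)

lemma ip_ract_left: "\<lbrakk>x \<in> carrier E; y \<in> carrier E; b \<in> B\<rbrakk> \<Longrightarrow>
    ip E (ract E x b) y = star b * ip E x y"
  using ip_star[of y "ract E x b"] by (simp add: ip_ract_right star_mult ip_star ract_closed)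

lemma ip_zero_right: "x \<in> carrier E \<Longrightarrow> ip E x \<zero> = 0"
  using ip_add_right[of x \<zero> \<zero>] by simp

lemma ip_zero_left: "x \<in> carrier E \<Longrightarrow> ip E \<zero> x = 0"
  using ip_add_left[of \<zero> \<zero> x] by simp

lemma ip_minus_right: "\<lbrakk>x \<in> carrier E; y \<in> carrier E\<rbrakk> \<Longrightarrow> ip E x (\<ominus> y) = - ip E x y"
  using ip_add_right[of x y "\<ominus> y"] by (simp add: r_neg ip_zero_right eq_neg_iff_add_eq_0 add.commute)

lemma ip_minus_left: "\<lbrakk>x \<in> carrier E; y \<in> carrier E\<rbrakk> \<Longrightarrow> ip E (\<ominus> x) y = - ip E x y"
  using ip_add_left[of x "\<ominus> x" y] by (simp add: r_neg ip_zero_left eq_neg_iff_add_eq_0 add.commute)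

lemma ip_diff_right: "\<lbrakk>x \<in> carrier E; y \<in> carrier E; z \<in> carrier E\<rbrakk> \<Longrightarrow>
    ip E x (y \<ominus> z) = ip E x y - ip E x z"
  by (simp add: a_minus_def ip_add_right ip_minus_right)

lemma ip_diff_left: "\<lbrakk>x \<in> carrier E; y \<in> carrier E; z \<in> carrier E\<rbrakk> \<Longrightarrow>
    ip E (x \<ominus> y) z = ip E x z - ip E y z"
  by (simp add: a_minus_def ip_add_left ip_minus_left)

lemma minus_zero_imp_eq:
  assumes "x \<in> carrier E" "y \<in> carrier E" "x \<ominus> y = \<zero>"
  shows "x = y"
proof -
  have "x = (x \<ominus> y) \<oplus> y" using assms(1,2) by (simp add: a_minus_def a_assoc l_neg)
  then show ?thesis using assms by simp
qed

lemma ract_zero: assumes "x \<in> carrier E" shows "ract E x 0 = \<zero>"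
proof -
  have z: "0 \<in> B" by (rule cstar_subalgebra_zero[OF coefficients])
  let ?p = "ract E x 0"
  have p: "?p \<in> carrier E" using assms z by (rule ract_closed)
  have "?p \<oplus> ?p = ?p" using ract_add_right[OF assms z z] by simp
  moreover have "\<ominus> ?p \<oplus> (?p \<oplus> ?p) = ?p" using p by (simp add: a_assoc[symmetric] l_neg)
  ultimately show ?thesis using p by (simp add: l_neg)
qed

lemma minus_eq_ract: assumes "x \<in> carrier E" shows "\<ominus> x = ract E x (- 1)"
proof -
  have o: "1 \<in> B" using coefficients by (simp add: cstar_subalgebra_def)
  then have m: "- 1 \<in> B" by (rule cstar_subalgebra_uminus[OF coefficients])
  have "ract E x (- 1) \<oplus> x = \<zero>"
    using ract_add_right[OF assms m o] by (simp add: ract_one assms ract_zero)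
  then show ?thesis using minus_equality ract_closed[OF assms m] assms by blast
qed

end

lemma bop_cauchy_schwarz:
  fixes E :: "('a, 'g::chilbert_space bop, 'e) bimodule" (structure)
  assumes "hilbert_module E B" and x: "x \<in> carrier E" and y: "y \<in> carrier E"
  shows "norm (ip E y x) \<le> mnorm E x * mnorm E y"
proof (cases "mnorm E y = 0")
  case True
  interpret hilbert_module E B by fact
  have "y = \<zero>" using True ip_definite[OF y] by (simp add: mnorm_def)
  then show ?thesis using x by (simp add: ip_zero_left)
next
  case False
  interpret hilbert_module E B by fact
  define t where "t = 1 / (mnorm E y)\<^sup>2"
  have pos: "0 < (mnorm E y)\<^sup>2" using False by simp
  define w where "w = ip E y x"
  define b where "b = t *\<^sub>R w"
  have bB: "b \<in> B" unfolding b_def w_def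
    by (intro cstar_subalgebra_scaleR coefficients ip_closed x y)
  have sb: "star b = t *\<^sub>R star w"
    unfolding b_def using star_scaleC[of "complex_of_real t" w] by (simp add: scaleC_of_real)
  define z where "z = x \<ominus> ract E y b"
  have yb: "ract E y b \<in> carrier E" by (intro ract_closed y bB)
  have zE: "z \<in> carrier E" unfolding z_def using x yb by (rule minus_closed)
  have sw: "ip E x y = star w" unfolding w_def by (simp add: ip_star x y)
  have ipz: "ip E z z = ip E x x - star w * b - star b * w + star b * (ip E y y * b)"
    unfolding z_def
    by (simp add: ip_diff_left ip_diff_right ip_ract_left ip_ract_right x y yb bB sw
        flip: w_def) (simp add: algebra_simps)
  have "norm (app w g) \<le> mnorm E x * mnorm E y * norm g" for g
  proof -
    obtain c where c: "ip E z z = star c * c"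
      using ip_positive[OF zE] by (auto simp: positive_element_def)
    let ?u = "app w g"
    have bd: "Re (cinner v (app (ip E p p) v)) \<le> (mnorm E p)\<^sup>2 * (norm v)\<^sup>2" for p and v :: 'g
    proof -
      have "Re (cinner v (app (ip E p p) v)) \<le> norm v * norm (app (ip E p p) v)"
        using cmod_cinner_le[of v "app (ip E p p) v"] complex_Re_le_cmod order_trans by blast
      also have "\<dots> \<le> norm v * (norm (ip E p p) * norm v)" by (intro mult_left_mono norm_app) simp
      finally show ?thesis by (simp only: mnorm_power2 power2_eq_square[of "norm v"] mult_ac)
    qed
    have "0 \<le> Re (cinner g (app (ip E z z) g))"
      by (simp add: c cinner_star_right cinner_self)
    also have "\<dots> = Re (cinner g (app (ip E x x) g)) - 2 * t * (norm ?u)\<^sup>2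
        + t\<^sup>2 * Re (cinner ?u (app (ip E y y) ?u))"
      by (simp add: ipz sb b_def cinner_add_right cinner_diff_right cinner_star_right
          scaleC_of_real[symmetric] cinner_scaleC_right cinner_scaleC_left app_scaleC cinner_self
          power2_eq_square algebra_simps)
    also have "\<dots> \<le> (mnorm E x)\<^sup>2 * (norm g)\<^sup>2 - 2 * t * (norm ?u)\<^sup>2
        + t\<^sup>2 * ((mnorm E y)\<^sup>2 * (norm ?u)\<^sup>2)"
      by (intro add_mono diff_mono mult_left_mono bd order_refl) simp
    also have "t\<^sup>2 * ((mnorm E y)\<^sup>2 * (norm ?u)\<^sup>2) = t * (norm ?u)\<^sup>2"
      using pos by (simp add: t_def power2_eq_square)
    finally have "t * (norm ?u)\<^sup>2 \<le> (mnorm E x)\<^sup>2 * (norm g)\<^sup>2" by simp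
    then have "(norm ?u)\<^sup>2 \<le> (mnorm E x)\<^sup>2 * (norm g)\<^sup>2 * (mnorm E y)\<^sup>2"
      using pos by (simp add: t_def field_simps)
    then have "(norm ?u)\<^sup>2 \<le> (mnorm E x * mnorm E y * norm g)\<^sup>2"
      by (simp add: power_mult_distrib mult_ac)
    then show ?thesis by (rule power2_le_imp_le) simp
  qed
  then show ?thesis unfolding w_def by (intro norm_bop_bound) auto
qed

context hilbert_bimodule
begin

definition closed_submodule :: "'e set \<Rightarrow> bool" where
  "closed_submodule F \<longleftrightarrow> F \<subseteq> carrier E \<and> \<zero> \<in> F \<and> (\<forall>x\<in>F. \<forall>y\<in>F. x \<oplus> y \<in> F) \<and>
     (\<forall>x\<in>F. \<forall>b\<in>B. ract E x b \<in> F) \<and> (\<forall>x\<in>F. \<forall>a. lact E a x \<in> F) \<and>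
     (\<forall>X x. (\<forall>n. X n \<in> F) \<longrightarrow> x \<in> carrier E \<longrightarrow> (\<lambda>n. mnorm E (X n \<ominus> x)) \<longlonglongrightarrow> 0 \<longrightarrow> x \<in> F)"

lemma closed_submodule_minus: "closed_submodule F \<Longrightarrow> x \<in> F \<Longrightarrow> \<ominus> x \<in> F"
  using coefficients minus_eq_ract[of x] cstar_subalgebra_uminus[OF coefficients, of 1]
  unfolding closed_submodule_def cstar_subalgebra_def by auto

definition transport :: "'e set \<Rightarrow> ('e \<Rightarrow> 'f) \<Rightarrow> ('a, 'b, 'f) bimodule" where
  "transport F J =
     \<lparr>carrier = J ` F, mult = undefined, one = undefined, zero = J \<zero>,
      add = (\<lambda>u v. J (inv_into F J u \<oplus> inv_into F J v)),
      ip = (\<lambda>u v. ip E (inv_into F J u) (inv_into F J v)),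
      ract = (\<lambda>u b. J (ract E (inv_into F J u) b)),
      lact = (\<lambda>a u. J (lact E a (inv_into F J u)))\<rparr>"

lemma transport:
  fixes J :: "'e \<Rightarrow> 'f"
  assumes F: "closed_submodule F" and J: "inj_on J F"
  shows "hilbert_bimodule (transport F J) B"
    and "\<And>x y. \<lbrakk>x \<in> F; y \<in> F\<rbrakk> \<Longrightarrow> mnorm (transport F J) (J x \<ominus>\<^bsub>transport F J\<^esub> J y) = mnorm E (x \<ominus> y)"
    and "\<And>x \<phi>. \<lbrakk>x \<in> F; x \<in> rep_vectors E \<phi>\<rbrakk> \<Longrightarrow> J x \<in> rep_vectors (transport F J) \<phi>"
proof -
  let ?T = "transport F J"
  have FE: "x \<in> carrier E" if "x \<in> F" for x using F that by (auto simp: closed_submodule_def)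
  have Fc: "\<zero> \<in> F" "\<And>x y. \<lbrakk>x \<in> F; y \<in> F\<rbrakk> \<Longrightarrow> x \<oplus> y \<in> F" "\<And>x b. \<lbrakk>x \<in> F; b \<in> B\<rbrakk> \<Longrightarrow> ract E x b \<in> F"
    "\<And>x a. x \<in> F \<Longrightarrow> lact E a x \<in> F"
    using F by (auto simp: closed_submodule_def)
  have Fm: "\<ominus> x \<in> F" if "x \<in> F" for x by (rule closed_submodule_minus[OF F that])
  have Fd: "x \<ominus> y \<in> F" if "x \<in> F" "y \<in> F" for x y using that by (simp add: a_minus_def Fc Fm)
  have inv: "inv_into F J (J x) = x" if "x \<in> F" for x using J that by (rule inv_into_f_f)
  have T [simp]: "carrier ?T = J ` F" "\<zero>\<^bsub>?T\<^esub> = J \<zero>"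
    by (simp_all add: transport_def)
  have T_add: "J x \<oplus>\<^bsub>?T\<^esub> J y = J (x \<oplus> y)" and T_ip: "ip ?T (J x) (J y) = ip E x y"
    if "x \<in> F" "y \<in> F" for x y
    using that by (simp_all add: transport_def inv)
  have T_ract: "ract ?T (J x) b = J (ract E x b)" and T_lact: "lact ?T a (J x) = J (lact E a x)"
    if "x \<in> F" for x b a
    using that by (simp_all add: transport_def inv)
  have "abelian_group ?T"
  proof (rule abelian_groupI)
    fix u assume "u \<in> carrier ?T"
    then obtain x where "u = J x" "x \<in> F" by auto
    then show "\<exists>v\<in>carrier ?T. v \<oplus>\<^bsub>?T\<^esub> u = \<zero>\<^bsub>?T\<^esub>"
      by (intro bexI[of _ "J (\<ominus> x)"]) (auto simp: T_add Fm FE l_neg)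
  next
    fix u v assume "u \<in> carrier ?T" "v \<in> carrier ?T"
    then obtain x y where "u = J x" "x \<in> F" "v = J y" "y \<in> F" by auto
    then show "u \<oplus>\<^bsub>?T\<^esub> v = v \<oplus>\<^bsub>?T\<^esub> u"
      using a_comm[of x y] by (simp add: T_add FE)
  qed (auto simp: T_add Fc FE a_assoc)
  then interpret T: abelian_group ?T .
  have T_minus: "\<ominus>\<^bsub>?T\<^esub> J x = J (\<ominus> x)" if "x \<in> F" for x
  proof (rule T.minus_equality)
    show "J (\<ominus> x) \<oplus>\<^bsub>?T\<^esub> J x = \<zero>\<^bsub>?T\<^esub>" using that by (simp add: T_add Fm FE l_neg)
  qed (use that Fm in auto)
  have T_diff: "J x \<ominus>\<^bsub>?T\<^esub> J y = J (x \<ominus> y)" if "x \<in> F" "y \<in> F" for x y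
    using that by (simp add: a_minus_def T_minus T_add Fm)
  have T_norm: "mnorm ?T (J x) = mnorm E x" if "x \<in> F" for x
    using that by (simp add: mnorm_def T_ip)
  have compl: "\<exists>u\<in>carrier ?T. (\<lambda>n. mnorm ?T (X n \<ominus>\<^bsub>?T\<^esub> u)) \<longlonglongrightarrow> 0"
    if X: "\<And>n. X n \<in> carrier ?T"
      and C: "\<And>e. e > 0 \<Longrightarrow> \<exists>N. \<forall>m\<ge>N. \<forall>n\<ge>N. mnorm ?T (X m \<ominus>\<^bsub>?T\<^esub> X n) < e" for X
  proof -
    have "\<exists>y. \<forall>n. X n = J (y n) \<and> y n \<in> F" using X by (intro choice) auto
    then obtain Y where Y: "\<And>n. X n = J (Y n)" "\<And>n. Y n \<in> F" by auto
    have "\<exists>x\<in>carrier E. (\<lambda>n. mnorm E (Y n \<ominus> x)) \<longlonglongrightarrow> 0"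
      using C by (intro complete) (auto simp: Y FE T_diff T_norm Fd)
    then obtain x where x: "x \<in> carrier E" "(\<lambda>n. mnorm E (Y n \<ominus> x)) \<longlonglongrightarrow> 0" by blast
    then have "x \<in> F" using F Y(2) unfolding closed_submodule_def by blast
    then show ?thesis using x(2) by (intro bexI[of _ "J x"]) (auto simp: Y T_diff T_norm Fd)
  qed
  have m: "c *\<^sub>C 1 \<in> B" for c using coefficients by (simp add: cstar_subalgebra_def)
  show "hilbert_bimodule ?T B"
  proof (unfold_locales, goal_cases)
    case (13 X) then show ?case by (rule compl)
  qed (auto simp: T_add T_ip T_ract T_lact Fc FE coefficients ract_add_left ract_add_right ract_mult
      ract_one ip_closed ip_add_right ip_ract_right ip_star ip_positive lact_star lact_add
      lact_scaleC lact_mult lact_one m dest: ip_definite[OF FE])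
  show "mnorm ?T (J x \<ominus>\<^bsub>?T\<^esub> J y) = mnorm E (x \<ominus> y)" if "x \<in> F" "y \<in> F" for x y
    using that by (simp add: T_diff T_norm Fd)
  show "J x \<in> rep_vectors ?T \<phi>" if "x \<in> F" "x \<in> rep_vectors E \<phi>" for x \<phi>
    using that by (auto simp: rep_vectors_def T_lact T_ip Fc)
qed

end

theorem bures_dist_le:
  fixes E :: "('a::unital_cstar_algebra, 'g::chilbert_space bop, 'e) bimodule" (structure)
  assumes E: "E \<in> common_rep_modules B \<phi> \<psi>" and "\<phi> \<in> CP B" "\<psi> \<in> CP B"
  shows "bures_dist B \<phi> \<psi> \<le> bures_dist_in E \<phi> \<psi>"
proof -
  interpret hilbert_bimodule E B using E by (simp add: common_rep_modules_def)
  have "bures_dist B \<phi> \<psi> \<le> mnorm E (x1 \<ominus> x2)"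
    if x1: "x1 \<in> rep_vectors E \<phi>" and x2: "x2 \<in> rep_vectors E \<psi>" for x1 x2
  proof -
    have x12: "x1 \<in> carrier E" "x2 \<in> carrier E" using x1 x2 by (auto simp: rep_vectors_def)
    define J where "J x = (\<lambda>a. (ip E x1 (lact E a x), ip E x2 (lact E a x)))" for x
    define F where "F = \<Inter>{F. closed_submodule F \<and> x1 \<in> F \<and> x2 \<in> F}"
    have E0: "closed_submodule (carrier E)"
      by (simp add: closed_submodule_def ract_closed lact_closed)
    have F: "closed_submodule F"
      unfolding closed_submodule_def
    proof (intro conjI allI impI ballI)
      show "F \<subseteq> carrier E" unfolding F_def using E0 x12 by blast
      show "x \<in> F" if "\<forall>n. X n \<in> F" "x \<in> carrier E" "(\<lambda>n. mnorm E (X n \<ominus> x)) \<longlonglongrightarrow> 0" for X x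
      proof -
        have "x \<in> F'" if "closed_submodule F'" "x1 \<in> F'" "x2 \<in> F'" for F'
        proof -
          have "\<forall>n. X n \<in> F'" using \<open>\<forall>n. X n \<in> F\<close> that unfolding F_def by blast
          then show ?thesis
            using that(1) \<open>x \<in> carrier E\<close> \<open>(\<lambda>n. mnorm E (X n \<ominus> x)) \<longlonglongrightarrow> 0\<close>
            unfolding closed_submodule_def by blast
        qed
        then show ?thesis unfolding F_def by blast
      qed
    qed (auto simp: F_def closed_submodule_def)
    have xF: "x1 \<in> F" "x2 \<in> F" unfolding F_def by auto
    have FE: "F \<subseteq> carrier E" using F by (simp add: closed_submodule_def)
    have lact_eqI: "u = v" if "u \<in> carrier E" "v \<in> carrier E" "\<And>y. y \<in> carrier E \<Longrightarrow> ip E y u = ip E y v" for u v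
    proof -
      have uv: "u \<ominus> v \<in> carrier E" using that by simp
      have "ip E (u \<ominus> v) (u \<ominus> v) = 0"
        using that(3)[OF uv] uv that(1,2) by (simp add: ip_diff_right[OF uv])
      then have "u \<ominus> v = \<zero>" by (rule ip_definite[OF uv])
      then show ?thesis by (rule minus_zero_imp_eq[OF that(1,2)])
    qed
    have lact_diff: "lact E a (u \<ominus> v) = lact E a u \<ominus> lact E a v"
      if "u \<in> carrier E" "v \<in> carrier E" for a u v
    proof (rule lact_eqI)
      fix y assume y: "y \<in> carrier E"
      have "ip E y (lact E a w) = ip E (lact E (star a) y) w" if "w \<in> carrier E" for w
        using lact_star[OF y that, of "star a"] by (simp add: star_star)
      then show "ip E y (lact E a (u \<ominus> v)) = ip E y (lact E a u \<ominus> lact E a v)"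
        using that y by (simp add: ip_diff_right lact_closed)
    qed (use that in \<open>auto simp: lact_closed\<close>)
    have "inj_on J F"
    proof (rule inj_onI)
      fix x y assume xy: "x \<in> F" "y \<in> F" "J x = J y"
      have xyE: "x \<in> carrier E" "y \<in> carrier E" using xy FE by auto
      define z where "z = x \<ominus> y"
      have zF: "z \<in> F" unfolding z_def a_minus_def
        using F xy closed_submodule_minus[OF F xy(2)] by (simp add: closed_submodule_def)
      then have zE: "z \<in> carrier E" using FE by auto
      define W where "W = {w \<in> carrier E. \<forall>a. ip E w (lact E a z) = 0}"
      have az: "lact E a z \<in> carrier E" for a by (rule lact_closed[OF zE])
      have "x1 \<in> W" "x2 \<in> W"
        using fun_cong[OF xy(3)] xyE x12
        by (auto simp: W_def J_def z_def lact_diff ip_diff_right lact_closed)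
      moreover have "closed_submodule W"
        unfolding closed_submodule_def
      proof (intro conjI allI impI ballI)
        show "W \<subseteq> carrier E" by (auto simp: W_def)
        show "\<zero> \<in> W" by (simp add: W_def ip_zero_left az)
        show "u \<oplus> v \<in> W" if "u \<in> W" "v \<in> W" for u v
          using that by (auto simp: W_def ip_add_left az)
        show "ract E u b \<in> W" if "u \<in> W" "b \<in> B" for u b
          using that by (auto simp: W_def ip_ract_left az ract_closed)
        show "lact E a u \<in> W" if "u \<in> W" for a u
          using that zE by (auto simp: W_def lact_closed lact_star az lact_mult[symmetric])
        fix X u assume X: "\<forall>n. X n \<in> W" "u \<in> carrier E" "(\<lambda>n. mnorm E (X n \<ominus> u)) \<longlonglongrightarrow> 0"
        have "ip E u (lact E a z) = 0" for a
        proof -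
          have "norm (ip E u (lact E a z)) \<le> mnorm E (lact E a z) * mnorm E (X n \<ominus> u)" for n
          proof -
            have Xn: "X n \<in> carrier E" "ip E (X n) (lact E a z) = 0" using X(1) by (auto simp: W_def)
            have d: "X n \<ominus> u \<in> carrier E" using Xn X(2) by simp
            have "ip E (X n \<ominus> u) (lact E a z) = - ip E u (lact E a z)"
              using Xn X(2) az by (simp add: ip_diff_left)
            then show ?thesis
              using bop_cauchy_schwarz[OF hilbert_module_axioms az[of a] d] by simp
          qed
          moreover have "(\<lambda>n. mnorm E (lact E a z) * mnorm E (X n \<ominus> u)) \<longlonglongrightarrow> mnorm E (lact E a z) * 0"
            by (intro tendsto_mult_left X(3))
          ultimately have "norm (ip E u (lact E a z)) \<le> mnorm E (lact E a z) * 0"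
            by (intro LIMSEQ_le_const) auto
          then show ?thesis by simp
        qed
        then show "u \<in> W" using X(2) by (simp add: W_def)
      qed
      ultimately have "z \<in> W" using zF unfolding F_def by blast
      then have "ip E z (lact E 1 z) = 0" by (simp add: W_def)
      then have "z = \<zero>" using ip_definite[OF zE] by (simp add: lact_one zE)
      then show "x = y" unfolding z_def by (rule minus_zero_imp_eq[OF xyE])
    qed
    note tr = transport[OF F this]
    let ?T = "transport F J"
    have J12: "J x1 \<in> rep_vectors ?T \<phi>" "J x2 \<in> rep_vectors ?T \<psi>"
      using tr(3) xF x1 x2 by auto
    then have T: "?T \<in> common_rep_modules B \<phi> \<psi>"
      using tr(1) by (auto simp: common_rep_modules_def)
    have "bures_dist B \<phi> \<psi> \<le> bures_dist_in ?T \<phi> \<psi>"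
      unfolding bures_dist_def using assms(2,3) T
    proof (simp, intro cINF_lower bdd_belowI2)
      fix E' :: "('a, 'g bop, 'a \<Rightarrow> 'g bop \<times> 'g bop) bimodule"
      assume "E' \<in> common_rep_modules B \<phi> \<psi>"
      then show "0 \<le> bures_dist_in E' \<phi> \<psi>"
        unfolding bures_dist_in_def common_rep_modules_def by (intro cInf_greatest) auto
    qed
    also have "\<dots> \<le> mnorm ?T (J x1 \<ominus>\<^bsub>?T\<^esub> J x2)"
      unfolding bures_dist_in_def using J12 by (intro cInf_lower bdd_belowI[of _ 0]) auto
    also have "\<dots> = mnorm E (x1 \<ominus> x2)" by (rule tr(2)[OF xF])
    finally show ?thesis .
  qed
  then show ?thesis
    using E unfolding bures_dist_in_def common_rep_modules_def by (intro cInf_greatest) auto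
qed

end

theory Submission
  imports Defs
begin

text \<open>Only the triangle inequality is hard: given \<open>x\<^sub>1, x\<^sub>2\<close> in one module and \<open>y\<^sub>2, y\<^sub>3\<close> in another one,
  where \<open>x\<^sub>2\<close> and \<open>y\<^sub>2\<close> both represent \<open>\<phi>\<^sub>2\<close>, the two modules must be glued along the submodules
  generated by \<open>x\<^sub>2\<close> and \<open>y\<^sub>2\<close>. On the level of Hilbert spaces, project \<open>x\<^sub>1 g\<close> and \<open>a y\<^sub>3 h\<close> onto the
  Stinespring space of \<open>\<phi>\<^sub>2\<close>; the inner products of the projections are the matrix coefficients
  \<open>\<langle>g, \<nu>(a) h\<rangle>\<close> of a map \<open>\<nu>\<close>, which takes values in \<open>B'' = B\<close> since everything commutes with \<open>B'\<close>.
  The kernel with diagonal \<open>\<phi>\<^sub>1, \<phi>\<^sub>3\<close> and off-diagonal entry \<open>\<nu>\<close> is positive, and the triangle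
  inequality for vectors of a Hilbert space bounds \<open>\<phi>\<^sub>1(1) + \<phi>\<^sub>3(1) - \<nu>(1) - \<nu>(1)\<^sup>*\<close>. It remains to
  build a module with a pair of vectors having a given positive kernel; the same construction with
  \<open>\<nu> = 0\<close> shows that common representation modules exist.\<close>

section \<open>Square roots and inverses in C*-algebras\<close>

text \<open>A closed submodule of a Hilbert module need not be complemented, so in general there is
  no projection of x_1 onto the submodule generated by x_2. This is why the argument passes to
  Hilbert spaces and has to recover \<open>B\<close> through its commutant. The projection itself is
  never constructed: w -> <w, x_1 g> is a functional on the Stinespring space, bounded by the
  Cauchy-Schwarz inequality, and the vector representing it is the projected vector. Accordingly a
  completion is modelled by its bounded conjugate linear functionals, and the vectors before
  completion are lists of pairs (a, g) standing for sums of a x g. Null vectors then require no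
  quotient, and no type has to depend on a kernel. The same device places the glued module in the
  very type over which \<open>bures_dist\<close> takes its infimum. In the glued kernel the
  components of x_1 g and y_3 g orthogonal to the Stinespring space are made orthogonal to each
  other. They thus add to the squared distance exactly what they already contribute to the two given
  ones, and only the projected parts are subject to the triangle inequality.\<close>

lemma norm_power_Suc_le: "norm (x ^ Suc n) \<le> norm (x::'a::unital_cstar_algebra) ^ Suc n"
proof (induction n)
  case (Suc n)
  have "norm (x ^ Suc (Suc n)) \<le> norm x * norm (x ^ Suc n)"
    by (simp only: power_Suc[of x "Suc n"] norm_mult_ineq)
  also have "\<dots> \<le> norm x * norm x ^ Suc n" by (intro mult_left_mono Suc) simp
  finally show ?case by simp
qed simp

lemma norm_star [simp]: "norm (star x) = norm (x::'a::unital_cstar_algebra)"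
proof -
  have le: "norm x \<le> norm (star x)" for x :: 'a
  proof (cases "norm x = 0")
    case False
    have "norm x * norm x \<le> norm (star x) * norm x"
      using cstar_identity[of x] norm_mult_ineq[of "star x" x] by (simp add: power2_eq_square)
    then show ?thesis using False by simp
  qed simp
  show ?thesis using le[of x] le[of "star x"] by (simp add: star_star)
qed

lemma star_scaleR: "star (r *\<^sub>R x) = r *\<^sub>R star (x::'a::unital_cstar_algebra)"
  using star_scaleC[of "complex_of_real r" x] by (simp add: scaleC_of_real)

lemma star_diff: "star (x - y) = star x - star (y::'a::unital_cstar_algebra)"
  using star_add[of x "- y"] by (simp add: star_minus)

lemma bounded_linear_star: "bounded_linear (star :: 'a::unital_cstar_algebra \<Rightarrow> 'a)"
  by (rule bounded_linear_intro[where K = 1]) (auto simp: star_add star_scaleR)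

lemma star_power: "star (x ^ n) = star (x::'a::unital_cstar_algebra) ^ n"
  by (induction n) (auto simp: star_mult power_commutes)

lemma cstar_subalgebra_power: "cstar_subalgebra D \<Longrightarrow> x \<in> D \<Longrightarrow> x ^ n \<in> D"
  by (induction n) (auto simp: cstar_subalgebra_def)

lemma cstar_subalgebra_sum:
  assumes "cstar_subalgebra D" "\<And>i. i \<in> I \<Longrightarrow> f i \<in> D"
  shows "sum f I \<in> D"
  using assms(2)
proof (induction I rule: infinite_finite_induct)
qed (use cstar_subalgebra_zero[OF assms(1)] assms(1) in \<open>auto simp: cstar_subalgebra_def\<close>)

lemma cstar_subalgebra_suminf:
  assumes "cstar_subalgebra D" "\<And>i. f i \<in> D" "summable f"
  shows "suminf f \<in> D"
proof (rule closed_sequentially)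
  show "closed D" using assms(1) by (simp add: cstar_subalgebra_def)
  show "(\<Sum>i<n. f i) \<in> D" for n by (intro cstar_subalgebra_sum assms)
  show "(\<lambda>n. \<Sum>i<n. f i) \<longlonglongrightarrow> suminf f" using assms(3) by (rule summable_LIMSEQ)
qed

lemma cstar_subalgebra_diff:
  assumes "cstar_subalgebra D" "x \<in> D" "y \<in> D"
  shows "x - y \<in> D"
  using assms cstar_subalgebra_uminus[OF assms(1,3)] unfolding cstar_subalgebra_def
  by (metis add_uminus_conv_diff)

text \<open>Coefficients of \<open>y = 1 - sqrt (1 - x)\<close>, which solves \<open>y = (x + y\<^sup>2) / 2\<close>.\<close>

fun sqrt_coeff :: "nat \<Rightarrow> real" where
  "sqrt_coeff 0 = 0"
| "sqrt_coeff (Suc 0) = 1 / 2"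
| "sqrt_coeff (Suc (Suc n)) = (\<Sum>i\<in>{1..Suc n}. sqrt_coeff i * sqrt_coeff (Suc (Suc n) - i)) / 2"

declare sqrt_coeff.simps(3) [simp del]

lemma sqrt_coeff_nonneg: "0 \<le> sqrt_coeff n"
proof (induction n rule: less_induct)
  case (less n)
  show ?case
  proof (cases n rule: sqrt_coeff.cases)
    case (3 m)
    then show ?thesis unfolding 3 sqrt_coeff.simps
      by (intro divide_nonneg_pos sum_nonneg) (auto intro!: mult_nonneg_nonneg less simp: 3)
  qed auto
qed

text \<open>Comparison of coefficients in 2 y = x + y^2. Degree one is excluded because
  \<open>x\<close> itself contributes there. The vanishing constant coefficient allows the sum to
  run over all \<open>i \<le> n\<close>.\<close>

lemma sqrt_coeff_rec:
  assumes "n \<noteq> 1" shows "2 * sqrt_coeff n = (\<Sum>i\<le>n. sqrt_coeff i * sqrt_coeff (n - i))"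
proof (cases n rule: sqrt_coeff.cases)
  case (3 m)
  have "2 * sqrt_coeff n = (\<Sum>i\<in>{1..Suc m}. sqrt_coeff i * sqrt_coeff (n - i))"
    unfolding 3 sqrt_coeff.simps by simp
  also have "\<dots> = (\<Sum>i\<le>n. sqrt_coeff i * sqrt_coeff (n - i))"
  proof (rule sum.mono_neutral_left)
    show "\<forall>i\<in>{..n} - {1..Suc m}. sqrt_coeff i * sqrt_coeff (n - i) = 0"
    proof
      fix i assume "i \<in> {..n} - {1..Suc m}"
      then have "i = 0 \<or> i = n" using 3 by auto
      then show "sqrt_coeff i * sqrt_coeff (n - i) = 0" by auto
    qed
  qed (auto simp: 3)
  finally show ?thesis .
qed (use assms in auto)

text \<open>The series is needed up to the boundary \<open>norm x = 1\<close>, where a geometric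
  majorant fails. For the partial sums s_n the recursion gives 2 s_(n+1) \<le> 1 + s_n^2, so the
  bound 1 propagates.\<close>

lemma sqrt_coeff_sum_le: "(\<Sum>i<n. sqrt_coeff i) \<le> 1"
proof (induction n)
  case (Suc n)
  let ?c = sqrt_coeff
  have "2 * (\<Sum>i<Suc n. ?c i) \<le> 1 + (\<Sum>k<Suc n. \<Sum>i\<le>k. ?c i * ?c (k - i))"
  proof -
    have "2 * ?c k \<le> (if k = 1 then 1 else 0) + (\<Sum>i\<le>k. ?c i * ?c (k - i))" for k
      using sqrt_coeff_rec[of k] by (cases "k = 1") (auto simp: sum_nonneg sqrt_coeff_nonneg)
    then have "(\<Sum>k<Suc n. 2 * ?c k) \<le> (\<Sum>k<Suc n. (if k = 1 then 1 else 0) + (\<Sum>i\<le>k. ?c i * ?c (k - i)))"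
      by (intro sum_mono)
    also have "\<dots> \<le> 1 + (\<Sum>k<Suc n. \<Sum>i\<le>k. ?c i * ?c (k - i))"
      by (simp add: sum.distrib sum.delta del: sum.lessThan_Suc)
    finally show ?thesis by (simp add: sum_distrib_left)
  qed
  also have "(\<Sum>k<Suc n. \<Sum>i\<le>k. ?c i * ?c (k - i)) = (\<Sum>(i, j)\<in>{(i, j). i + j < Suc n}. ?c i * ?c j)"
    by (rule sum.triangle_reindex[symmetric])
  \<comment> \<open>In the triangle \<open>i + j < Suc n\<close> an index can reach \<open>n\<close>
    only if the other one is \<open>0\<close>, and there the product vanishes. What remains lies in
    the square of side \<open>n\<close>, to which the induction hypothesis applies.\<close>
  also have "\<dots> \<le> (\<Sum>(i, j)\<in>{..<n} \<times> {..<n}. ?c i * ?c j)"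
  proof -
    have fin: "finite {(i, j). i + j < Suc n}"
      by (rule finite_subset[of _ "{..n} \<times> {..n}"]) auto
    have "(\<Sum>(i, j)\<in>{(i, j). i + j < Suc n}. ?c i * ?c j)
        = (\<Sum>(i, j)\<in>{(i, j). i + j < Suc n} \<inter> {..<n} \<times> {..<n}. ?c i * ?c j)"
    proof (rule sum.mono_neutral_right[OF fin])
      show "\<forall>p\<in>{(i, j). i + j < Suc n} - {(i, j). i + j < Suc n} \<inter> {..<n} \<times> {..<n}.
          (case p of (i, j) \<Rightarrow> ?c i * ?c j) = 0"
      proof clarify
        fix i j assume "i + j < Suc n" "(i, j) \<notin> {(i, j). i + j < Suc n} \<inter> {..<n} \<times> {..<n}"
        then have "i = 0 \<or> j = 0" by auto
        then show "?c i * ?c j = 0" by auto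
      qed
    qed auto
    also have "\<dots> \<le> (\<Sum>(i, j)\<in>{..<n} \<times> {..<n}. ?c i * ?c j)"
      by (rule sum_mono2) (auto intro!: mult_nonneg_nonneg sqrt_coeff_nonneg)
    finally show ?thesis .
  qed
  also have "\<dots> = (\<Sum>i<n. ?c i)\<^sup>2"
    by (simp add: power2_eq_square sum_product sum.cartesian_product)
  also have "\<dots> \<le> 1" using Suc by (intro power_le_one sum_nonneg sqrt_coeff_nonneg) auto
  finally show ?case by simp
qed simp

text \<open>The power series converges absolutely for \<open>norm x \<le> 1\<close>, and its sum
  stays in the closed subalgebra \<open>D\<close>; no spectral theory is involved.\<close>

lemma cstar_sqrt_one_minus:
  fixes x :: "'a::unital_cstar_algebra"
  assumes D: "cstar_subalgebra D" and x: "x \<in> D" "star x = x" "norm x \<le> 1"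
  shows "\<exists>c\<in>D. star c = c \<and> c * c = 1 - x"
proof -
  let ?f = "\<lambda>n. sqrt_coeff n *\<^sub>R x ^ n"
  have sc: "summable sqrt_coeff"
    by (rule summableI_nonneg_bounded[where x = 1]) (auto simp: sqrt_coeff_nonneg sqrt_coeff_sum_le)
  have nf: "norm (?f n) \<le> sqrt_coeff n" for n
  proof (cases n)
    case (Suc m)
    have "norm (x ^ n) \<le> 1"
      using norm_power_Suc_le[of x m] power_le_one[OF norm_ge_zero x(3), of "Suc m"] Suc by simp
    then show ?thesis using mult_left_mono[OF _ sqrt_coeff_nonneg[of n], of "norm (x ^ n)" 1]
      by (simp add: sqrt_coeff_nonneg)
  qed simp
  have sn: "summable (\<lambda>n. norm (?f n))"
    by (rule summable_comparison_test[OF _ sc]) (use nf in auto)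
  have sf: "summable ?f" using sn by (rule summable_norm_cancel)
  define y where "y = suminf ?f"
  have "y * y = (\<Sum>k. \<Sum>i\<le>k. ?f i * ?f (k - i))"
    unfolding y_def by (rule Cauchy_product[OF sn sn])
  also have "\<dots> = (\<Sum>k. 2 *\<^sub>R ?f k - (if k = 1 then x else 0))"
  proof (rule suminf_cong)
    fix k
    have "(\<Sum>i\<le>k. ?f i * ?f (k - i)) = (\<Sum>i\<le>k. (sqrt_coeff i * sqrt_coeff (k - i)) *\<^sub>R x ^ k)"
      by (intro sum.cong refl) (simp add: power_add[symmetric] mult.commute)
    also have "\<dots> = (\<Sum>i\<le>k. sqrt_coeff i * sqrt_coeff (k - i)) *\<^sub>R x ^ k"
      by (rule scaleR_sum_left[symmetric])
    also have "\<dots> = 2 *\<^sub>R ?f k - (if k = 1 then x else 0)"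
    proof (cases "k = 1")
      case False then show ?thesis by (simp add: sqrt_coeff_rec[symmetric])
    qed simp
    finally show "(\<Sum>i\<le>k. ?f i * ?f (k - i)) = 2 *\<^sub>R ?f k - (if k = 1 then x else 0)" .
  qed
  also have "\<dots> = (\<Sum>k. 2 *\<^sub>R ?f k) - (\<Sum>k. if k = 1 then x else 0)"
    by (intro suminf_diff[symmetric] summable_scaleR_right sf) (rule summable_single)
  also have "\<dots> = 2 *\<^sub>R y - x"
    unfolding y_def using suminf_scaleR_right[OF sf, of 2] sums_unique[OF sums_single[of 1 "\<lambda>_. x"]]
    by simp
  finally have yy: "y * y = 2 *\<^sub>R y - x" .
  have "star y = y"
    unfolding y_def using bounded_linear.suminf[OF bounded_linear_star sf]
    by (simp add: star_scaleR star_power x(2))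
  moreover have "y \<in> D"
    unfolding y_def
    by (intro cstar_subalgebra_suminf[OF D _ sf] cstar_subalgebra_scaleR[OF D] cstar_subalgebra_power[OF D] x(1))
  moreover have "1 \<in> D" using D by (simp add: cstar_subalgebra_def)
  ultimately have "1 - y \<in> D \<and> star (1 - y) = 1 - y"
    using D by (simp add: star_diff cstar_subalgebra_diff)
  moreover have "(1 - y) * (1 - y) = 1 - x"
    by (simp add: algebra_simps yy scaleR_2)
  ultimately show ?thesis by blast
qed

lemma cstar_one_minus_inverse:
  fixes x :: "'a::unital_cstar_algebra"
  assumes D: "cstar_subalgebra D" and x: "x \<in> D" "norm x < 1"
  shows "\<exists>r\<in>D. (1 - x) * r = 1"
proof -
  have "summable (\<lambda>n. norm x ^ Suc n)"
    using summable_geometric[of "norm x"] x(2) by (subst summable_Suc_iff) simp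
  then have "summable (\<lambda>n. norm (x ^ Suc n))"
    by (rule summable_comparison_test[rotated]) (auto intro: norm_power_Suc_le simp del: power_Suc)
  then have s1: "summable (\<lambda>n. x ^ Suc n)" by (rule summable_norm_cancel)
  then have s: "summable (\<lambda>n. x ^ n)" by (subst (asm) summable_Suc_iff)
  have "x * (\<Sum>n. x ^ n) = (\<Sum>n. x ^ Suc n)"
    using bounded_linear.suminf[OF bounded_linear_mult_right s, of x] by simp
  also have "\<dots> = (\<Sum>n. x ^ n) - 1" using suminf_split_head[OF s] by simp
  finally have "(1 - x) * (\<Sum>n. x ^ n) = 1" by (simp add: left_diff_distrib)
  moreover have "(\<Sum>n. x ^ n) \<in> D"
    by (intro cstar_subalgebra_suminf[OF D _ s] cstar_subalgebra_power[OF D x(1)])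
  ultimately show ?thesis by blast
qed

section \<open>Positive forms and their completions\<close>

text \<open>The discriminant criterion, tested on real multiples of \<open>cnj z\<close>. It serves
  for the Cauchy-Schwarz inequality and, with \<open>p\<close> a small error, for the approximate
  Riesz theorem.\<close>

lemma cmod_quadratic_bound:
  assumes bd: "\<And>t. 2 * Re (t * z) \<le> p + (cmod t)\<^sup>2 * q" and q: "0 \<le> q"
  shows "(cmod z)\<^sup>2 \<le> p * q"
proof (cases "z = 0")
  case True
  have "0 \<le> p" using bd[of 0] by simp
  then show ?thesis using True q by simp
next
  case False
  have zz: "Re (complex_of_real r * cnj z * z) = r * (cmod z)\<^sup>2" for r
    by (simp add: complex_norm_square[symmetric] mult.assoc mult.commute[of "cnj z"] flip: of_real_power)
  have cr: "(cmod (complex_of_real r * cnj z))\<^sup>2 = r\<^sup>2 * (cmod z)\<^sup>2" for r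
    by (simp add: norm_mult power_mult_distrib)
  have b: "2 * r * (cmod z)\<^sup>2 \<le> p + r\<^sup>2 * (cmod z)\<^sup>2 * q" for r
    using bd[of "complex_of_real r * cnj z"] unfolding zz cr by simp
  have pos: "0 < (cmod z)\<^sup>2" using False by simp
  show ?thesis
  proof (cases "q = 0")
    case True
    \<comment> \<open>With \<open>q = 0\<close> the left side is unbounded in \<open>r\<close> while
      the right side is the constant \<open>p\<close>; this value of \<open>r\<close> turns the
      bound into \<open>p + 1 \<le> p\<close>.\<close>
    have "2 * ((p + 1) / (2 * (cmod z)\<^sup>2)) * (cmod z)\<^sup>2 \<le> p" using b True by (metis mult_zero_right add_0_right)
    then show ?thesis using pos by simp
  next
    case False
    then have "0 < q" using q by simp
    then show ?thesis using b[of "1 / q"] by (simp add: field_simps power2_eq_square)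
  qed
qed

text \<open>No vector space axioms are required of \<open>add\<close> and \<open>sc\<close>: the vectors will be
  lists, with concatenation as addition.\<close>

locale psd_form =
  fixes add :: "'v \<Rightarrow> 'v \<Rightarrow> 'v" and sc :: "complex \<Rightarrow> 'v \<Rightarrow> 'v" and s :: "'v \<Rightarrow> 'v \<Rightarrow> complex"
  assumes s_add_right: "s u (add v w) = s u v + s u w"
    and s_sc_right: "s u (sc c v) = c * s u v"
    and s_commute: "s u v = cnj (s v u)"
    and s_nonneg: "0 \<le> Re (s v v)"
begin

definition sn :: "'v \<Rightarrow> real" where "sn v = sqrt (Re (s v v))"

lemma sn_nonneg [simp]: "0 \<le> sn v"
  by (simp add: sn_def s_nonneg)

lemma sn_power2: "(sn v)\<^sup>2 = Re (s v v)"
  by (simp add: sn_def s_nonneg)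

lemma s_self: "s v v = complex_of_real ((sn v)\<^sup>2)"
  using arg_cong[OF s_commute[of v v], of Im] by (intro complex_eqI) (simp_all add: sn_power2)

lemma s_add_left: "s (add u v) w = s u w + s v w"
  by (metis s_add_right s_commute complex_cnj_add)

lemma s_sc_left: "s (sc c u) w = cnj c * s u w"
  by (metis s_sc_right s_commute complex_cnj_mult)

lemma sn_perturb:
  "(sn (add v (sc t w)))\<^sup>2 = (sn v)\<^sup>2 + 2 * Re (cnj t * s w v) + (cmod t)\<^sup>2 * (sn w)\<^sup>2"
proof -
  have "Re (t * s v w) = Re (cnj t * s w v)"
    by (subst s_commute) (simp add: algebra_simps)
  moreover have "Re (t * (cnj t * s w w)) = (cmod t)\<^sup>2 * (sn w)\<^sup>2"
    by (simp add: s_self mult.assoc[symmetric] complex_norm_square[symmetric] 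
        flip: of_real_power of_real_mult)
  ultimately show ?thesis
    by (simp add: sn_power2 s_add_left s_add_right s_sc_left s_sc_right distrib_left del: times_complex.sel)
qed

lemma s_cauchy_schwarz: "cmod (s u v) \<le> sn u * sn v"
proof -
  have "(cmod (- s v u))\<^sup>2 \<le> (sn u)\<^sup>2 * (sn v)\<^sup>2"
  proof (rule cmod_quadratic_bound)
    fix t
    have "0 \<le> (sn (add u (sc (cnj t) v)))\<^sup>2" by simp
    then show "2 * Re (t * - s v u) \<le> (sn u)\<^sup>2 + (cmod t)\<^sup>2 * (sn v)\<^sup>2"
      unfolding sn_perturb by simp
  qed simp
  then have "(cmod (s u v))\<^sup>2 \<le> (sn u * sn v)\<^sup>2"
    by (subst s_commute) (simp add: power_mult_distrib)
  then show ?thesis by (rule power2_le_imp_le) simp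
qed

text \<open>The completion of the form, realized as its space of bounded conjugate linear
  functionals: the vector \<open>v\<close> becomes \<open>\<lambda>w. s w v\<close>, and the inner product
  \<open>dip\<close> below is determined by Riesz approximation.\<close>

definition dual :: "('v \<Rightarrow> complex) set" where
  "dual = {F. (\<forall>u v. F (add u v) = F u + F v) \<and> (\<forall>c v. F (sc c v) = cnj c * F v) \<and>
     (\<exists>C. \<forall>v. cmod (F v) \<le> C * sn v)}"

lemma dualI:
  assumes "\<And>u v. F (add u v) = F u + F v" "\<And>c v. F (sc c v) = cnj c * F v"
    "\<And>v. cmod (F v) \<le> C * sn v"
  shows "F \<in> dual"
  using assms unfolding dual_def by blast

lemma dual_add: "F \<in> dual \<Longrightarrow> F (add u v) = F u + F v"
  and dual_sc: "F \<in> dual \<Longrightarrow> F (sc c v) = cnj c * F v"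
  by (auto simp: dual_def)

lemma dual_bound:
  assumes "F \<in> dual" obtains C where "0 \<le> C" "\<And>v. cmod (F v) \<le> C * sn v"
proof -
  obtain C where C: "\<And>v. cmod (F v) \<le> C * sn v" using assms by (auto simp: dual_def)
  have "cmod (F v) \<le> \<bar>C\<bar> * sn v" for v
    using C[of v] mult_right_mono[OF abs_ge_self[of C] sn_nonneg[of v]] by linarith
  then show ?thesis using that[of "\<bar>C\<bar>"] by auto
qed

lemma dual_vector: "(\<lambda>w. s w v) \<in> dual"
  using s_cauchy_schwarz by (intro dualI[where C = "sn v"]) (auto simp: s_add_left s_sc_left mult.commute)

lemma dual_plus:
  assumes "F \<in> dual" "G \<in> dual" shows "(\<lambda>v. F v + G v) \<in> dual"
proof -
  obtain C where C: "\<And>v. cmod (F v) \<le> C * sn v" using dual_bound[OF assms(1)] by blast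
  obtain D where D: "\<And>v. cmod (G v) \<le> D * sn v" using dual_bound[OF assms(2)] by blast
  show ?thesis
  proof (rule dualI[where C = "C + D"])
    show "cmod (F v + G v) \<le> (C + D) * sn v" for v
      using norm_triangle_mono[OF C D, of v v] by (simp add: distrib_right)
  qed (use assms in \<open>auto simp: dual_add dual_sc algebra_simps\<close>)
qed

lemma dual_scale:
  assumes "F \<in> dual" shows "(\<lambda>v. c * F v) \<in> dual"
proof -
  obtain C where C: "\<And>v. cmod (F v) \<le> C * sn v" using dual_bound[OF assms] by blast
  show ?thesis
  proof (rule dualI[where C = "cmod c * C"])
    show "cmod (c * F v) \<le> cmod c * C * sn v" for v
      using mult_left_mono[OF C norm_ge_zero, of c v] by (simp add: norm_mult mult.assoc)
  qed (use assms in \<open>auto simp: dual_add dual_sc algebra_simps\<close>)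
qed

text \<open>Distance at most \<open>e\<close> between \<open>F\<close> and \<open>v\<close> in the
  dual norm. The inequality against \<open>sn w\<close> replaces a quotient, as \<open>sn\<close>
  may vanish on some vectors.\<close>

definition approx :: "('v \<Rightarrow> complex) \<Rightarrow> real \<Rightarrow> 'v \<Rightarrow> bool" where
  "approx F e v \<longleftrightarrow> 0 \<le> e \<and> (\<forall>w. cmod (F w - s w v) \<le> e * sn w)"

text \<open>As in the proof of the Riesz representation theorem, almost minimizers of
  \<open>v \<mapsto> \<parallel>v\<parallel>\<^sup>2 - 2 Re (F v)\<close> represent \<open>F\<close> approximately.\<close>

lemma approx_exists:
  assumes F: "F \<in> dual" and e: "0 < e"
  shows "\<exists>v. approx F e v"
proof -
  obtain C where C: "\<And>v. cmod (F v) \<le> C * sn v" using dual_bound[OF F] by blast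
  define J where "J v = (sn v)\<^sup>2 - 2 * Re (F v)" for v
  have low: "- C\<^sup>2 \<le> J v" for v
  proof -
    have "0 \<le> (sn v - C)\<^sup>2" by simp
    moreover have "Re (F v) \<le> C * sn v" using C[of v] complex_Re_le_cmod order_trans by blast
    ultimately show ?thesis by (simp add: J_def power2_diff mult.commute)
  qed
  have bdd: "bdd_below (range J)" using low by (auto intro!: bdd_belowI)
  define m where "m = Inf (range J)"
  have m_le: "m \<le> J v" for v unfolding m_def by (intro cInf_lower bdd) simp
  \<comment> \<open>The slack \<open>e\<^sup>2\<close> becomes the constant term of the quadratic
    inequality in \<open>t\<close>, which leaves an error \<open>e\<close> after taking
    roots.\<close>
  have "\<exists>v. J v < m + e\<^sup>2"
    using cInf_lessD[of "range J" "m + e\<^sup>2"] e unfolding m_def by auto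
  then obtain v where v: "J v < m + e\<^sup>2" by blast
  have "cmod (F w - s w v) \<le> e * sn w" for w
  proof -
    have "(cmod (F w - s w v))\<^sup>2 \<le> e\<^sup>2 * (sn w)\<^sup>2"
    proof (rule cmod_quadratic_bound)
      fix t
      have "J (add v (sc (cnj t) w)) = J v - 2 * Re (t * (F w - s w v)) + (cmod t)\<^sup>2 * (sn w)\<^sup>2"
        by (simp add: J_def sn_perturb dual_add[OF F] dual_sc[OF F] algebra_simps)
      then show "2 * Re (t * (F w - s w v)) \<le> e\<^sup>2 + (cmod t)\<^sup>2 * (sn w)\<^sup>2"
        using m_le[of "add v (sc (cnj t) w)"] v by linarith
    qed simp
    then have "(cmod (F w - s w v))\<^sup>2 \<le> (e * sn w)\<^sup>2" by (simp add: power_mult_distrib)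
    then show ?thesis by (rule power2_le_imp_le) (use e in simp)
  qed
  then show ?thesis using e by (auto simp: approx_def)
qed

section \<open>Inner products of functionals as limits along approximating vectors\<close>

definition approximates :: "('v \<Rightarrow> complex) \<Rightarrow> (nat \<Rightarrow> 'v) \<Rightarrow> bool" where
  "approximates F X \<longleftrightarrow> (\<exists>e. e \<longlonglongrightarrow> 0 \<and> (\<forall>n. approx F (e n) (X n)))"

text \<open>\<open>G v\<close> plays the role of the inner product of \<open>v\<close> with
  \<open>G\<close>, taken along vectors tending to \<open>F\<close>. \<open>SOME\<close> merely
  fixes one sequence; by \<open>approximates_tendsto\<close> every other one gives the same
  limit.\<close>

definition dip :: "('v \<Rightarrow> complex) \<Rightarrow> ('v \<Rightarrow> complex) \<Rightarrow> complex" where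
  "dip F G = lim (\<lambda>n. G (SOME v. approx F (1 / Suc n) v))"

lemma approximates_some:
  assumes "F \<in> dual" shows "approximates F (\<lambda>n. SOME v. approx F (1 / Suc n) v)"
proof -
  have "approx F (1 / Suc n) (SOME v. approx F (1 / Suc n) v)" for n
    by (rule someI_ex, rule approx_exists[OF assms]) simp
  moreover have "(\<lambda>n. 1 / real (Suc n)) \<longlonglongrightarrow> 0" by (intro LIMSEQ_Suc lim_1_over_n)
  ultimately show ?thesis unfolding approximates_def by (intro exI[of _ "\<lambda>n. 1 / real (Suc n)"]) blast
qed

text \<open>For the formal difference \<open>w\<close> of the two approximants, \<open>sn w\<close>
  squared is the real part of \<open>s w u - s w v\<close>, and \<open>F w\<close> can be inserted
  between the two terms. This yields convergence and independence of choices in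
  \<open>dip\<close>.\<close>

lemma approx_dist:
  assumes G: "G \<in> dual" "\<And>v. cmod (G v) \<le> C * sn v" "0 \<le> C"
    and a: "approx F e u" "approx F d v"
  shows "cmod (G u - G v) \<le> C * (e + d)"
proof -
  define w where "w = add u (sc (- 1) v)"
  have "(sn w)\<^sup>2 = Re ((F w - s w v) - (F w - s w u))"
    unfolding sn_power2 by (subst (2) w_def) (simp add: s_add_right s_sc_right)
  also have "\<dots> \<le> cmod (F w - s w v) + cmod (F w - s w u)"
    by (rule order_trans[OF complex_Re_le_cmod norm_triangle_ineq4])
  also have "\<dots> \<le> d * sn w + e * sn w" using a unfolding approx_def by (intro add_mono) auto
  finally have "sn w * sn w \<le> (e + d) * sn w" by (simp add: power2_eq_square algebra_simps)
  moreover have "0 \<le> e + d" using a by (simp add: approx_def)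
  ultimately have le: "sn w \<le> e + d" by (cases "sn w = 0") (auto simp: less_le)
  have "cmod (G u - G v) = cmod (G w)" by (simp add: w_def dual_add[OF G(1)] dual_sc[OF G(1)])
  also have "\<dots> \<le> C * sn w" by (rule G(2))
  also have "\<dots> \<le> C * (e + d)" by (rule mult_left_mono[OF le G(3)])
  finally show ?thesis .
qed

lemma approximates_tendsto:
  assumes F: "F \<in> dual" and G: "G \<in> dual" and X: "approximates F X"
  shows "(\<lambda>n. G (X n)) \<longlonglongrightarrow> dip F G"
proof -
  obtain C where C: "0 \<le> C" "\<And>v. cmod (G v) \<le> C * sn v" using dual_bound[OF G] by blast
  define Y where "Y n = (SOME v. approx F (1 / Suc n) v)" for n
  have "approximates F Y" unfolding Y_def by (rule approximates_some[OF F])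
  then obtain d where d: "d \<longlonglongrightarrow> 0" "\<And>n. approx F (d n) (Y n)" by (auto simp: approximates_def)
  obtain e where e: "e \<longlonglongrightarrow> 0" "\<And>n. approx F (e n) (X n)" using X by (auto simp: approximates_def)
  have "Cauchy (\<lambda>n. G (Y n))"
  proof (rule metric_CauchyI)
    fix r :: real assume r: "0 < r"
    define q where "q = r / (2 * (C + 1))"
    have q: "0 < q" using r C(1) by (simp add: q_def)
    obtain M where M: "\<And>n. M \<le> n \<Longrightarrow> d n < q"
      using order_tendstoD(2)[OF d(1) q] by (auto simp: eventually_sequentially)
    have "dist (G (Y m)) (G (Y n)) < r" if "M \<le> m" "M \<le> n" for m n
    proof -
      have "dist (G (Y m)) (G (Y n)) \<le> C * (d m + d n)"
        unfolding dist_norm by (rule approx_dist[OF G C(2,1) d(2) d(2)])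
      also have "\<dots> \<le> C * (q + q)" using M that C(1) by (intro mult_left_mono add_mono) (auto intro: less_imp_le)
      also have "\<dots> < (C + 1) * (q + q)" using q by simp
      also have "\<dots> = (2 * (C + 1)) * q" by simp
      also have "\<dots> = r" using C(1) by (simp add: q_def)
      finally show ?thesis .
    qed
    then show "\<exists>M. \<forall>m\<ge>M. \<forall>n\<ge>M. dist (G (Y m)) (G (Y n)) < r" by blast
  qed
  then have "convergent (\<lambda>n. G (Y n))" by (rule Cauchy_convergent)
  then have Y: "(\<lambda>n. G (Y n)) \<longlonglongrightarrow> dip F G"
    unfolding dip_def Y_def convergent_LIMSEQ_iff .
  have "(\<lambda>n. G (X n) - G (Y n)) \<longlonglongrightarrow> 0"
  proof (rule Lim_null_comparison)
    show "\<forall>\<^sub>F n in sequentially. cmod (G (X n) - G (Y n)) \<le> C * (e n + d n)"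
      using approx_dist[OF G C(2,1) e(2) d(2)] by simp
    show "(\<lambda>n. C * (e n + d n)) \<longlonglongrightarrow> 0"
      using tendsto_mult_left[OF tendsto_add[OF e(1) d(1)], of C] by simp
  qed
  from tendsto_add[OF this Y] show ?thesis by simp
qed

lemma approximates_exists:
  assumes "F \<in> dual" obtains X where "approximates F X"
  by (rule that[OF approximates_some[OF assms]])

lemma dip_add_right:
  assumes "F \<in> dual" "G \<in> dual" "H \<in> dual"
  shows "dip F (\<lambda>v. G v + H v) = dip F G + dip F H"
proof -
  obtain X where X: "approximates F X" using approximates_exists[OF assms(1)] .
  note t = approximates_tendsto[OF assms(1) _ X]
  show ?thesis
    by (rule LIMSEQ_unique[OF t[OF dual_plus[OF assms(2,3)]] tendsto_add[OF t[OF assms(2)] t[OF assms(3)]]])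
qed

lemma dip_scale_right:
  assumes "F \<in> dual" "G \<in> dual"
  shows "dip F (\<lambda>v. c * G v) = c * dip F G"
proof -
  obtain X where X: "approximates F X" using approximates_exists[OF assms(1)] .
  note t = approximates_tendsto[OF assms(1) _ X]
  show ?thesis
    by (rule LIMSEQ_unique[OF t[OF dual_scale[OF assms(2)]] tendsto_mult_left[OF t[OF assms(2)]]])
qed

text \<open>Reproducing property: against an embedded vector the inner product is evaluation up to
  conjugation, so that mixed inner products reduce to entries of the given kernels.\<close>

lemma dip_vector_right: "F \<in> dual \<Longrightarrow> dip F (\<lambda>w. s w v) = cnj (F v)"
proof -
  assume F: "F \<in> dual"
  obtain X where X: "approximates F X" using approximates_exists[OF F] .
  obtain e where e: "e \<longlonglongrightarrow> 0" "\<And>n. approx F (e n) (X n)" using X by (auto simp: approximates_def)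
  have "(\<lambda>n. s (X n) v - cnj (F v)) \<longlonglongrightarrow> 0"
  proof (rule Lim_null_comparison)
    have "cmod (s (X n) v - cnj (F v)) \<le> e n * sn v" for n
    proof -
      have "cmod (s (X n) v - cnj (F v)) = cmod (cnj (F v - s v (X n)))"
        by (subst s_commute) (simp add: norm_minus_commute)
      then show ?thesis using e(2)[of n] by (simp only: complex_mod_cnj) (simp add: approx_def)
    qed
    then show "\<forall>\<^sub>F n in sequentially. cmod (s (X n) v - cnj (F v)) \<le> e n * sn v" by simp
    show "(\<lambda>n. e n * sn v) \<longlonglongrightarrow> 0" using tendsto_mult_right[OF e(1), of "sn v"] by simp
  qed
  then have "(\<lambda>n. s (X n) v) \<longlonglongrightarrow> cnj (F v)" by (simp add: LIM_zero_iff)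
  then show ?thesis using approximates_tendsto[OF F dual_vector X] LIMSEQ_unique by blast
qed

text \<open>The error is at most \<open>e n * sn (Y n)\<close>, so the point is that approximants of
  \<open>G\<close> stay bounded, by \<open>C + d n\<close>. Hence \<open>dip\<close> is a limit of
  values of the form \<open>s\<close>, which gives its symmetry and positivity.\<close>

lemma approximates_self:
  assumes F: "F \<in> dual" and X: "approximates F X" and Y: "approximates G Y" and G: "G \<in> dual"
  shows "(\<lambda>n. F (Y n) - s (Y n) (X n)) \<longlonglongrightarrow> 0"
proof -
  obtain C where C: "0 \<le> C" "\<And>v. cmod (G v) \<le> C * sn v" using dual_bound[OF G] by blast
  obtain e where e: "e \<longlonglongrightarrow> 0" "\<And>n. approx F (e n) (X n)" using X by (auto simp: approximates_def)
  obtain d where d: "d \<longlonglongrightarrow> 0" "\<And>n. approx G (d n) (Y n)" using Y by (auto simp: approximates_def)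
  have sn: "sn (Y n) \<le> C + d n" for n
  proof -
    have "(sn (Y n))\<^sup>2 = Re (G (Y n) - (G (Y n) - s (Y n) (Y n)))" by (simp add: sn_power2)
    also have "\<dots> \<le> cmod (G (Y n)) + cmod (G (Y n) - s (Y n) (Y n))"
      by (rule order_trans[OF complex_Re_le_cmod norm_triangle_ineq4])
    also have "\<dots> \<le> C * sn (Y n) + d n * sn (Y n)" using d(2)[of n] C(2) by (intro add_mono) (auto simp: approx_def)
    finally have "sn (Y n) * sn (Y n) \<le> (C + d n) * sn (Y n)" by (simp add: power2_eq_square algebra_simps)
    then show ?thesis using C(1) d(2)[of n] by (cases "sn (Y n) = 0") (auto simp: less_le approx_def)
  qed
  show ?thesis
  proof (rule Lim_null_comparison)
    have "cmod (F (Y n) - s (Y n) (X n)) \<le> e n * (C + d n)" for n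
    proof -
      have "cmod (F (Y n) - s (Y n) (X n)) \<le> e n * sn (Y n)" using e(2)[of n] by (simp add: approx_def)
      also have "\<dots> \<le> e n * (C + d n)" using e(2)[of n] by (intro mult_left_mono sn) (simp add: approx_def)
      finally show ?thesis .
    qed
    then show "\<forall>\<^sub>F n in sequentially. cmod (F (Y n) - s (Y n) (X n)) \<le> e n * (C + d n)" by simp
    show "(\<lambda>n. e n * (C + d n)) \<longlonglongrightarrow> 0"
      using tendsto_mult[OF e(1) tendsto_add[OF tendsto_const d(1)], of C] by simp
  qed
qed

lemma approximates_tendsto_s:
  assumes F: "F \<in> dual" and G: "G \<in> dual" and X: "approximates F X" and Y: "approximates G Y"
  shows "(\<lambda>n. s (X n) (Y n)) \<longlonglongrightarrow> dip F G"
  using tendsto_diff[OF approximates_tendsto[OF F G X] approximates_self[OF G Y X F]] by simp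

lemma dip_commute:
  assumes F: "F \<in> dual" and G: "G \<in> dual"
  shows "dip F G = cnj (dip G F)"
proof -
  obtain X where X: "approximates F X" using approximates_exists[OF F] .
  obtain Y where Y: "approximates G Y" using approximates_exists[OF G] .
  have "(\<lambda>n. cnj (s (Y n) (X n))) \<longlonglongrightarrow> cnj (dip G F)"
    by (intro tendsto_cnj approximates_tendsto_s assms X Y)
  then have "(\<lambda>n. s (X n) (Y n)) \<longlonglongrightarrow> cnj (dip G F)" by (simp add: s_commute[symmetric])
  then show ?thesis using approximates_tendsto_s[OF F G X Y] LIMSEQ_unique by blast
qed

lemma dip_add_left:
  assumes "F \<in> dual" "G \<in> dual" "H \<in> dual"
  shows "dip (\<lambda>v. F v + G v) H = dip F H + dip G H"
  using dip_commute[OF dual_plus[OF assms(1,2)] assms(3)] dip_commute[OF assms(1,3)] dip_commute[OF assms(2,3)]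
  by (simp add: assms dip_add_right)

lemma dip_scale_left:
  assumes "F \<in> dual" "G \<in> dual"
  shows "dip (\<lambda>v. c * F v) G = cnj c * dip F G"
  using dip_commute[OF dual_scale[OF assms(1)] assms(2)] dip_commute[OF assms]
  by (simp add: assms dip_scale_right)

lemma dip_vector_left: "F \<in> dual \<Longrightarrow> dip (\<lambda>w. s w v) F = F v"
  using dip_commute[OF dual_vector] by (simp add: dip_vector_right)

lemma dip_self:
  assumes F: "F \<in> dual"
  shows "dip F F = complex_of_real (Re (dip F F))" and "0 \<le> Re (dip F F)"
proof -
  show "dip F F = complex_of_real (Re (dip F F))"
    using arg_cong[OF dip_commute[OF F F], of Im] by (intro complex_eqI) simp_all
  obtain X where X: "approximates F X" using approximates_exists[OF F] .
  show "0 \<le> Re (dip F F)"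
    by (rule LIMSEQ_le_const[OF tendsto_Re[OF approximates_tendsto_s[OF F F X X]]]) (simp add: s_nonneg)
qed

section \<open>The norm of the completion\<close>

definition dn :: "('v \<Rightarrow> complex) \<Rightarrow> real" where "dn F = sqrt (Re (dip F F))"

lemma dn_nonneg [simp]: "F \<in> dual \<Longrightarrow> 0 \<le> dn F"
  by (simp add: dn_def dip_self(2))

lemma dn_power2: "F \<in> dual \<Longrightarrow> (dn F)\<^sup>2 = Re (dip F F)"
  by (simp add: dn_def dip_self(2))

lemma dual_le_dn:
  assumes F: "F \<in> dual"
  shows "cmod (F v) \<le> dn F * sn v"
proof -
  obtain X where X: "approximates F X" using approximates_exists[OF F] .
  obtain e where e: "e \<longlonglongrightarrow> 0" "\<And>n. approx F (e n) (X n)" using X by (auto simp: approximates_def)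
  have "(\<lambda>n. (e n + sn (X n)) * sn v) \<longlonglongrightarrow> (0 + dn F) * sn v"
    unfolding sn_def dn_def by (intro tendsto_intros e tendsto_Re approximates_tendsto_s F X)
  moreover have "cmod (F v) \<le> (e n + sn (X n)) * sn v" for n
  proof -
    have "cmod (F v) \<le> cmod (F v - s v (X n)) + cmod (s v (X n))"
      using norm_triangle_ineq[of "F v - s v (X n)" "s v (X n)"] by simp
    also have "\<dots> \<le> e n * sn v + sn v * sn (X n)"
      using e(2)[of n] s_cauchy_schwarz by (intro add_mono) (auto simp: approx_def)
    finally show ?thesis by (simp add: algebra_simps)
  qed
  ultimately have "cmod (F v) \<le> (0 + dn F) * sn v" by (intro LIMSEQ_le_const) auto
  then show ?thesis by simp
qed

text \<open>Together with \<open>dual_le_dn\<close> this makes \<open>dn F\<close> the least bound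
  of \<open>F\<close> relative to \<open>sn\<close>, so norm estimates such as the triangle
  inequality can be checked pointwise.\<close>

lemma dn_le:
  assumes F: "F \<in> dual" and b: "\<And>v. cmod (F v) \<le> C * sn v" and C: "0 \<le> C"
  shows "dn F \<le> C"
proof -
  obtain X where X: "approximates F X" using approximates_exists[OF F] .
  have "(\<lambda>n. C * sn (X n) - Re (F (X n))) \<longlonglongrightarrow> C * dn F - Re (dip F F)"
    unfolding sn_def dn_def
    by (intro tendsto_intros tendsto_Re approximates_tendsto_s approximates_tendsto F X)
  moreover have "0 \<le> C * sn (X n) - Re (F (X n))" for n
    using b[of "X n"] complex_Re_le_cmod[of "F (X n)"] by linarith
  ultimately have "0 \<le> C * dn F - Re (dip F F)" by (intro LIMSEQ_le_const) auto
  then have "dn F * dn F \<le> C * dn F" by (simp add: dn_power2[OF F, symmetric] power2_eq_square)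
  then show ?thesis using C F by (cases "dn F = 0") (auto simp: less_le)
qed

lemma dip_cauchy_schwarz:
  assumes F: "F \<in> dual" and G: "G \<in> dual"
  shows "cmod (dip F G) \<le> dn F * dn G"
proof -
  obtain X where X: "approximates F X" using approximates_exists[OF F] .
  have "(\<lambda>n. dn G * sn (X n) - cmod (G (X n))) \<longlonglongrightarrow> dn G * dn F - cmod (dip F G)"
    unfolding sn_def dn_def[of F]
    by (intro tendsto_intros tendsto_Re approximates_tendsto_s approximates_tendsto F G X)
  moreover have "0 \<le> dn G * sn (X n) - cmod (G (X n))" for n
    using dual_le_dn[OF G] by simp
  ultimately have "0 \<le> dn G * dn F - cmod (dip F G)" by (intro LIMSEQ_le_const) auto
  then show ?thesis by (simp add: mult.commute)
qed

lemma dn_triangle: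
  assumes F: "F \<in> dual" and G: "G \<in> dual"
  shows "dn (\<lambda>v. F v + G v) \<le> dn F + dn G"
proof (rule dn_le)
  show "cmod (F v + G v) \<le> (dn F + dn G) * sn v" for v
    using norm_triangle_mono[OF dual_le_dn[OF F, of v] dual_le_dn[OF G, of v]] by (simp add: distrib_right)
qed (use assms in \<open>auto intro: dual_plus\<close>)

lemma dual_diff: "F \<in> dual \<Longrightarrow> G \<in> dual \<Longrightarrow> (\<lambda>v. F v - G v) \<in> dual"
  using dual_plus[OF _ dual_scale, of F G "- 1"] by simp

lemma dn_diff_power2:
  assumes "F \<in> dual" "G \<in> dual"
  shows "(dn (\<lambda>v. F v - G v))\<^sup>2 = (dn F)\<^sup>2 + (dn G)\<^sup>2 - 2 * Re (dip F G)"
proof -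
  have m: "(\<lambda>v. - 1 * G v) \<in> dual" by (rule dual_scale) fact
  have "dip (\<lambda>v. F v + - 1 * G v) (\<lambda>v. F v + - 1 * G v) = dip F F - dip F G - dip G F + dip G G"
    by (simp only: dip_add_left dip_add_right dip_scale_left dip_scale_right assms m dual_plus) simp
  moreover have "Re (dip G F) = Re (dip F G)" using dip_commute[OF assms] by simp
  ultimately show ?thesis using assms dual_diff[OF assms] by (simp add: dn_power2)
qed

lemma dip_zero: "G \<in> dual \<Longrightarrow> dip (\<lambda>_. 0) G = 0" "G \<in> dual \<Longrightarrow> dip G (\<lambda>_. 0) = 0"
  using dip_scale_left[of G G 0] dip_scale_right[of G G 0] by simp_all

lemma dn_diff_triangle:
  assumes "F \<in> dual" "G \<in> dual" "H \<in> dual"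
  shows "dn (\<lambda>v. F v - H v) \<le> dn (\<lambda>v. F v - G v) + dn (\<lambda>v. G v - H v)"
  using dn_triangle[OF dual_diff[OF assms(1,2)] dual_diff[OF assms(2,3)]] by simp

text \<open>If \<open>t'\<close> is adjoint to the bounded map \<open>t\<close>, it carries
  approximants of \<open>F\<close> to approximants of \<open>F\<close> composed with
  \<open>t\<close>. Precomposition with \<open>t\<close> is thus the action of \<open>t'\<close> on
  the completion.\<close>

lemma dip_compose:
  assumes F: "F \<in> dual" and G: "G \<in> dual"
    and Ft: "(\<lambda>v. F (t v)) \<in> dual" and Gt: "(\<lambda>v. G (t' v)) \<in> dual"
    and t: "\<And>v. sn (t v) \<le> K * sn v" "\<And>u v. s (t u) v = s u (t' v)"
  shows "dip (\<lambda>v. F (t v)) G = dip F (\<lambda>v. G (t' v))"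
proof -
  obtain X where X: "approximates F X" using approximates_exists[OF F] .
  obtain e where e: "e \<longlonglongrightarrow> 0" "\<And>n. approx F (e n) (X n)" using X by (auto simp: approximates_def)
  have "approx (\<lambda>v. F (t v)) (e n * \<bar>K\<bar>) (t' (X n))" for n
    unfolding approx_def
  proof (intro conjI allI)
    show "0 \<le> e n * \<bar>K\<bar>" using e(2)[of n] by (simp add: approx_def)
    show "cmod (F (t w) - s w (t' (X n))) \<le> e n * \<bar>K\<bar> * sn w" for w
    proof -
      have "cmod (F (t w) - s w (t' (X n))) \<le> e n * sn (t w)"
        using e(2)[of n] by (simp add: approx_def t(2)[symmetric])
      also have "sn (t w) \<le> \<bar>K\<bar> * sn w"
        using t(1)[of w] mult_right_mono[OF abs_ge_self[of K] sn_nonneg[of w]] by linarith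
      then have "e n * sn (t w) \<le> e n * (\<bar>K\<bar> * sn w)"
        using e(2)[of n] by (intro mult_left_mono) (auto simp: approx_def)
      finally show ?thesis by (simp add: mult.assoc)
    qed
  qed
  moreover have "(\<lambda>n. e n * \<bar>K\<bar>) \<longlonglongrightarrow> 0" using tendsto_mult_right[OF e(1), of "\<bar>K\<bar>"] by simp
  ultimately have a: "approximates (\<lambda>v. F (t v)) (\<lambda>n. t' (X n))"
    unfolding approximates_def by (intro exI[of _ "\<lambda>n. e n * \<bar>K\<bar>"]) simp
  have "(\<lambda>n. G (t' (X n))) \<longlonglongrightarrow> dip (\<lambda>v. F (t v)) G" by (rule approximates_tendsto[OF Ft G a])
  then show ?thesis using approximates_tendsto[OF F Gt X] LIMSEQ_unique by blast
qed

text \<open>Automatic continuity of star representations: for \<open>x \<noteq> 0\<close>,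
  \<open>1 - star x * x / norm x ^ 2\<close> is a square \<open>c * c\<close>, and nonnegativity of
  the form at \<open>t c v\<close> is the bound. The laws for \<open>t\<close> are required inside
  \<open>s\<close> only, since on lists a sum of multipliers does not act as the concatenation of
  the two actions.\<close>

lemma sn_action_le:
  fixes t :: "'c::unital_cstar_algebra \<Rightarrow> 'v \<Rightarrow> 'v"
  assumes D: "cstar_subalgebra D" and x: "x \<in> D"
    and adj: "\<And>y u v. y \<in> D \<Longrightarrow> s (t y u) v = s u (t (star y) v)"
    and mul: "\<And>y z u v. \<lbrakk>y \<in> D; z \<in> D\<rbrakk> \<Longrightarrow> s u (t y (t z v)) = s u (t (y * z) v)"
    and add: "\<And>y z u v. \<lbrakk>y \<in> D; z \<in> D\<rbrakk> \<Longrightarrow> s u (t (y + z) v) = s u (t y v) + s u (t z v)"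
    and scale: "\<And>r y u v. y \<in> D \<Longrightarrow> s u (t (r *\<^sub>R y) v) = complex_of_real r * s u (t y v)"
    and one: "\<And>u v. s u (t 1 v) = s u v"
  shows "sn (t x v) \<le> norm x * sn v"
proof -
  have Dc: "1 \<in> D" "\<And>y. y \<in> D \<Longrightarrow> star y \<in> D" "\<And>y z. \<lbrakk>y \<in> D; z \<in> D\<rbrakk> \<Longrightarrow> y * z \<in> D"
    using D by (auto simp: cstar_subalgebra_def)
  have sq: "(sn (t y v))\<^sup>2 = Re (s v (t (star y * y) v))" if "y \<in> D" for y v
    using that by (simp add: sn_power2 adj mul Dc)
  show ?thesis
  proof (cases "x = 0")
    case True
    then have "(sn (t x v))\<^sup>2 = 0" using sq[OF x, of v] scale[of 0 v 0 v] x by simp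
    then show ?thesis using True by simp
  next
    case False
    define y where "y = (1 / (norm x)\<^sup>2) *\<^sub>R (star x * x)"
    have "norm y \<le> 1" using False by (simp add: y_def cstar_identity)
    moreover have y: "y \<in> D" unfolding y_def by (intro cstar_subalgebra_scaleR[OF D] Dc x)
    moreover have "star y = y" by (simp add: y_def star_scaleR star_mult star_star)
    ultimately obtain c where c: "c \<in> D" "star c = c" "c * c = 1 - y"
      using cstar_sqrt_one_minus[OF D] by blast
    have "c * c = 1 + (- (1 / (norm x)\<^sup>2)) *\<^sub>R (star x * x)" by (simp add: c(3) y_def)
    then have "s v (t (star c * c) v) = s v v - complex_of_real (1 / (norm x)\<^sup>2) * s v (t (star x * x) v)"
      using x by (simp add: c(2) add scale one Dc cstar_subalgebra_scaleR[OF D] del: scaleR_minus_left)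
    then have "(sn (t c v))\<^sup>2 = (sn v)\<^sup>2 - (1 / (norm x)\<^sup>2) * (sn (t x v))\<^sup>2"
      by (simp only: sq[OF c(1)] sq[OF x] minus_complex.sel sn_power2[of v] times_complex.sel complex_of_real_def complex.sel)
    then have "0 \<le> (sn v)\<^sup>2 - (1 / (norm x)\<^sup>2) * (sn (t x v))\<^sup>2" by (metis zero_le_power2)
    then have "(sn (t x v))\<^sup>2 \<le> (norm x * sn v)\<^sup>2"
      using False by (simp add: field_simps power_mult_distrib)
    then show ?thesis by (rule power2_le_imp_le) simp
  qed
qed

end

section \<open>Positive operators\<close>

lemma cinner_scaleR_right: "cinner x (r *\<^sub>R y) = complex_of_real r * cinner x (y::'g::chilbert_space)"
  by (simp add: scaleC_of_real[symmetric] cinner_scaleC_right)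

lemma cinner_app_commute: "star T = T \<Longrightarrow> cinner h (app T g) = cnj (cinner g (app T (h::'g::chilbert_space)))"
  by (metis cinner_commute cinner_star_left)

lemma psd_form_bop:
  fixes T :: "'g::chilbert_space bop"
  assumes "star T = T" "\<And>g. 0 \<le> Re (cinner g (app T g))"
  shows "psd_form (+) scaleC (\<lambda>h g. cinner h (app T g))"
  by unfold_locales
    (use assms(2) in \<open>auto simp: app_add cinner_add_right app_scaleC cinner_scaleC_right
      intro: cinner_app_commute[OF assms(1)]\<close>)

lemma norm_bop_bound_cinner:
  fixes T :: "'g::chilbert_space bop"
  assumes c: "0 \<le> c" and b: "\<And>h g. cmod (cinner h (app T g)) \<le> c * norm h * norm g"
  shows "norm T \<le> c"
proof (rule norm_bop_bound[OF c])
  fix g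
  have "(norm (app T g))\<^sup>2 = cmod (cinner (app T g) (app T g))"
    by (simp only: cinner_self norm_of_real abs_power2)
  also have "\<dots> \<le> c * norm (app T g) * norm g" by (rule b)
  finally have "norm (app T g) * norm (app T g) \<le> (c * norm g) * norm (app T g)"
    by (simp add: power2_eq_square mult_ac)
  then show "norm (app T g) \<le> c * norm g"
    using c by (cases "app T g = 0") (auto dest: mult_right_le_imp_le)
qed

text \<open>The Cauchy-Schwarz inequality for the form \<open>cinner h (app T g)\<close> turns a
  bound on the diagonal into one on all matrix coefficients, hence on the norm.\<close>

lemma norm_bop_le_quadratic:
  fixes T :: "'g::chilbert_space bop"
  assumes T: "star T = T" "\<And>g. 0 \<le> Re (cinner g (app T g))"
    and c: "0 \<le> c" and b: "\<And>g. Re (cinner g (app T g)) \<le> c * (norm g)\<^sup>2"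
  shows "norm T \<le> c"
proof (rule norm_bop_bound_cinner[OF c])
  interpret psd_form "(+)" scaleC "\<lambda>h g. cinner h (app T g)" by (rule psd_form_bop[OF T])
  have sn: "sn g \<le> sqrt c * norm g" for g
    unfolding sn_def using real_sqrt_le_mono[OF b, of g] by (simp add: real_sqrt_mult)
  fix h g
  have "cmod (cinner h (app T g)) \<le> sn h * sn g" by (rule s_cauchy_schwarz)
  also have "\<dots> \<le> (sqrt c * norm h) * (sqrt c * norm g)" using c by (intro mult_mono sn) auto
  also have "\<dots> = c * norm h * norm g" using c by simp
  finally show "cmod (cinner h (app T g)) \<le> c * norm h * norm g" .
qed

lemma Re_cinner_bop_le: "Re (cinner g (app T g)) \<le> norm T * (norm (g::'g::chilbert_space))\<^sup>2"
proof -
  have "Re (cinner g (app T g)) \<le> norm g * norm (app T g)"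
    using cmod_cinner_le[of g "app T g"] complex_Re_le_cmod order_trans by blast
  also have "\<dots> \<le> norm g * (norm T * norm g)" by (intro mult_left_mono norm_app) simp
  finally show ?thesis by (simp add: power2_eq_square mult_ac)
qed

text \<open>In spectral terms \<open>T\<close> lies between \<open>e\<close> and \<open>t\<close>,
  so \<open>1 - T / t\<close> lies between \<open>0\<close> and \<open>1 - e / t\<close>. The case
  \<open>e = 0\<close> prepares square roots, the case \<open>e > 0\<close> inverses.\<close>

lemma norm_one_minus_scaled_bop:
  fixes T :: "'g::chilbert_space bop"
  assumes T: "star T = T" "\<And>g. e * (norm g)\<^sup>2 \<le> Re (cinner g (app T g))"
    and t: "norm T \<le> t" "0 < t" "e \<le> t"
  shows "norm (1 - (1 / t) *\<^sub>R T) \<le> 1 - e / t"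
proof (rule norm_bop_le_quadratic)
  show "star (1 - (1 / t) *\<^sub>R T) = 1 - (1 / t) *\<^sub>R T" by (simp add: star_diff star_scaleR T)
  have eq: "Re (cinner g (app (1 - (1 / t) *\<^sub>R T) g)) = (norm g)\<^sup>2 - Re (cinner g (app T g)) / t" for g :: 'g
    by (simp add: cinner_diff_right cinner_scaleR_right cinner_self)
  fix g :: 'g
  have "Re (cinner g (app T g)) \<le> t * (norm g)\<^sup>2"
    using Re_cinner_bop_le[of g T] mult_right_mono[OF t(1), of "(norm g)\<^sup>2"] by simp
  then show "0 \<le> Re (cinner g (app (1 - (1 / t) *\<^sub>R T) g))"
    unfolding eq using t(2) by (simp add: pos_divide_le_eq mult.commute)
  have "e * (norm g)\<^sup>2 / t \<le> Re (cinner g (app T g)) / t"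
    using t(2) by (intro divide_right_mono T(2)) auto
  then show "Re (cinner g (app (1 - (1 / t) *\<^sub>R T) g)) \<le> (1 - e / t) * (norm g)\<^sup>2"
    unfolding eq by (simp add: left_diff_distrib)
qed (use t in simp)

text \<open>Up to a scalar \<open>T\<close> is \<open>1 - S\<close> with
  \<open>norm S \<le> 1\<close>, and the square root series stays in \<open>B\<close>. Positivity in
  \<open>B\<close> can therefore be tested on vectors.\<close>

lemma positive_element_bop:
  fixes T :: "'g::chilbert_space bop"
  assumes B: "cstar_subalgebra B" and T: "T \<in> B" "star T = T" "\<And>g. 0 \<le> Re (cinner g (app T g))"
  shows "positive_element B T"
proof (cases "T = 0")
  case True
  then show ?thesis unfolding positive_element_def
    by (intro bexI[of _ 0]) (use T in auto)
next
  case False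
  define S where "S = 1 - (1 / norm T) *\<^sub>R T"
  have "norm S \<le> 1 - 0 / norm T"
    unfolding S_def using False T by (intro norm_one_minus_scaled_bop) auto
  moreover have "S \<in> B" unfolding S_def
    using B T(1) cstar_subalgebra_scaleR[OF B T(1)] by (intro cstar_subalgebra_diff) (auto simp: cstar_subalgebra_def)
  moreover have "star S = S" by (simp add: S_def star_diff star_scaleR T)
  ultimately obtain c where c: "c \<in> B" "star c = c" "c * c = 1 - S"
    using cstar_sqrt_one_minus[OF B, of S] by auto
  have "star (sqrt (norm T) *\<^sub>R c) * (sqrt (norm T) *\<^sub>R c) = norm T *\<^sub>R (c * c)"
    by (simp add: star_scaleR c(2))
  also have "\<dots> = T" using False by (simp add: c(3) S_def)
  finally show ?thesis unfolding positive_element_def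
    using cstar_subalgebra_scaleR[OF B c(1)] by metis
qed

lemma bop_plus_scalar_inverse:
  fixes T :: "'g::chilbert_space bop"
  assumes B: "cstar_subalgebra B" and T: "T \<in> B" "star T = T" "\<And>g. 0 \<le> Re (cinner g (app T g))"
    and e: "0 < e"
  shows "\<exists>R\<in>B. (T + e *\<^sub>R 1) * R = 1"
proof -
  define U where "U = T + e *\<^sub>R (1 :: 'g bop)"
  \<comment> \<open>The summand \<open>e\<close> secures \<open>0 < t\<close> and
    \<open>e \<le> t\<close> at once; on the zero space \<open>norm U\<close> alone would be
    \<open>0\<close>.\<close>
  define t where "t = norm U + e"
  define S where "S = 1 - (1 / t) *\<^sub>R U"
  have t: "0 < t" using e by (simp add: t_def add_nonneg_pos)
  have B1: "1 \<in> B" "\<And>x y. x \<in> B \<Longrightarrow> y \<in> B \<Longrightarrow> x + y \<in> B" using B by (auto simp: cstar_subalgebra_def)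
  have U: "U \<in> B" "star U = U"
    using T B1 cstar_subalgebra_scaleR[OF B] by (auto simp: U_def star_add star_scaleR)
  have "norm S \<le> 1 - e / t"
    unfolding S_def
  proof (rule norm_one_minus_scaled_bop[OF U(2) _ _ t])
    show "e * (norm g)\<^sup>2 \<le> Re (cinner g (app U g))" for g
      using T(3)[of g] by (simp add: U_def cinner_add_right cinner_scaleR_right cinner_self)
  qed (use e in \<open>auto simp: t_def\<close>)
  then have "norm S < 1" using t e by (simp add: order_le_less_trans)
  moreover have "S \<in> B" unfolding S_def
    using B B1 U(1) cstar_subalgebra_scaleR[OF B U(1)] by (intro cstar_subalgebra_diff) auto
  ultimately obtain R where R: "R \<in> B" "(1 - S) * R = 1" using cstar_one_minus_inverse[OF B] by blast
  have "U * ((1 / t) *\<^sub>R R) = 1" using R(2) by (simp add: S_def)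
  then show ?thesis using cstar_subalgebra_scaleR[OF B R(1)] unfolding U_def by blast
qed

lemma bop_of_sesquilinear:
  fixes f :: "'g::chilbert_space \<Rightarrow> 'g \<Rightarrow> complex"
  assumes add: "\<And>h h' g. f (h + h') g = f h g + f h' g" "\<And>h g g'. f h (g + g') = f h g + f h g'"
    and sc: "\<And>c h g. f (c *\<^sub>C h) g = cnj c * f h g" "\<And>c h g. f h (c *\<^sub>C g) = c * f h g"
    and bd: "\<And>h g. cmod (f h g) \<le> C * norm h * norm g"
  shows "\<exists>T. \<forall>h g. cinner h (app T g) = f h g"
proof -
  have "\<exists>y. \<forall>h. cinner h y = f h g" for g
  proof -
    have "bounded_linear (\<lambda>h. Re (f h g))"
    proof (rule bounded_linear_intro)
      show "Re (f (r *\<^sub>R h) g) = r *\<^sub>R Re (f h g)" for r h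
        using sc(1)[of "complex_of_real r" h g] by (simp add: scaleC_of_real)
      show "norm (Re (f h g)) \<le> norm h * (C * norm g)" for h
        using bd[of h g] abs_Re_le_cmod[of "f h g"] by (simp add: mult_ac)
    qed (simp add: add)
    then obtain y where y: "\<And>h. Re (f h g) = inner y h" using riesz_representation_real by blast
    have re: "Re (cinner h y) = Re (f h g)" for h by (simp add: Re_cinner y inner_commute)
    have "cinner h y = f h g" for h
    proof (rule complex_eqI[OF re])
      \<comment> \<open>By conjugate linearity in \<open>h\<close>, the real part at the imaginary
        unit times \<open>h\<close> is the imaginary part at \<open>h\<close>.\<close>
      show "Im (cinner h y) = Im (f h g)"
        using re[of "\<i> *\<^sub>C h"] by (simp add: cinner_scaleC_left sc)
    qed
    then show ?thesis by blast
  qed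
  then obtain T where T: "\<And>h g. cinner h (T g) = f h g" by metis
  have lin: "T (x + y) = T x + T y" "T (c *\<^sub>C x) = c *\<^sub>C T x" for x y c
    by (rule cinner_eqI, simp add: T cinner_add_right cinner_scaleC_right add sc)+
  have bl: "bounded_linear T"
  proof (rule bounded_linear_intro[OF lin(1)])
    show "T (r *\<^sub>R x) = r *\<^sub>R T x" for r x
      using lin(2)[of "complex_of_real r" x] by (simp add: scaleC_of_real)
    show "norm (T x) \<le> norm x * \<bar>C\<bar>" for x
    proof -
      have "(norm (T x))\<^sup>2 = cmod (f (T x) x)"
        by (simp only: T[symmetric] cinner_self norm_of_real abs_power2)
      also have "\<dots> \<le> C * norm (T x) * norm x" by (rule bd)
      also have "\<dots> \<le> \<bar>C\<bar> * norm (T x) * norm x" by (intro mult_right_mono) auto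
      finally have "norm (T x) * norm (T x) \<le> (norm x * \<bar>C\<bar>) * norm (T x)"
        by (simp add: power2_eq_square mult_ac)
      then show ?thesis by (cases "T x = 0") (auto dest: mult_right_le_imp_le)
    qed
  qed
  have "app (bop_of_blinfun (Blinfun T)) x = T x" for x
    using bl lin by (simp add: app_def bop_of_blinfun_inverse bounded_linear_Blinfun_apply)
  then show ?thesis using T by metis
qed

lemma bop_eq_cinnerI:
  fixes S T :: "'g::chilbert_space bop"
  assumes "\<And>h g. cinner h (app S g) = cinner h (app T g)" shows "S = T"
  by (rule bop_eqI, rule cinner_eqI, rule assms)

lemma cstar_subalgebra_commutant:
  fixes B :: "'g::chilbert_space bop set"
  assumes "\<And>b. b \<in> B \<Longrightarrow> star b \<in> B"
  shows "cstar_subalgebra (commutant B)"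
  unfolding cstar_subalgebra_def
proof (intro conjI ballI allI closed_commutant)
  fix x y :: "'g bop" and c assume x: "x \<in> commutant B" and "y \<in> commutant B"
  then have xy: "x * b = b * x" "y * b = b * y" if "b \<in> B" for b using that by (auto simp: commutant_def)
  have "x * y * b = b * (x * y)" if "b \<in> B" for b using xy[OF that] by (metis mult.assoc)
  then show "x * y \<in> commutant B" by (simp add: commutant_def)
  show "x + y \<in> commutant B" using xy by (simp add: commutant_def distrib_left distrib_right)
next
  fix x :: "'g bop" and c assume x: "x \<in> commutant B"
  then show "c *\<^sub>C x \<in> commutant B" by (auto simp: commutant_def scaleC_mult_left scaleC_mult_right)
  have "star x * b = b * star x" if "b \<in> B" for b
  proof -
    have "x * star b = star b * x" using x assms[OF that] by (auto simp: commutant_def)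
    then have "star (x * star b) = star (star b * x)" by simp
    then show ?thesis by (simp add: star_mult star_star)
  qed
  then show "star x \<in> commutant B" by (simp add: commutant_def)
qed (simp add: commutant_def)

section \<open>Forms on lists\<close>

text \<open>A list of pairs (a, g) stands for the sum of the vectors a x g. If \<open>f a\<close> is
  the inner product of a x with y, then \<open>lfun f h v\<close> is the inner product of the vector
  \<open>v\<close> with y h.\<close>

definition lfun :: "('a \<Rightarrow> 'g::chilbert_space bop) \<Rightarrow> 'g \<Rightarrow> ('a \<times> 'g) list \<Rightarrow> complex" where
  "lfun f h v = (\<Sum>(a, g)\<leftarrow>v. cinner g (app (f a) h))"

text \<open>The inner product of a sum of a x g with a sum of b y h when \<kappa> a = <x, a y>. For
  a completely positive \<kappa> and x = y this is the Stinespring form.\<close>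

definition kform :: "('a::unital_cstar_algebra \<Rightarrow> 'g::chilbert_space bop) \<Rightarrow> ('a \<times> 'g) list \<Rightarrow> ('a \<times> 'g) list \<Rightarrow> complex" where
  "kform \<kappa> u v = (\<Sum>(a, g)\<leftarrow>v. lfun (\<lambda>a'. \<kappa> (star a' * a)) g u)"

definition lsc :: "complex \<Rightarrow> ('a \<times> 'g::chilbert_space) list \<Rightarrow> ('a \<times> 'g) list" where
  "lsc c = map (\<lambda>(a, g). (a, c *\<^sub>C g))"

definition lmul :: "'a::times \<Rightarrow> ('a \<times> 'g) list \<Rightarrow> ('a \<times> 'g) list" where
  "lmul a = map (\<lambda>(a', g). (a * a', g))"

text \<open>For \<open>T\<close> in the commutant of \<open>B\<close> this is the action sending a x
  g to a x (T g), which exists on the Hilbert space although not on the module.\<close>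

definition lapp :: "'g::chilbert_space bop \<Rightarrow> ('a \<times> 'g) list \<Rightarrow> ('a \<times> 'g) list" where
  "lapp T = map (\<lambda>(a, g). (a, app T g))"

lemma lmul_simps [simp]:
  "lmul b [] = []" "lmul b ((a, g) # v) = (b * a, g) # lmul b v" "lmul b (u @ v) = lmul b u @ lmul b v"
  by (simp_all add: lmul_def)

lemma lsc_simps [simp]:
  "lsc c [] = []" "lsc c ((a, g) # v) = (a, c *\<^sub>C g) # lsc c v" "lsc c (u @ v) = lsc c u @ lsc c v"
  by (simp_all add: lsc_def)

lemma lapp_simps [simp]:
  "lapp T [] = []" "lapp T ((a, g) # v) = (a, app T g) # lapp T v" "lapp T (u @ v) = lapp T u @ lapp T v"
  by (simp_all add: lapp_def)

lemma lfun_simps [simp]: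
  "lfun f h [] = 0" "lfun f h ((a, g) # v) = cinner g (app (f a) h) + lfun f h v"
  "lfun f h (u @ v) = lfun f h u + lfun f h v"
  by (simp_all add: lfun_def)

lemma kform_simps [simp]:
  "kform \<kappa> u [] = 0" "kform \<kappa> u ((a, g) # v) = lfun (\<lambda>a'. \<kappa> (star a' * a)) g u + kform \<kappa> u v"
  "kform \<kappa> u (v @ w) = kform \<kappa> u v + kform \<kappa> u w"
  by (simp_all add: kform_def)

lemma lfun_lsc: "lfun f h (lsc c v) = cnj c * lfun f h v"
  by (induction v) (auto simp: cinner_scaleC_left distrib_left)

lemma lfun_add: "lfun f (h + h') v = lfun f h v + lfun f h' v"
  by (induction v) (auto simp: app_add cinner_add_right)

lemma lfun_scale: "lfun f (c *\<^sub>C h) v = c * lfun f h v"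
  by (induction v) (auto simp: app_scaleC cinner_scaleC_right distrib_left)

lemma lfun_add_fun: "lfun (\<lambda>a. f a + f' a) h v = lfun f h v + lfun f' h v"
  by (induction v) (auto simp: cinner_add_right)

lemma lfun_minus_fun: "lfun (\<lambda>a. - f a) h v = - lfun f h v"
  by (induction v) (auto simp: cinner_minus_right)

lemma lfun_scale_fun: "lfun (\<lambda>a. c *\<^sub>C f a) h v = c * lfun f h v"
  by (induction v) (auto simp: cinner_scaleC_right distrib_left)

lemma lfun_mult_fun: "lfun (\<lambda>a. f a * T) h v = lfun f (app T h) v"
  by (induction v) auto

lemma lfun_lmul: "lfun f h (lmul a v) = lfun (\<lambda>a'. f (a * a')) h v"
  by (induction v) auto

lemma lfun_lapp:
  assumes "\<And>a. f a * star T = star T * f a"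
  shows "lfun f h (lapp T v) = lfun f (app (star T) h) v"
proof -
  have "cinner (app T g) (app (f a) h) = cinner g (app (f a) (app (star T) h))" for a g
    using arg_cong[OF assms[of a], of "\<lambda>S. cinner g (app S h)"] by (simp add: cinner_star_right)
  then show ?thesis by (induction v) auto
qed

lemma kform_append_left: "kform \<kappa> (u @ v) w = kform \<kappa> u w + kform \<kappa> v w"
  by (induction w) auto

lemma kform_lsc_right: "kform \<kappa> u (lsc c v) = c * kform \<kappa> u v"
  by (induction v) (auto simp: lfun_scale distrib_left)

lemma kform_lsc_left: "kform \<kappa> (lsc c u) v = cnj c * kform \<kappa> u v"
  by (induction v) (auto simp: lfun_lsc distrib_left)

lemma kform_lmul: "kform \<kappa> (lmul a u) v = kform \<kappa> u (lmul (star a) v)"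
  by (induction v) (auto simp: lfun_lmul star_mult mult.assoc)

lemma kform_lapp:
  assumes "\<And>a. \<kappa> a * star T = star T * \<kappa> a"
  shows "kform \<kappa> (lapp T u) v = kform \<kappa> u (lapp (star T) v)"
  by (induction v) (auto simp: lfun_lapp assms)

lemma kform_commute:
  assumes "\<And>a. \<kappa> (star a) = star (\<kappa> a)"
  shows "kform \<kappa> u v = cnj (kform \<kappa> v u)"
proof -
  have singleton: "lfun (\<lambda>a'. \<kappa> (star a' * a)) g u = cnj (kform \<kappa> [(a, g)] u)" for a g
  proof (induction u)
    case (Cons p u)
    have "cinner g' (app (\<kappa> (star a' * a)) g) = cnj (cinner g (app (\<kappa> (star a * a')) g'))" for a' g'
      using assms[of "star a' * a"] cinner_star_right[of g "\<kappa> (star a' * a)" g']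
      by (simp add: star_mult star_star) (metis cinner_commute)
    then show ?case using Cons by (cases p) simp
  qed simp
  show ?thesis
  proof (induction v)
    case Nil
    show ?case by (induction u) auto
  next
    case (Cons p v)
    obtain a g where p: "p = (a, g)" by (cases p)
    have "kform \<kappa> (p # v) u = kform \<kappa> [p] u + kform \<kappa> v u"
      using kform_append_left[of \<kappa> "[p]" v u] by simp
    then show ?case using Cons singleton[of a g] by (simp add: p)
  qed
qed

definition clinear_map :: "('a::complex_normed_vector \<Rightarrow> 'b::complex_normed_vector) \<Rightarrow> bool" where
  "clinear_map \<kappa> \<longleftrightarrow> (\<forall>a b. \<kappa> (a + b) = \<kappa> a + \<kappa> b) \<and> (\<forall>c a. \<kappa> (c *\<^sub>C a) = c *\<^sub>C \<kappa> a)"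

lemma clinear_map_simps:
  assumes "clinear_map \<kappa>"
  shows "\<kappa> (a + b) = \<kappa> a + \<kappa> b" "\<kappa> (c *\<^sub>C a) = c *\<^sub>C \<kappa> a" "\<kappa> (r *\<^sub>R a) = r *\<^sub>R \<kappa> a"
    "\<kappa> 0 = 0" "\<kappa> (- a) = - \<kappa> a" "\<kappa> (a - b) = \<kappa> a - \<kappa> b"
proof -
  show add: "\<kappa> (a + b) = \<kappa> a + \<kappa> b" for a b using assms by (simp add: clinear_map_def)
  show "\<kappa> (c *\<^sub>C a) = c *\<^sub>C \<kappa> a" using assms by (simp add: clinear_map_def)
  show "\<kappa> (r *\<^sub>R a) = r *\<^sub>R \<kappa> a" 
    using assms by (simp add: clinear_map_def scaleC_of_real[symmetric])
  show 0: "\<kappa> 0 = 0" using add[of 0 0] by simp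
  show m: "\<kappa> (- a) = - \<kappa> a" for a using add[of a "- a"] 0 by (simp add: eq_neg_iff_add_eq_0 add.commute)
  show "\<kappa> (a - b) = \<kappa> a - \<kappa> b" using add[of a "- b"] m[of b] by simp
qed

lemma kform_lmul_add:
  assumes "clinear_map \<kappa>"
  shows "kform \<kappa> u (lmul (a + b) v) = kform \<kappa> u (lmul a v) + kform \<kappa> u (lmul b v)"
  by (induction v) (auto simp: distrib_left distrib_right clinear_map_simps[OF assms] lfun_add_fun)

lemma kform_lmul_scaleR:
  assumes "clinear_map \<kappa>"
  shows "kform \<kappa> u (lmul (r *\<^sub>R a) v) = complex_of_real r * kform \<kappa> u (lmul a v)"
  by (induction v)
    (auto simp: clinear_map_simps[OF assms] distrib_left lfun_scale_fun[of "complex_of_real r", simplified scaleC_of_real])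

lemma lmul_lmul: "lmul a (lmul b v) = lmul (a * b) (v :: ('a::monoid_mult \<times> 'g) list)"
  and lmul_one: "lmul 1 v = (v :: ('a::monoid_mult \<times> 'g) list)"
  by (induction v) (auto simp: mult.assoc)

lemma lapp_lapp: "lapp S (lapp T v) = lapp (S * T) v" and lapp_one: "lapp 1 v = v"
  by (induction v) auto

lemma kform_lapp_add: "kform \<kappa> u (lapp (S + T) v) = kform \<kappa> u (lapp S v) + kform \<kappa> u (lapp T v)"
  by (induction v) (auto simp: lfun_add)

lemma kform_lapp_scaleR: "kform \<kappa> u (lapp (r *\<^sub>R T) v) = complex_of_real r * kform \<kappa> u (lapp T v)"
  by (induction v) (auto simp: lfun_scale distrib_left scaleC_of_real[symmetric])

lemma tendsto_lfun:
  assumes "\<And>a. (\<lambda>n. F n a) \<longlonglongrightarrow> f a"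
  shows "(\<lambda>n. lfun (F n) h v) \<longlonglongrightarrow> lfun f h v"
proof (induction v)
  case (Cons p v)
  obtain a g where p: "p = (a, g)" by (cases p)
  have "(\<lambda>n. cinner g (app (F n a) h)) \<longlonglongrightarrow> cinner g (app (f a) h)"
  proof (rule LIM_zero_cancel)
    have le: "cmod (cinner g (app (F n a) h) - cinner g (app (f a) h)) \<le> norm (F n a - f a) * (norm g * norm h)" for n
    proof -
      have "cinner g (app (F n a) h) - cinner g (app (f a) h) = cinner g (app (F n a - f a) h)"
        by (simp add: cinner_diff_right)
      then have "cmod (cinner g (app (F n a) h) - cinner g (app (f a) h)) \<le> norm g * norm (app (F n a - f a) h)"
        using cmod_cinner_le by metis
      also have "\<dots> \<le> norm g * (norm (F n a - f a) * norm h)" by (intro mult_left_mono norm_app) simp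
      finally show ?thesis by (simp add: mult_ac)
    qed
    have "(\<lambda>n. norm (F n a - f a) * (norm g * norm h)) \<longlonglongrightarrow> 0 * (norm g * norm h)"
      using assms[of a] by (intro tendsto_mult_right) (simp add: LIM_zero_iff tendsto_norm_zero_iff)
    then have z: "(\<lambda>n. norm (F n a - f a) * (norm g * norm h)) \<longlonglongrightarrow> 0" by simp
    show "(\<lambda>n. cinner g (app (F n a) h) - cinner g (app (f a) h)) \<longlonglongrightarrow> 0"
      by (rule Lim_null_comparison[OF always_eventually z]) (intro allI le)
  qed
  then show ?case using Cons unfolding p by (simp add: tendsto_add)
qed simp

section \<open>The self-dual module of a pair of vectors\<close>

lemma Cauchy_of_scaled:
  assumes "\<And>e. e > 0 \<Longrightarrow> \<exists>N. \<forall>m\<ge>N. \<forall>n\<ge>N. d m n < (e::real)" "0 \<le> K"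
    and "\<And>m n. norm (X m - X n) \<le> d m n * K"
  shows "Cauchy (X :: nat \<Rightarrow> 'x::real_normed_vector)"
proof (rule CauchyI)
  fix e :: real assume e: "0 < e"
  obtain N where N: "\<And>m n. \<lbrakk>m \<ge> N; n \<ge> N\<rbrakk> \<Longrightarrow> d m n < e / (K + 1)"
    using assms(1)[of "e / (K + 1)"] e assms(2) by auto
  have "norm (X m - X n) < e" if "m \<ge> N" "n \<ge> N" for m n
  proof -
    have "norm (X m - X n) \<le> d m n * K" by (rule assms(3))
    also have "\<dots> \<le> (e / (K + 1)) * K" using N[OF that] assms(2) by (intro mult_right_mono) auto
    also have "\<dots> < (e / (K + 1)) * (K + 1)" using e assms(2) by (intro mult_strict_left_mono) auto
    finally show ?thesis using assms(2) by simp
  qed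
  then show "\<exists>N. \<forall>m\<ge>N. \<forall>n\<ge>N. norm (X m - X n) < e" by blast
qed

definition pair_append where "pair_append u v = (fst u @ fst v, snd u @ snd v)"

definition on_both where "on_both f v = (f (fst v), f (snd v))"

text \<open>The Gram form of two vectors \<open>x\<^sub>1\<close>, \<open>x\<^sub>2\<close> with \<open>\<langle>x\<^sub>1, a x\<^sub>1\<rangle> = \<phi> a\<close>,
  \<open>\<langle>x\<^sub>1, a x\<^sub>2\<rangle> = \<kappa> a\<close> and \<open>\<langle>x\<^sub>2, a x\<^sub>2\<rangle> = \<psi> a\<close>.\<close>

definition pair_form where
  "pair_form \<phi> \<kappa> \<psi> u v = kform \<phi> (fst u) (fst v) + kform \<kappa> (fst u) (snd v)
     + cnj (kform \<kappa> (fst v) (snd u)) + kform \<psi> (snd u) (snd v)"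

text \<open>Only the diagonal entries must be Hermitian: the second off-diagonal corner is by
  construction the adjoint of the first, which is the \<open>cnj\<close> term of
  \<open>pair_form\<close>.\<close>

locale pair_kernel =
  fixes B :: "'g::chilbert_space bop set" and \<phi> \<kappa> \<psi> :: "'a::unital_cstar_algebra \<Rightarrow> 'g bop"
  assumes vN: "von_neumann_algebra B"
    and lin: "clinear_map \<phi>" "clinear_map \<kappa>" "clinear_map \<psi>"
    and inB: "\<phi> a \<in> B" "\<kappa> a \<in> B" "\<psi> a \<in> B"
    and herm: "\<phi> (star a) = star (\<phi> a)" "\<psi> (star a) = star (\<psi> a)"
    and pos: "0 \<le> Re (pair_form \<phi> \<kappa> \<psi> v v)"
begin

sublocale psd_form pair_append "\<lambda>c. on_both (lsc c)" "pair_form \<phi> \<kappa> \<psi>"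
proof
  show "pair_form \<phi> \<kappa> \<psi> u v = cnj (pair_form \<phi> \<kappa> \<psi> v u)" for u v
    using kform_commute[of \<phi> "fst u" "fst v"] kform_commute[of \<psi> "snd u" "snd v"]
    by (simp add: pair_form_def herm)
qed (rule pos | simp add: pair_form_def pair_append_def on_both_def kform_append_left kform_lsc_right
    kform_lsc_left distrib_left)+

lemma cstar_B: "cstar_subalgebra B"
  using vN by (rule von_neumann_algebra_cstar)

lemma B_closed: "1 \<in> B" "\<lbrakk>x \<in> B; y \<in> B\<rbrakk> \<Longrightarrow> x + y \<in> B" "\<lbrakk>x \<in> B; y \<in> B\<rbrakk> \<Longrightarrow> x * y \<in> B"
  "x \<in> B \<Longrightarrow> star x \<in> B" "x \<in> B \<Longrightarrow> - x \<in> B" "0 \<in> B" "\<lbrakk>x \<in> B; y \<in> B\<rbrakk> \<Longrightarrow> x - y \<in> B" "x \<in> B \<Longrightarrow> c *\<^sub>C x \<in> B"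
  using cstar_B cstar_subalgebra_uminus[OF cstar_B] cstar_subalgebra_zero[OF cstar_B] cstar_subalgebra_diff[OF cstar_B]
  by (auto simp: cstar_subalgebra_def)

lemma commutant_cstar: "cstar_subalgebra (commutant B)"
  by (rule cstar_subalgebra_commutant) (rule B_closed)

lemma commutant_star: "T \<in> commutant B \<Longrightarrow> star T \<in> commutant B"
  using commutant_cstar by (simp add: cstar_subalgebra_def)

lemma commute: "T \<in> commutant B \<Longrightarrow> b \<in> B \<Longrightarrow> b * T = T * b"
  by (auto simp: commutant_def)

text \<open>The use of B'' = B: an operator known only through its matrix coefficients is placed in
  \<open>B\<close> by checking that it commutes with B'.\<close>

lemma in_B: "(\<And>T. T \<in> commutant B \<Longrightarrow> b * T = T * b) \<Longrightarrow> b \<in> B"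
  using vN unfolding von_neumann_algebra_def commutant_def by blast

lemma pair_form_lmul: "pair_form \<phi> \<kappa> \<psi> (on_both (lmul a) u) v = pair_form \<phi> \<kappa> \<psi> u (on_both (lmul (star a)) v)"
  by (simp add: pair_form_def on_both_def kform_lmul star_star)

lemma sn_lmul_le: "sn (on_both (lmul a) v) \<le> norm a * sn v"
proof (rule sn_action_le[where D = UNIV and t = "\<lambda>a. on_both (lmul a)"])
  fix y z :: 'a and u v :: "('a \<times> 'g) list \<times> ('a \<times> 'g) list" and r
  show "pair_form \<phi> \<kappa> \<psi> u (on_both (lmul (y + z)) v)
      = pair_form \<phi> \<kappa> \<psi> u (on_both (lmul y) v) + pair_form \<phi> \<kappa> \<psi> u (on_both (lmul z) v)"
    by (simp add: pair_form_def on_both_def kform_lmul kform_lmul_add lin star_add)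
  show "pair_form \<phi> \<kappa> \<psi> u (on_both (lmul (r *\<^sub>R y)) v)
      = complex_of_real r * pair_form \<phi> \<kappa> \<psi> u (on_both (lmul y) v)"
    by (simp add: pair_form_def on_both_def kform_lmul kform_lmul_scaleR lin star_scaleR distrib_left)
qed (auto simp: pair_form_lmul, auto simp: on_both_def lmul_lmul lmul_one cstar_subalgebra_def)

lemma pair_form_lapp:
  assumes "T \<in> commutant B"
  shows "pair_form \<phi> \<kappa> \<psi> (on_both (lapp T) u) v = pair_form \<phi> \<kappa> \<psi> u (on_both (lapp (star T)) v)"
proof -
  note comm = commute[OF commutant_star[OF assms]] commute[OF assms]
  have "kform f (lapp T u) v = kform f u (lapp (star T) v)" "kform f (lapp (star T) u) v = kform f u (lapp T v)"
    if "\<And>a. f a \<in> B" for f :: "'a \<Rightarrow> 'g bop" and u v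
    using kform_lapp[of f T, OF comm(1)[OF that]] kform_lapp[of f "star T"] comm(2)[OF that]
    by (simp_all add: star_star)
  then show ?thesis using inB by (simp add: pair_form_def on_both_def)
qed

lemma sn_lapp_le:
  assumes "T \<in> commutant B"
  shows "sn (on_both (lapp T) v) \<le> norm T * sn v"
proof (rule sn_action_le[where D = "commutant B" and t = "\<lambda>a. on_both (lapp a)", OF commutant_cstar assms])
  fix y z :: "'g bop" and u v :: "('a \<times> 'g) list \<times> ('a \<times> 'g) list" and r
  assume y: "y \<in> commutant B"
  have ll: "kform \<kappa> (lapp T u) v = kform \<kappa> u (lapp (star T) v)" if "T \<in> commutant B" for T u v
    using kform_lapp[of \<kappa> T] commute[OF commutant_star[OF that] inB(2)] by simp
  show "pair_form \<phi> \<kappa> \<psi> u (on_both (lapp (r *\<^sub>R y)) v)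
      = complex_of_real r * pair_form \<phi> \<kappa> \<psi> u (on_both (lapp y) v)"
    using y cstar_subalgebra_scaleR[OF commutant_cstar y]
    by (simp add: pair_form_def on_both_def ll kform_lapp_scaleR star_scaleR distrib_left)
  assume z: "z \<in> commutant B"
  have "y + z \<in> commutant B" using y z commutant_cstar by (simp add: cstar_subalgebra_def)
  then show "pair_form \<phi> \<kappa> \<psi> u (on_both (lapp (y + z)) v)
      = pair_form \<phi> \<kappa> \<psi> u (on_both (lapp y) v) + pair_form \<phi> \<kappa> \<psi> u (on_both (lapp z) v)"
    using y z by (simp add: pair_form_def on_both_def ll kform_lapp_add star_add)
qed (auto simp: pair_form_lapp, auto simp: on_both_def lapp_lapp lapp_one)

text \<open>The module generated by \<open>x\<^sub>1\<close> and \<open>x\<^sub>2\<close>, made self-dual: an element \<open>y\<close> is represented by the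
  function \<open>a \<mapsto> (\<langle>a x\<^sub>1, y\<rangle>, \<langle>a x\<^sub>2, y\<rangle>)\<close>, and all bounded functions are admitted.\<close>

definition pfun :: "('a \<Rightarrow> 'g bop \<times> 'g bop) \<Rightarrow> 'g \<Rightarrow> ('a \<times> 'g) list \<times> ('a \<times> 'g) list \<Rightarrow> complex" where
  "pfun f h v = lfun (\<lambda>a. fst (f a)) h (fst v) + lfun (\<lambda>a. snd (f a)) h (snd v)"

definition bounded_by :: "real \<Rightarrow> ('a \<Rightarrow> 'g bop \<times> 'g bop) \<Rightarrow> bool" where
  "bounded_by C f \<longleftrightarrow> 0 \<le> C \<and> (\<forall>h v. cmod (pfun f h v) \<le> C * norm h * sn v)"

text \<open>The conjugate scalars come from \<open>a\<close> standing in the first, conjugate linear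
  slot of <a x_i, y>. A bound uniform in \<open>h\<close> says that y is a bounded operator from the
  Hilbert space of \<open>B\<close> to the completion.\<close>

definition kmod :: "('a \<Rightarrow> 'g bop \<times> 'g bop) set" where
  "kmod = {f. (\<forall>a. fst (f a) \<in> B \<and> snd (f a) \<in> B) \<and> (\<forall>a b. f (a + b) = f a + f b) \<and>
     (\<forall>c a. fst (f (c *\<^sub>C a)) = cnj c *\<^sub>C fst (f a) \<and> snd (f (c *\<^sub>C a)) = cnj c *\<^sub>C snd (f a)) \<and>
     (\<exists>C. bounded_by C f)}"

lemma kmodI:
  assumes "\<And>a. fst (f a) \<in> B" "\<And>a. snd (f a) \<in> B" "\<And>a b. f (a + b) = f a + f b"
    "\<And>c a. fst (f (c *\<^sub>C a)) = cnj c *\<^sub>C fst (f a)" "\<And>c a. snd (f (c *\<^sub>C a)) = cnj c *\<^sub>C snd (f a)"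
    "bounded_by C f"
  shows "f \<in> kmod"
  using assms unfolding kmod_def by blast

lemma kmodD:
  assumes "f \<in> kmod"
  shows "fst (f a) \<in> B" "snd (f a) \<in> B" "f (a + b) = f a + f b"
    "fst (f (c *\<^sub>C a)) = cnj c *\<^sub>C fst (f a)" "snd (f (c *\<^sub>C a)) = cnj c *\<^sub>C snd (f a)"
  using assms unfolding kmod_def by auto

lemma kmod_bounded: assumes "f \<in> kmod" obtains C where "bounded_by C f"
  using assms unfolding kmod_def by blast

lemma bounded_byD: "bounded_by C f \<Longrightarrow> 0 \<le> C" "bounded_by C f \<Longrightarrow> cmod (pfun f h v) \<le> C * norm h * sn v"
  unfolding bounded_by_def by blast+

lemma pfun_add_vec: "pfun f (h + h') = (\<lambda>v. pfun f h v + pfun f h' v)"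
  and pfun_scale_vec: "pfun f (c *\<^sub>C h) = (\<lambda>v. c * pfun f h v)"
  by (auto simp: fun_eq_iff pfun_def lfun_add lfun_scale distrib_left)

lemma pfun_add: "pfun (\<lambda>a. f a + f' a) h = (\<lambda>v. pfun f h v + pfun f' h v)"
  and pfun_minus: "pfun (\<lambda>a. - f a) h = (\<lambda>v. - pfun f h v)"
  by (auto simp: fun_eq_iff pfun_def lfun_add_fun lfun_minus_fun)

lemma pfun_ract: "pfun (\<lambda>a. (fst (f a) * b, snd (f a) * b)) h = pfun f (app b h)"
  by (auto simp: fun_eq_iff pfun_def lfun_mult_fun)

lemma pfun_lact: "pfun (\<lambda>a'. f (star a * a')) h = (\<lambda>v. pfun f h (on_both (lmul (star a)) v))"
  by (auto simp: fun_eq_iff pfun_def lfun_lmul on_both_def)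

lemma pfun_dual: "f \<in> kmod \<Longrightarrow> pfun f h \<in> dual"
proof -
  assume "f \<in> kmod"
  then obtain C where "bounded_by C f" by (rule kmod_bounded)
  then show ?thesis
  proof (intro dualI[where C = "C * norm h"])
    show "cmod (pfun f h v) \<le> C * norm h * sn v" for v by (rule bounded_byD) fact
  qed (auto simp: pfun_def pair_append_def on_both_def lfun_lsc distrib_left)
qed

lemma dn_pfun_le: "f \<in> kmod \<Longrightarrow> bounded_by C f \<Longrightarrow> dn (pfun f h) \<le> C * norm h"
  by (rule dn_le[OF pfun_dual]) (auto dest: bounded_byD)

section \<open>The operator-valued inner product\<close>

definition kip :: "('a \<Rightarrow> 'g bop \<times> 'g bop) \<Rightarrow> ('a \<Rightarrow> 'g bop \<times> 'g bop) \<Rightarrow> 'g bop" where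
  "kip f f' = (SOME T. \<forall>h g. cinner h (app T g) = dip (pfun f h) (pfun f' g))"

lemma cinner_kip:
  assumes f: "f \<in> kmod" "f' \<in> kmod"
  shows "cinner h (app (kip f f') g) = dip (pfun f h) (pfun f' g)"
proof -
  obtain C where C: "bounded_by C f" using kmod_bounded[OF f(1)] .
  obtain D where D: "bounded_by D f'" using kmod_bounded[OF f(2)] .
  have "\<exists>T. \<forall>h g. cinner h (app T g) = dip (pfun f h) (pfun f' g)"
  proof (rule bop_of_sesquilinear)
    show "cmod (dip (pfun f h) (pfun f' g)) \<le> (C * D) * norm h * norm g" for h g
    proof -
      have "cmod (dip (pfun f h) (pfun f' g)) \<le> dn (pfun f h) * dn (pfun f' g)"
        by (intro dip_cauchy_schwarz pfun_dual f)
      also have "\<dots> \<le> (C * norm h) * (D * norm g)"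
        using f C D bounded_byD(1) by (intro mult_mono dn_pfun_le) (auto simp: pfun_dual)
      finally show ?thesis by (simp add: mult_ac)
    qed
  qed (simp_all add: pfun_add_vec pfun_scale_vec dip_add_left dip_add_right dip_scale_left dip_scale_right pfun_dual f)
  then show ?thesis unfolding kip_def by (rule someI2_ex) blast
qed

lemma pfun_lapp:
  assumes "f \<in> kmod" "T \<in> commutant B"
  shows "pfun f (app T h) = (\<lambda>v. pfun f h (on_both (lapp (star T)) v))"
proof -
  have "lfun f' (app T h) v = lfun f' h (lapp (star T) v)" if "\<And>a. f' a \<in> B" for f' :: "'a \<Rightarrow> 'g bop" and v
    using lfun_lapp[of f' "star T"] commute[OF assms(2) that] by (simp add: star_star)
  then show ?thesis using kmodD(1,2)[OF assms(1)]
    by (simp add: fun_eq_iff pfun_def on_both_def)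
qed

text \<open>Elements of \<open>kmod\<close> have coordinates in \<open>B\<close>, so they intertwine
  B' with its action on lists; moving \<open>T\<close> across by \<open>dip_compose\<close> shows
  that the inner product commutes with \<open>T\<close>.\<close>

lemma kip_in_B:
  assumes f: "f \<in> kmod" "f' \<in> kmod"
  shows "kip f f' \<in> B"
proof (rule in_B, rule bop_eq_cinnerI)
  fix T h g assume T: "T \<in> commutant B"
  have "cinner h (app (kip f f' * T) g) = dip (pfun f h) (\<lambda>v. pfun f' g (on_both (lapp (star T)) v))"
    by (simp add: cinner_kip f pfun_lapp T)
  also have "\<dots> = dip (\<lambda>v. pfun f h (on_both (lapp T) v)) (pfun f' g)"
  proof (rule dip_compose[symmetric, where K = "norm T"])
    show "(\<lambda>v. pfun f' g (on_both (lapp (star T)) v)) \<in> dual"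
      using pfun_dual[OF f(2)] by (simp add: pfun_lapp[OF f(2) T, symmetric])
    have "pfun f (app (star T) h) = (\<lambda>v. pfun f h (on_both (lapp T) v))"
      by (simp add: pfun_lapp[OF f(1) commutant_star[OF T]] star_star)
    then show "(\<lambda>v. pfun f h (on_both (lapp T) v)) \<in> dual"
      using pfun_dual[OF f(1)] by metis
  qed (simp_all add: pfun_dual f sn_lapp_le pair_form_lapp T)
  also have "\<dots> = cinner (app (star T) h) (app (kip f f') g)"
    by (simp add: cinner_kip f pfun_lapp commutant_star T star_star)
  finally show "cinner h (app (kip f f' * T) g) = cinner h (app (T * kip f f') g)"
    by (simp add: cinner_star_left)
qed

text \<open>In \<open>lact\<close> the factor \<open>star a\<close> appears because <a' x_i, a y>
  equals <(star a) a' x_i, y>.\<close>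

definition kmodule :: "('a, 'g bop, 'a \<Rightarrow> 'g bop \<times> 'g bop) bimodule" where
  "kmodule = \<lparr>carrier = kmod, mult = undefined, one = undefined, zero = (\<lambda>_. 0),
     add = (\<lambda>f f' a. f a + f' a), ip = kip,
     ract = (\<lambda>f b a. (fst (f a) * b, snd (f a) * b)), lact = (\<lambda>a f a'. f (star a * a'))\<rparr>"

lemma kmodule_simps [simp]:
  "carrier kmodule = kmod" "\<zero>\<^bsub>kmodule\<^esub> = (\<lambda>_. 0)" "f \<oplus>\<^bsub>kmodule\<^esub> f' = (\<lambda>a. f a + f' a)"
  "ip kmodule = kip" "ract kmodule f b = (\<lambda>a. (fst (f a) * b, snd (f a) * b))"
  "lact kmodule a f = (\<lambda>a'. f (star a * a'))"
  by (simp_all add: kmodule_def)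

section \<open>The module operations, norm and completeness\<close>

lemma bounded_by_add:
  assumes "bounded_by C f" "bounded_by D f'" shows "bounded_by (C + D) (\<lambda>a. f a + f' a)"
proof -
  have "cmod (pfun (\<lambda>a. f a + f' a) h v) \<le> (C + D) * norm h * sn v" for h v
    using norm_triangle_mono[OF bounded_byD(2)[OF assms(1)] bounded_byD(2)[OF assms(2)], of h v h v]
    by (simp add: pfun_add distrib_right)
  then show ?thesis using assms by (simp add: bounded_by_def)
qed

lemma kmod_add: assumes "f \<in> kmod" "f' \<in> kmod" shows "(\<lambda>a. f a + f' a) \<in> kmod"
proof -
  obtain C where C: "bounded_by C f" using kmod_bounded[OF assms(1)] .
  obtain D where D: "bounded_by D f'" using kmod_bounded[OF assms(2)] .
  show ?thesis using kmodD[OF assms(1)] kmodD[OF assms(2)]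
    by (intro kmodI[OF _ _ _ _ _ bounded_by_add[OF C D]]) (auto simp: B_closed scaleC_add_right)
qed

lemma bounded_by_minus: "bounded_by C f \<Longrightarrow> bounded_by C (\<lambda>a. - f a)"
  by (simp add: bounded_by_def pfun_minus)

lemma kmod_minus: assumes "f \<in> kmod" shows "(\<lambda>a. - f a) \<in> kmod"
proof -
  obtain C where C: "bounded_by C f" using kmod_bounded[OF assms] .
  show ?thesis using kmodD[OF assms]
    by (intro kmodI[OF _ _ _ _ _ bounded_by_minus[OF C]]) (auto simp: B_closed scaleC_minus_right)
qed

lemma kmod_diff: "f \<in> kmod \<Longrightarrow> f' \<in> kmod \<Longrightarrow> (\<lambda>a. f a - f' a) \<in> kmod"
  using kmod_add[OF _ kmod_minus, of f f'] by simp

lemma kmod_zero: "(\<lambda>_. 0) \<in> kmod"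
proof (rule kmodI[where C = 0])
  have "pfun (\<lambda>_. 0) h v = 0" for h v
    using fun_cong[OF pfun_add[of "\<lambda>_. 0" "\<lambda>_. 0" h], of v] by simp
  then show "bounded_by 0 (\<lambda>_. 0)" by (simp add: bounded_by_def)
qed (auto simp: B_closed)

lemma kmod_ract: assumes "f \<in> kmod" "b \<in> B" shows "(\<lambda>a. (fst (f a) * b, snd (f a) * b)) \<in> kmod"
proof -
  obtain C where C: "bounded_by C f" using kmod_bounded[OF assms(1)] .
  have "bounded_by (C * norm b) (\<lambda>a. (fst (f a) * b, snd (f a) * b))"
    unfolding bounded_by_def pfun_ract
  proof (intro conjI allI)
    fix h v
    have "cmod (pfun f (app b h) v) \<le> C * norm (app b h) * sn v" by (rule bounded_byD[OF C])
    also have "\<dots> \<le> C * (norm b * norm h) * sn v"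
      using bounded_byD(1)[OF C] by (intro mult_right_mono mult_left_mono norm_app) auto
    finally show "cmod (pfun f (app b h) v) \<le> C * norm b * norm h * sn v" by (simp add: mult_ac)
  qed (use bounded_byD(1)[OF C] in simp)
  then show ?thesis using kmodD[OF assms(1)] assms(2)
    by (intro kmodI) (auto simp: B_closed distrib_right scaleC_mult_left)
qed

lemma kmod_lact: assumes "f \<in> kmod" shows "(\<lambda>a'. f (star a * a')) \<in> kmod"
proof -
  obtain C where C: "bounded_by C f" using kmod_bounded[OF assms(1)] .
  have "bounded_by (C * norm a) (\<lambda>a'. f (star a * a'))"
    unfolding bounded_by_def pfun_lact
  proof (intro conjI allI)
    fix h v
    have "cmod (pfun f h (on_both (lmul (star a)) v)) \<le> C * norm h * sn (on_both (lmul (star a)) v)"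
      by (rule bounded_byD[OF C])
    also have "\<dots> \<le> C * norm h * (norm a * sn v)"
      using bounded_byD(1)[OF C] sn_lmul_le[of "star a" v] by (intro mult_left_mono) auto
    finally show "cmod (pfun f h (on_both (lmul (star a)) v)) \<le> C * norm a * norm h * sn v"
      by (simp add: mult_ac)
  qed (use bounded_byD(1)[OF C] in simp)
  then show ?thesis using kmodD[OF assms(1)]
    by (intro kmodI) (auto simp: distrib_left scaleC_mult_right)
qed

lemma kmodule_abelian_group: "abelian_group kmodule"
proof (rule abelian_groupI)
  fix f assume "f \<in> carrier kmodule"
  then show "\<exists>f'\<in>carrier kmodule. f' \<oplus>\<^bsub>kmodule\<^esub> f = \<zero>\<^bsub>kmodule\<^esub>"
    by (intro bexI[of _ "\<lambda>a. - f a"]) (auto simp: kmod_minus)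
qed (auto simp: kmod_add kmod_zero add.assoc add.commute)

lemma kmodule_minus: "f \<in> kmod \<Longrightarrow> f' \<in> kmod \<Longrightarrow> f \<ominus>\<^bsub>kmodule\<^esub> f' = (\<lambda>a. f a - f' a)"
proof -
  interpret abelian_group kmodule by (rule kmodule_abelian_group)
  assume f: "f \<in> kmod" "f' \<in> kmod"
  have "\<ominus>\<^bsub>kmodule\<^esub> f' = (\<lambda>a. - f' a)" by (rule minus_equality) (auto simp: f kmod_minus)
  then show ?thesis by (simp add: a_minus_def)
qed

lemma Re_kip_self: "f \<in> kmod \<Longrightarrow> Re (cinner h (app (kip f f) h)) = (dn (pfun f h))\<^sup>2"
  by (simp add: cinner_kip dn_power2 pfun_dual)

lemma kip_star: "f \<in> kmod \<Longrightarrow> f' \<in> kmod \<Longrightarrow> star (kip f f') = kip f' f"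
proof (rule bop_eq_cinnerI)
  fix h g assume f: "f \<in> kmod" "f' \<in> kmod"
  have "cinner h (app (star (kip f f')) g) = cnj (cinner g (app (kip f f') h))"
    by (metis cinner_star_right cinner_commute)
  then show "cinner h (app (star (kip f f')) g) = cinner h (app (kip f' f) g)"
    using dip_commute[OF pfun_dual[OF f(2), of h] pfun_dual[OF f(1), of g]] by (simp add: cinner_kip f)
qed

text \<open>With \<open>bounded_by_mnorm\<close> this identifies the module norm with the least
  constant in \<open>bounded_by\<close>, so convergence in the module can be handled by estimates on
  \<open>pfun\<close>.\<close>

lemma mnorm_le_bound: "f \<in> kmod \<Longrightarrow> bounded_by C f \<Longrightarrow> mnorm kmodule f \<le> C"
proof -
  assume f: "f \<in> kmod" and C: "bounded_by C f"
  have "norm (kip f f) \<le> C\<^sup>2"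
  proof (rule norm_bop_le_quadratic)
    show "star (kip f f) = kip f f" by (rule kip_star[OF f f])
    show "Re (cinner g (app (kip f f) g)) \<le> C\<^sup>2 * (norm g)\<^sup>2" for g
      using power_mono[OF dn_pfun_le[OF f C, of g] dn_nonneg[OF pfun_dual[OF f]], of 2]
      by (simp add: Re_kip_self f power_mult_distrib)
  qed (auto simp: Re_kip_self f)
  then show ?thesis using real_sqrt_le_mono[of "norm (kip f f)" "C\<^sup>2"] bounded_byD(1)[OF C]
    by (simp add: mnorm_def)
qed

lemma bounded_by_mnorm:
  assumes f: "f \<in> kmod" shows "bounded_by (mnorm kmodule f) f"
  unfolding bounded_by_def
proof (intro conjI allI)
  fix h v
  have "(dn (pfun f h))\<^sup>2 \<le> (mnorm kmodule f * norm h)\<^sup>2"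
    using Re_cinner_bop_le[of h "kip f f"] by (simp add: Re_kip_self f power_mult_distrib mnorm_power2)
  then have "dn (pfun f h) \<le> mnorm kmodule f * norm h" by (rule power2_le_imp_le) simp
  then show "cmod (pfun f h v) \<le> mnorm kmodule f * norm h * sn v"
    using order_trans[OF dual_le_dn[OF pfun_dual[OF f]] mult_right_mono[OF _ sn_nonneg]] by blast
qed simp

text \<open>Obtained by testing on one-element lists. It makes each coordinate continuous in the
  module norm, which serves both for completeness and for definiteness.\<close>

lemma norm_coordinates_le:
  assumes "bounded_by C f"
  shows "norm (fst (f a)) \<le> C * sqrt (norm (\<phi> (star a * a)))" "norm (snd (f a)) \<le> C * sqrt (norm (\<psi> (star a * a)))"
proof -
  have sn: "sn ([(a, g)], []) \<le> sqrt (norm (\<phi> (star a * a))) * norm g"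
    "sn ([], [(a, g)]) \<le> sqrt (norm (\<psi> (star a * a))) * norm g" for g
    using real_sqrt_le_mono[OF Re_cinner_bop_le[of g "\<phi> (star a * a)"]]
      real_sqrt_le_mono[OF Re_cinner_bop_le[of g "\<psi> (star a * a)"]]
    by (simp_all add: sn_def pair_form_def real_sqrt_mult)
  note C = bounded_byD(1)[OF assms]
  show "norm (fst (f a)) \<le> C * sqrt (norm (\<phi> (star a * a)))"
  proof (rule norm_bop_bound_cinner)
    fix h g
    have "cmod (cinner h (app (fst (f a)) g)) \<le> C * norm g * sn ([(a, h)], [])"
      using bounded_byD(2)[OF assms, of g "([(a, h)], [])"] by (simp add: pfun_def)
    also have "\<dots> \<le> C * norm g * (sqrt (norm (\<phi> (star a * a))) * norm h)"
      using C by (intro mult_left_mono sn) auto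
    finally show "cmod (cinner h (app (fst (f a)) g)) \<le> C * sqrt (norm (\<phi> (star a * a))) * norm h * norm g"
      by (simp add: mult_ac)
  qed (use C in simp)
  show "norm (snd (f a)) \<le> C * sqrt (norm (\<psi> (star a * a)))"
  proof (rule norm_bop_bound_cinner)
    fix h g
    have "cmod (cinner h (app (snd (f a)) g)) \<le> C * norm g * sn ([], [(a, h)])"
      using bounded_byD(2)[OF assms, of g "([], [(a, h)])"] by (simp add: pfun_def)
    also have "\<dots> \<le> C * norm g * (sqrt (norm (\<psi> (star a * a))) * norm h)"
      using C by (intro mult_left_mono sn) auto
    finally show "cmod (cinner h (app (snd (f a)) g)) \<le> C * sqrt (norm (\<psi> (star a * a))) * norm h * norm g"
      by (simp add: mult_ac)
  qed (use C in simp)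
qed

lemma kmodule_complete:
  assumes X: "\<And>n. X n \<in> kmod"
    and C: "\<And>e. e > 0 \<Longrightarrow> \<exists>N. \<forall>m\<ge>N. \<forall>n\<ge>N. mnorm kmodule (\<lambda>a. X m a - X n a) < e"
  shows "\<exists>f\<in>kmod. (\<lambda>n. mnorm kmodule (\<lambda>a. X n a - f a)) \<longlonglongrightarrow> 0"
proof -
  define d where "d m n = mnorm kmodule (\<lambda>a. X m a - X n a)" for m n
  have bd: "bounded_by (d m n) (\<lambda>a. X m a - X n a)" for m n
    unfolding d_def by (intro bounded_by_mnorm kmod_diff X)
  have Cd: "\<exists>N. \<forall>m\<ge>N. \<forall>n\<ge>N. d m n < e" if "e > 0" for e using C[OF that] by (simp add: d_def)
  have c1: "Cauchy (\<lambda>n. fst (X n a))" for a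
    by (rule Cauchy_of_scaled[OF Cd, where K = "sqrt (norm (\<phi> (star a * a)))"])
      (use norm_coordinates_le(1)[OF bd, where a = a] in simp_all)
  have c2: "Cauchy (\<lambda>n. snd (X n a))" for a
    by (rule Cauchy_of_scaled[OF Cd, where K = "sqrt (norm (\<psi> (star a * a)))"])
      (use norm_coordinates_le(2)[OF bd, where a = a] in simp_all)
  have "\<exists>p. (\<lambda>n. X n a) \<longlonglongrightarrow> p" for a
  proof -
    obtain p q where "(\<lambda>n. fst (X n a)) \<longlonglongrightarrow> p" "(\<lambda>n. snd (X n a)) \<longlonglongrightarrow> q"
      using Cauchy_convergent[OF c1[of a]] Cauchy_convergent[OF c2[of a]] by (auto simp: convergent_def)
    from tendsto_Pair[OF this] show ?thesis by auto
  qed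
  then obtain f where f: "\<And>a. (\<lambda>n. X n a) \<longlonglongrightarrow> f a" by metis
  have clB: "closed B" using cstar_B by (simp add: cstar_subalgebra_def)
  \<comment> \<open>For fixed \<open>h\<close> and \<open>v\<close> only finitely many coordinates
    occur, so the bound for \<open>X n - X m\<close> survives the limit in \<open>m\<close>.\<close>
  have b: "bounded_by e (\<lambda>a. X n a - f a)" if e: "0 < e" and N: "\<And>m n. \<lbrakk>m \<ge> N; n \<ge> N\<rbrakk> \<Longrightarrow> d m n < e" and n: "n \<ge> N" for e N n
    unfolding bounded_by_def
  proof (intro conjI allI)
    fix h v
    have "(\<lambda>m. pfun (\<lambda>a. X n a - X m a) h v) \<longlonglongrightarrow> pfun (\<lambda>a. X n a - f a) h v"
      unfolding pfun_def by (intro tendsto_add tendsto_lfun tendsto_fst tendsto_snd tendsto_diff tendsto_const f)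
    then have "(\<lambda>m. cmod (pfun (\<lambda>a. X n a - X m a) h v)) \<longlonglongrightarrow> cmod (pfun (\<lambda>a. X n a - f a) h v)"
      by (rule tendsto_norm)
    moreover have "cmod (pfun (\<lambda>a. X n a - X m a) h v) \<le> e * norm h * sn v" if "m \<ge> N" for m
    proof -
      have "cmod (pfun (\<lambda>a. X n a - X m a) h v) \<le> d n m * norm h * sn v" by (rule bounded_byD[OF bd])
      also have "\<dots> \<le> e * norm h * sn v" using N[OF n that] by (intro mult_right_mono) auto
      finally show ?thesis .
    qed
    ultimately show "cmod (pfun (\<lambda>a. X n a - f a) h v) \<le> e * norm h * sn v"
      by (intro LIMSEQ_le_const2[of _ "cmod (pfun (\<lambda>a. X n a - f a) h v)"]) auto
  qed (use e in simp)
  have fk: "f \<in> kmod"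
  proof -
    obtain N where N: "\<And>m n. \<lbrakk>m \<ge> N; n \<ge> N\<rbrakk> \<Longrightarrow> d m n < 1" using C[of 1] unfolding d_def by auto
    obtain D where D: "bounded_by D (X N)" using kmod_bounded[OF X] .
    have "bounded_by (D + 1) (\<lambda>a. X N a + - (X N a - f a))"
      by (intro bounded_by_add D bounded_by_minus b[of 1 N]) (use N in auto)
    then have "bounded_by (D + 1) f" by simp
    moreover have "fst (f a) \<in> B" "snd (f a) \<in> B" for a
      using closed_sequentially[OF clB kmodD(1)[OF X] tendsto_fst[OF f]]
        closed_sequentially[OF clB kmodD(2)[OF X] tendsto_snd[OF f]] by auto
    moreover have "f (a + a') = f a + f a'" for a a'
      using LIMSEQ_unique[OF f[of "a + a'"]] tendsto_add[OF f[of a] f[of a']] kmodD(3)[OF X] by simp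
    moreover have "fst (f (c *\<^sub>C a)) = cnj c *\<^sub>C fst (f a)" for c a
      using LIMSEQ_unique[OF tendsto_fst[OF f[of "c *\<^sub>C a"]]]
        bounded_linear.tendsto[OF bounded_linear_scaleC tendsto_fst[OF f[of a]], of "cnj c"] kmodD(4)[OF X] by simp
    moreover have "snd (f (c *\<^sub>C a)) = cnj c *\<^sub>C snd (f a)" for c a
      using LIMSEQ_unique[OF tendsto_snd[OF f[of "c *\<^sub>C a"]]]
        bounded_linear.tendsto[OF bounded_linear_scaleC tendsto_snd[OF f[of a]], of "cnj c"] kmodD(5)[OF X] by simp
    ultimately show ?thesis by (intro kmodI)
  qed
  have "(\<lambda>n. mnorm kmodule (\<lambda>a. X n a - f a)) \<longlonglongrightarrow> 0"
  proof (rule LIMSEQ_I)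
    fix e :: real assume e: "0 < e"
    obtain N where N: "\<And>m n. \<lbrakk>m \<ge> N; n \<ge> N\<rbrakk> \<Longrightarrow> d m n < e / 2" using C[of "e / 2"] e unfolding d_def by auto
    have "mnorm kmodule (\<lambda>a. X n a - f a) \<le> e / 2" if "n \<ge> N" for n
      using e N that by (intro mnorm_le_bound kmod_diff X fk b[of "e / 2" N]) auto
    then have "norm (mnorm kmodule (\<lambda>a. X n a - f a) - 0) < e" if "n \<ge> N" for n
      using that e by (force simp: abs_of_nonneg)
    then show "\<exists>N. \<forall>n\<ge>N. norm (mnorm kmodule (\<lambda>a. X n a - f a) - 0) < e" by blast
  qed
  then show ?thesis using fk by blast
qed

lemma kmodule_hilbert_bimodule: "hilbert_bimodule kmodule B"
proof -
  interpret abelian_group kmodule by (rule kmodule_abelian_group)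
  show ?thesis
  \<comment> \<open>The goals follow the order of the axioms: 1 is \<open>coefficients\<close>, 7 to
    13 run from \<open>ip_closed\<close> to \<open>complete\<close>, and 15 is
    \<open>lact_star\<close>.\<close>
  proof (unfold_locales, goal_cases)
    case 1 show ?case by (rule cstar_B)
  next
    case (7 x y) then show ?case by (simp add: kip_in_B)
  next
    case (8 x y z)
    then show ?case
      by (intro bop_eq_cinnerI) (simp add: cinner_kip kmod_add pfun_add dip_add_right pfun_dual cinner_add_right)
  next
    case (9 x y b)
    then show ?case
      by (intro bop_eq_cinnerI) (simp add: cinner_kip kmod_ract pfun_ract)
  next
    case (10 x y) then show ?case by (simp add: kip_star)
  next
    case (11 x)
    then show ?case
      by (simp, intro positive_element_bop cstar_B kip_in_B kip_star) (simp_all add: Re_kip_self)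
  next
    case (12 x)
    then have x: "x \<in> kmod" "kip x x = 0" by simp_all
    then have "bounded_by 0 x" using bounded_by_mnorm[OF x(1)] by (simp add: mnorm_def)
    from norm_coordinates_le[OF this] show ?case by (simp add: fun_eq_iff prod_eq_iff)
  next
    case (13 X)
    then have "\<exists>f\<in>kmod. (\<lambda>n. mnorm kmodule (\<lambda>a. X n a - f a)) \<longlonglongrightarrow> 0"
      by (intro kmodule_complete) (simp_all add: kmodule_minus)
    then show ?case using 13(1) by (simp add: kmodule_minus cong: bex_cong_simp)
  next
    case (15 x y a)
    then have xy: "x \<in> kmod" "y \<in> kmod" by simp_all
    show ?case
    proof (simp, rule bop_eq_cinnerI)
      fix h g
      have "dip (\<lambda>v. pfun x h (on_both (lmul (star a)) v)) (pfun y g) = dip (pfun x h) (\<lambda>v. pfun y g (on_both (lmul a) v))"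
      proof (rule dip_compose[where K = "norm a"])
        show "(\<lambda>v. pfun x h (on_both (lmul (star a)) v)) \<in> dual"
          using pfun_dual[OF kmod_lact[OF xy(1)], of a h] by (simp add: pfun_lact)
        show "(\<lambda>v. pfun y g (on_both (lmul a) v)) \<in> dual"
          using pfun_dual[OF kmod_lact[OF xy(2)], of "star a" g] pfun_lact[of y "star a" g] by (simp add: star_star)
        show "sn (on_both (lmul (star a)) v) \<le> norm a * sn v" for v using sn_lmul_le[of "star a" v] by simp
      qed (simp_all add: pfun_dual xy pair_form_lmul star_star)
      then show "cinner h (app (kip (\<lambda>a'. x (star a * a')) y) g) = cinner h (app (kip x (\<lambda>a'. y (star (star a) * a'))) g)"
        using xy kmod_lact[OF xy(2), of "star a"] pfun_lact[of y "star a" g]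
        by (simp add: cinner_kip kmod_lact pfun_lact star_star)
    qed
  qed (auto simp: kmod_ract kmod_lact fun_eq_iff prod_eq_iff distrib_left distrib_right kmodD star_add
      star_scaleC star_mult mult.assoc scaleC_mult_left scaleC_mult_right)
qed

text \<open>The vectors x_1 and x_2 themselves, in the coordinates <a x_1, y> and <a x_2, y>; for
  instance <a x_2, x_1> is the adjoint of \<kappa> a = <x_1, a x_2>.\<close>

definition gen1 :: "'a \<Rightarrow> 'g bop \<times> 'g bop" where "gen1 a = (\<phi> (star a), star (\<kappa> a))"
definition gen2 :: "'a \<Rightarrow> 'g bop \<times> 'g bop" where "gen2 a = (\<kappa> (star a), \<psi> (star a))"

lemma pfun_gen1: "pfun gen1 h = (\<lambda>v. pair_form \<phi> \<kappa> \<psi> v ([(1, h)], []))"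
proof -
  have "cnj (kform \<kappa> [(1, h)] w) = lfun (\<lambda>a. star (\<kappa> a)) h w" for w
    by (induction w) (auto simp: cinner_star_right, metis cinner_commute)
  then show ?thesis by (simp add: fun_eq_iff pfun_def gen1_def pair_form_def)
qed

lemma pfun_gen2: "pfun gen2 h = (\<lambda>v. pair_form \<phi> \<kappa> \<psi> v ([], [(1, h)]))"
proof -
  have "kform \<kappa> [] v = 0" for v by (induction v) auto
  then show ?thesis by (simp add: fun_eq_iff pfun_def gen2_def pair_form_def)
qed

lemma bounded_by_vector:
  assumes "\<And>h. pfun f h = (\<lambda>v. pair_form \<phi> \<kappa> \<psi> v (e h))" "\<And>h. sn (e h) \<le> C * norm h" "0 \<le> C"
  shows "bounded_by C f"
  unfolding bounded_by_def
proof (intro conjI allI)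
  fix h v
  have "cmod (pfun f h v) \<le> sn v * sn (e h)" by (simp add: assms(1) s_cauchy_schwarz)
  also have "\<dots> \<le> sn v * (C * norm h)" by (intro mult_left_mono assms) simp
  finally show "cmod (pfun f h v) \<le> C * norm h * sn v" by (simp add: mult_ac)
qed fact

lemma gen_in_kmod: "gen1 \<in> kmod" "gen2 \<in> kmod"
proof -
  have sn: "sn ([(1, h)], []) \<le> sqrt (norm (\<phi> 1)) * norm h" "sn ([], [(1, h)]) \<le> sqrt (norm (\<psi> 1)) * norm h" for h
    using real_sqrt_le_mono[OF Re_cinner_bop_le[of h "\<phi> 1"]] real_sqrt_le_mono[OF Re_cinner_bop_le[of h "\<psi> 1"]]
    by (simp_all add: sn_def pair_form_def real_sqrt_mult)
  show "gen1 \<in> kmod"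
    by (rule kmodI[OF _ _ _ _ _ bounded_by_vector[OF pfun_gen1 sn(1)]])
      (auto simp: gen1_def inB B_closed clinear_map_simps lin star_add star_scaleC)
  show "gen2 \<in> kmod"
    by (rule kmodI[OF _ _ _ _ _ bounded_by_vector[OF pfun_gen2 sn(2)]])
      (auto simp: gen2_def inB B_closed clinear_map_simps lin star_add star_scaleC)
qed

lemma ip_gen:
  "ip kmodule gen1 (lact kmodule a gen1) = \<phi> a" "ip kmodule gen1 (lact kmodule a gen2) = \<kappa> a"
  "ip kmodule gen2 (lact kmodule a gen2) = \<psi> a"
  using kmod_lact[OF gen_in_kmod(1), of a] kmod_lact[OF gen_in_kmod(2), of a]
  by (auto intro!: bop_eq_cinnerI simp: cinner_kip gen_in_kmod pfun_gen1 pfun_gen2 dip_vector_left pfun_dual,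
     auto simp: pfun_def gen1_def gen2_def star_star)

lemma gen_rep_vectors: "gen1 \<in> rep_vectors kmodule \<phi>" "gen2 \<in> rep_vectors kmodule \<psi>"
  using gen_in_kmod ip_gen by (auto simp: rep_vectors_def simp del: kmodule_simps(4-))

lemma kmodule_common: "kmodule \<in> common_rep_modules B \<phi> \<psi>"
  using gen_rep_vectors kmodule_hilbert_bimodule by (auto simp: common_rep_modules_def)

end

section \<open>Gram matrices in Hilbert modules\<close>

definition gram_form :: "('a, 'g::chilbert_space bop, 'e) bimodule \<Rightarrow> ('e \<times> 'g) list \<Rightarrow> ('e \<times> 'g) list \<Rightarrow> complex" where
  "gram_form E u v = (\<Sum>(x, g)\<leftarrow>u. \<Sum>(y, h)\<leftarrow>v. cinner g (app (ip E x y) h))"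

lemma gram_form_simps [simp]:
  "gram_form E [] v = 0" "gram_form E ((x, g) # u) v = (\<Sum>(y, h)\<leftarrow>v. cinner g (app (ip E x y) h)) + gram_form E u v"
  "gram_form E (u @ u') v = gram_form E u v + gram_form E u' v"
  by (simp_all add: gram_form_def)

lemma gram_form_append_right: "gram_form E u (v @ v') = gram_form E u v + gram_form E u v'"
  by (induction u) auto

lemma real_nonneg_epsilon:
  assumes "0 \<le> (c::real)" "\<And>e. 0 < e \<Longrightarrow> - (e * c) \<le> x"
  shows "0 \<le> x"
proof (rule ccontr)
  assume "\<not> 0 \<le> x"
  then have x: "x < 0" by simp
  define e where "e = - x / (2 * (c + 1))"
  have e: "0 < e" using x assms(1) unfolding e_def by (intro divide_pos_pos) auto
  have "e * c \<le> e * (c + 1)" using e by simp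
  also have "\<dots> = - x / 2" using assms(1) by (simp add: e_def field_simps)
  finally show False using assms(2)[OF e] x by simp
qed

text \<open>Approximate Gram--Schmidt: subtracting from all other vectors \<open>y\<close> the approximate
  projection \<open>x (\<langle>x, x\<rangle> + e)\<^sup>-\<^sup>1 \<langle>x, y\<rangle>\<close> removes \<open>x\<close> from the list, up to an error \<open>O(e)\<close>.\<close>

lemma gram_form_nonneg:
  fixes E :: "('a, 'g::chilbert_space bop, 'e) bimodule" (structure)
  assumes E: "hilbert_module E B" and v: "fst ` set v \<subseteq> carrier E"
  shows "0 \<le> Re (gram_form E v v)"
  using v
proof (induction "length v" arbitrary: v)
  case (Suc n)
  interpret hilbert_module E B by fact
  obtain x g w where vw: "v = (x, g) # w" using Suc(2) by (cases v) auto
  have x: "x \<in> carrier E" and wE: "fst ` set w \<subseteq> carrier E" and n: "n = length w"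
    using Suc(2,3) by (auto simp: vw)
  define A where "A = ip E x x"
  have A: "A \<in> B" "star A = A" by (simp_all add: A_def ip_closed ip_star x)
  obtain c where c: "A = star c * c" using ip_positive[OF x] by (auto simp: A_def positive_element_def)
  have Apos: "0 \<le> Re (cinner h (app A h))" for h by (simp add: c cinner_star_right cinner_self)
  have bound: "- (e * ((norm g)\<^sup>2 / 2)) \<le> Re (gram_form E v v)" if e: "0 < e" for e
  proof -
    obtain R where R: "R \<in> B" "(A + e *\<^sub>R 1) * R = 1"
      using bop_plus_scalar_inverse[OF coefficients A Apos e] by blast
    define \<beta> where "\<beta> y = R * ip E x y" for y
    have \<beta>: "\<beta> y \<in> B" if "y \<in> carrier E" for y
      using coefficients R(1) ip_closed[OF x that] by (simp add: \<beta>_def cstar_subalgebra_def)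
    have xy: "ip E x y = (A + e *\<^sub>R 1) * \<beta> y" for y by (simp add: \<beta>_def R(2) mult.assoc[symmetric])
    have yx: "ip E y x = star (\<beta> y) * (A + e *\<^sub>R 1)" if "y \<in> carrier E" for y
      using ip_star[OF x that] by (simp add: xy star_mult star_add star_scaleR A)
    define p where "p y = y \<ominus> ract E x (\<beta> y)" for y
    have pE: "p y \<in> carrier E" if "y \<in> carrier E" for y
      using that x \<beta>[OF that] by (simp add: p_def ract_closed)
    \<comment> \<open>The two cross terms subtract \<open>A + e\<close> twice and the last term
      returns \<open>A\<close> once, so the Gram entries drop by the form of
      \<open>A + 2 e\<close>.\<close>
    define D where "D = A + e *\<^sub>R 1 + e *\<^sub>R 1"
    have pp: "ip E (p y) (p z) = ip E y z - star (\<beta> y) * D * \<beta> z" if y: "y \<in> carrier E" and z: "z \<in> carrier E" for y z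
    proof -
      have "ip E (p y) (p z) = ip E y z - ip E y x * \<beta> z - (star (\<beta> y) * ip E x z - star (\<beta> y) * (A * \<beta> z))"
        by (simp add: p_def ip_diff_left ip_diff_right ip_ract_left ip_ract_right ract_closed \<beta> x y z A_def algebra_simps)
      then show ?thesis
        by (simp add: xy yx[OF y] D_def algebra_simps)
    qed
    define q where "q = map (\<lambda>(y, h :: 'g). (p y, h))"
    define \<gamma> where "\<gamma> u = (\<Sum>(y, h)\<leftarrow>u. app (\<beta> y) h)" for u
    have row: "(\<Sum>(y, h)\<leftarrow>q u. cinner k (app (ip E (p z) y) h))
        = (\<Sum>(y, h)\<leftarrow>u. cinner k (app (ip E z y) h)) - cinner (app (\<beta> z) k) (app D (\<gamma> u))"
      if "z \<in> carrier E" "fst ` set u \<subseteq> carrier E" for z k u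
      using that(2)
      by (induction u)
        (auto simp: q_def \<gamma>_def pp that(1) cinner_diff_right cinner_add_right cinner_star_right app_add algebra_simps)
    have gq: "gram_form E (q u) (q w) = gram_form E u w - cinner (\<gamma> u) (app D (\<gamma> w))"
      if "fst ` set u \<subseteq> carrier E" for u
      using that
    proof (induction u)
      case (Cons r u)
      then show ?case using row[OF _ wE]
        by (cases r) (auto simp: gram_form_def \<gamma>_def cinner_add_left q_def)
    qed (simp add: gram_form_def q_def \<gamma>_def)
    have "0 \<le> Re (gram_form E (q w) (q w))"
    proof (rule Suc(1))
      show "n = length (q w)" by (simp add: q_def n)
      show "fst ` set (q w) \<subseteq> carrier E" using wE by (auto simp: q_def pE image_subset_iff)
    qed
    then have ww: "Re (cinner (\<gamma> w) (app D (\<gamma> w))) \<le> Re (gram_form E w w)" by (simp add: gq[OF wE])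
    have r: "(\<Sum>(y, h)\<leftarrow>u. cinner g (app (ip E x y) h)) = cinner g (app (A + e *\<^sub>R 1) (\<gamma> u))" for u
      by (induction u) (auto simp: \<gamma>_def xy app_add cinner_add_right scaleR_add_right algebra_simps)
    have l: "(\<Sum>(y, h)\<leftarrow>u. cinner h (app (ip E y x) g)) = cinner (\<gamma> u) (app (A + e *\<^sub>R 1) g)"
      if "fst ` set u \<subseteq> carrier E" for u
      using that
      by (induction u) (auto simp: \<gamma>_def yx cinner_add_left cinner_star_right cinner_add_right)
    have col: "gram_form E u ((x, g) # w) = (\<Sum>(y, h)\<leftarrow>u. cinner h (app (ip E y x) g)) + gram_form E u w" for u
      by (induction u) (auto simp: gram_form_def)
    define \<gamma>0 where "\<gamma>0 = \<gamma> w"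
    have "Re (gram_form E v v) = Re (cinner g (app A g)) + Re (cinner g (app (A + e *\<^sub>R 1) \<gamma>0))
        + Re (cinner \<gamma>0 (app (A + e *\<^sub>R 1) g)) + Re (gram_form E w w)"
      by (simp add: vw col r l[OF wE] A_def[symmetric] \<gamma>0_def)
    moreover have "Re (cinner (g + \<gamma>0) (app A (g + \<gamma>0))) = Re (cinner g (app A g)) + Re (cinner g (app A \<gamma>0))
        + Re (cinner \<gamma>0 (app A g)) + Re (cinner \<gamma>0 (app A \<gamma>0))"
      by (simp add: app_add cinner_add_left cinner_add_right)
    moreover have "Re (cinner \<gamma>0 (app D \<gamma>0)) = Re (cinner \<gamma>0 (app A \<gamma>0)) + 2 * e * (norm \<gamma>0)\<^sup>2"
      by (simp add: D_def cinner_add_right cinner_scaleR_right cinner_self)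
    \<comment> \<open>Completing the square: apart from the form of \<open>A\<close> at
      \<open>g + \<gamma>0\<close>, the lower bound consists of half of this square minus half of
      \<open>e * (norm g)\<^sup>2\<close>, which is the error in \<open>bound\<close>.\<close>
    moreover have "0 \<le> e * (norm (g + 2 *\<^sub>R \<gamma>0))\<^sup>2" using e by simp
    moreover have "e * (norm (g + 2 *\<^sub>R \<gamma>0))\<^sup>2 = e * (norm g)\<^sup>2 + 4 * (e * inner g \<gamma>0) + 4 * e * (norm \<gamma>0)\<^sup>2"
      by (simp add: power2_norm_eq_inner inner_add_left inner_add_right inner_commute[of \<gamma>0 g] algebra_simps)
    moreover have "Re (cinner g (app (A + e *\<^sub>R 1) \<gamma>0)) = Re (cinner g (app A \<gamma>0)) + e * inner g \<gamma>0"
      "Re (cinner \<gamma>0 (app (A + e *\<^sub>R 1) g)) = Re (cinner \<gamma>0 (app A g)) + e * inner g \<gamma>0"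
      by (simp_all add: cinner_add_right cinner_scaleR_right Re_cinner inner_commute[of \<gamma>0 g])
    ultimately show ?thesis using ww Apos[of "g + \<gamma>0"] by (simp add: \<gamma>0_def)
  qed
  show ?case
  proof (rule real_nonneg_epsilon[OF _ bound])
    show "0 \<le> (norm g)\<^sup>2 / 2" by simp
  qed
qed simp

text \<open>The pair form is the Gram form of the vectors a x and b y, so its positivity is
  \<open>gram_form_nonneg\<close>. This is the passage from modules to kernels;
  \<open>kmodule\<close> is the way back.\<close>

lemma module_pair_kernel:
  fixes E :: "('a::unital_cstar_algebra, 'g::chilbert_space bop, 'e) bimodule" (structure)
  assumes E: "hilbert_bimodule E B" and B: "von_neumann_algebra B"
    and xy: "x \<in> carrier E" "y \<in> carrier E"
  shows "pair_kernel B (\<lambda>a. ip E x (lact E a x)) (\<lambda>a. ip E x (lact E a y)) (\<lambda>a. ip E y (lact E a y))"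
proof -
  interpret hilbert_bimodule E B by fact
  define l where "l x = map (\<lambda>(a, g::'g). (lact E a x, g))" for x
  have row: "lfun (\<lambda>a'. ip E x (lact E (star a' * a) y)) g u = (\<Sum>(x', h)\<leftarrow>l x u. cinner h (app (ip E x' (lact E a y)) g))"
    if "x \<in> carrier E" "y \<in> carrier E" for x y a g u
    using that by (induction u) (auto simp: l_def lact_mult lact_star lact_closed)
  have kf: "kform (\<lambda>a. ip E x (lact E a y)) u v = gram_form E (l x u) (l y v)"
    if "x \<in> carrier E" "y \<in> carrier E" for x y u v
  proof (induction v)
    case Nil
    show ?case by (induction u) (auto simp: l_def gram_form_def)
  next
    case (Cons p v)
    obtain a g where p: "p = (a, g)" by (cases p)
    have "gram_form E (l x u) (l y (p # v)) = gram_form E (l x u) (l y [p]) + gram_form E (l x u) (l y v)"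
      by (subst gram_form_append_right[symmetric]) (simp add: l_def)
    also have "gram_form E (l x u) (l y [p]) = lfun (\<lambda>a'. ip E x (lact E (star a' * a) y)) g u"
      unfolding row[OF that] by (simp add: gram_form_def l_def[of y] p)
    finally show ?case using Cons by (simp add: p)
  qed
  have comm: "cinner g (app (ip E x y) h) = cnj (cinner h (app (ip E y x) g))" if "x \<in> carrier E" "y \<in> carrier E" for x y g h
    unfolding ip_star[OF that(2,1), symmetric] cinner_star_right by (rule cinner_commute)
  have row_comm: "(\<Sum>(y, h)\<leftarrow>v. cinner g (app (ip E x y) h)) = cnj (gram_form E v [(x, g)])"
    if "fst ` set v \<subseteq> carrier E" "x \<in> carrier E" for v x g
    using that(1)
  proof (induction v)
    case (Cons p v)
    obtain y h where p: "p = (y, h)" by (cases p)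
    show ?case using Cons comm[OF that(2), of y g h] by (simp add: p gram_form_def)
  qed (simp add: gram_form_def)
  have cg: "gram_form E u v = cnj (gram_form E v u)" if "fst ` set u \<subseteq> carrier E" "fst ` set v \<subseteq> carrier E" for u v
    using that(1)
  proof (induction u)
    case Nil
    show ?case by (induction v) (auto simp: gram_form_def)
  next
    case (Cons p u)
    obtain x g where p: "p = (x, g)" by (cases p)
    have "gram_form E v (p # u) = gram_form E v [p] + gram_form E v u"
      using gram_form_append_right[of E v "[p]" u] by simp
    then show ?case using Cons row_comm[OF that(2), of x g] by (simp add: p)
  qed
  have lE: "fst ` set (l x u) \<subseteq> carrier E" if "x \<in> carrier E" for x u
    using that by (auto simp: l_def lact_closed)
  show ?thesis
  proof
    show "0 \<le> Re (pair_form (\<lambda>a. ip E x (lact E a x)) (\<lambda>a. ip E x (lact E a y)) (\<lambda>a. ip E y (lact E a y)) v v)" for v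
    proof -
      have "pair_form (\<lambda>a. ip E x (lact E a x)) (\<lambda>a. ip E x (lact E a y)) (\<lambda>a. ip E y (lact E a y)) v v
          = gram_form E (l x (fst v) @ l y (snd v)) (l x (fst v) @ l y (snd v))"
        using cg[OF lE lE, OF xy(2,1), of "snd v" "fst v"]
        by (simp add: pair_form_def kf xy gram_form_append_right)
      then show ?thesis using gram_form_nonneg[OF hilbert_module_axioms, of "l x (fst v) @ l y (snd v)"] lE xy by auto
    qed
    have star_ip: "ip E x (lact E (star a) x) = star (ip E x (lact E a x))" if "x \<in> carrier E" for x a
      using that ip_star[of x "lact E a x"] lact_star[of x x a] by (simp add: lact_closed)
    show "ip E x (lact E (star a) x) = star (ip E x (lact E a x))"
      "ip E y (lact E (star a) y) = star (ip E y (lact E a y))" for a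
      using star_ip xy by blast+
  qed (use xy B coefficients in \<open>auto simp: clinear_map_def lact_add ip_add_right lact_closed ip_closed lact_scaleC
      ip_ract_right cstar_subalgebra_def scaleC_mult_right\<close>)
qed

section \<open>Gluing two modules along a common vector\<close>

text \<open>The squared length of (x_1 - x_2) g, written in terms of the kernel of x_1 and x_2;
  compare \<open>gap_module\<close>.\<close>

definition gap :: "('a::unital_cstar_algebra \<Rightarrow> 'g::chilbert_space bop) \<Rightarrow> ('a \<Rightarrow> 'g bop) \<Rightarrow> ('a \<Rightarrow> 'g bop) \<Rightarrow> 'g \<Rightarrow> real" where
  "gap \<phi> \<kappa> \<psi> g = Re (cinner g (app (\<phi> 1) g)) + Re (cinner g (app (\<psi> 1) g)) - 2 * Re (cinner g (app (\<kappa> 1) g))"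

locale two_kernels = P: pair_kernel B \<phi>1 \<kappa> \<phi>2 + Q: pair_kernel B \<phi>2 \<mu> \<phi>3
  for B :: "'g::chilbert_space bop set" and \<phi>1 \<phi>2 \<phi>3 \<kappa> \<mu> :: "'a::unital_cstar_algebra \<Rightarrow> 'g bop"
begin

lemma pair_form_single:
  "pair_form \<phi>1 \<kappa> \<phi>2 ([], v) ([], w) = kform \<phi>2 v w" "pair_form \<phi>1 \<kappa> \<phi>2 (u, []) (u', []) = kform \<phi>1 u u'"
  "pair_form \<phi>1 \<kappa> \<phi>2 (u, []) ([], w) = kform \<kappa> u w"
  "pair_form \<phi>2 \<mu> \<phi>3 (v, []) (w, []) = kform \<phi>2 v w" "pair_form \<phi>2 \<mu> \<phi>3 ([], u) ([], u') = kform \<phi>3 u u'"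
  "pair_form \<phi>2 \<mu> \<phi>3 (v, []) ([], u) = kform \<mu> v u"
proof -
  have [simp]: "kform \<alpha> [] v = 0" for \<alpha> :: "'a \<Rightarrow> 'g bop" and v by (induction v) auto
  show "pair_form \<phi>1 \<kappa> \<phi>2 ([], v) ([], w) = kform \<phi>2 v w" "pair_form \<phi>1 \<kappa> \<phi>2 (u, []) (u', []) = kform \<phi>1 u u'"
    "pair_form \<phi>1 \<kappa> \<phi>2 (u, []) ([], w) = kform \<kappa> u w"
    "pair_form \<phi>2 \<mu> \<phi>3 (v, []) (w, []) = kform \<phi>2 v w" "pair_form \<phi>2 \<mu> \<phi>3 ([], u) ([], u') = kform \<phi>3 u u'"
    "pair_form \<phi>2 \<mu> \<phi>3 (v, []) ([], u) = kform \<mu> v u"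
    by (simp_all add: pair_form_def)
qed

text \<open>The Stinespring space of \<open>\<phi>\<^sub>2\<close>, onto which both modules are projected.\<close>

sublocale S: psd_form "(@)" lsc "kform \<phi>2"
proof
  show "kform \<phi>2 u v = cnj (kform \<phi>2 v u)" for u v by (rule kform_commute) (rule Q.herm)
  show "0 \<le> Re (kform \<phi>2 v v)" for v using P.s_nonneg[of "([], v)"] by (simp add: pair_form_single)
qed (simp_all add: kform_lsc_right)

lemma sn_single: "P.sn ([], w) = S.sn w" "Q.sn (w, []) = S.sn w"
  by (simp_all add: P.sn_def Q.sn_def S.sn_def pair_form_single)

lemma S_sn_lmul_le: "S.sn (lmul a w) \<le> norm a * S.sn w"
  using P.sn_lmul_le[of a "([], w)"] by (simp add: on_both_def sn_single)

lemma S_sn_lapp_le: "T \<in> commutant B \<Longrightarrow> S.sn (lapp T w) \<le> norm T * S.sn w"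
  using P.sn_lapp_le[of T "([], w)"] by (simp add: on_both_def sn_single)

text \<open>\<open>F u\<close> and \<open>H v\<close> are the functionals <w, u> and <w, v> on the
  Stinespring space, that is, the projections of the vectors coded by \<open>u\<close> and
  \<open>v\<close>. The conjugate in \<open>F\<close> arises because \<phi>2 is the second entry of
  the first kernel but the first entry of the second.\<close>

definition F where "F u w = cnj (kform \<kappa> u w)"
definition H where "H v w = kform \<mu> w v"

lemma F_bound: "cmod (F u w) \<le> sqrt (Re (kform \<phi>1 u u)) * S.sn w"
  using P.s_cauchy_schwarz[of "(u, [])" "([], w)"]
  by (simp add: F_def pair_form_single P.sn_def S.sn_def)

lemma H_bound: "cmod (H v w) \<le> sqrt (Re (kform \<phi>3 v v)) * S.sn w"
  using Q.s_cauchy_schwarz[of "(w, [])" "([], v)"]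
  by (simp add: H_def pair_form_single Q.sn_def S.sn_def mult.commute)

lemma F_dual: "F u \<in> S.dual"
  by (rule S.dualI[OF _ _ F_bound]) (simp_all add: F_def kform_lsc_right)

lemma H_dual: "H v \<in> S.dual"
  by (rule S.dualI[OF _ _ H_bound]) (simp_all add: H_def kform_append_left kform_lsc_left)

lemma kform_nonneg: "0 \<le> Re (kform \<phi>1 u u)" "0 \<le> Re (kform \<phi>3 v v)"
  using P.s_nonneg[of "(u, [])"] Q.s_nonneg[of "([], v)"] by (simp_all add: pair_form_single)

text \<open>A projection does not increase norms; the loss is the squared length of the orthogonal
  component.\<close>

lemma dn_F_le: "S.dn (F u) \<le> sqrt (Re (kform \<phi>1 u u))"
  by (rule S.dn_le[OF F_dual F_bound]) (simp add: kform_nonneg)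

lemma dn_H_le: "S.dn (H v) \<le> sqrt (Re (kform \<phi>3 v v))"
  by (rule S.dn_le[OF H_dual H_bound]) (simp add: kform_nonneg)

lemma F_append: "F (u @ u') = (\<lambda>w. F u w + F u' w)"
  by (auto simp: F_def kform_append_left)

lemma H_append: "H (v @ v') = (\<lambda>w. H v w + H v' w)"
  by (auto simp: H_def)

lemma F_lmul: "F (lmul a u) = (\<lambda>w. F u (lmul (star a) w))"
  and H_lmul: "H (lmul a v) = (\<lambda>w. H v (lmul (star a) w))"
  by (auto simp: F_def H_def kform_lmul star_star)

lemma F_lapp: "T \<in> commutant B \<Longrightarrow> F (lapp T u) = (\<lambda>w. F u (lapp (star T) w))"
  using kform_lapp[of \<kappa> T u] P.commute[OF P.commutant_star P.inB(2)] by (auto simp: F_def)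

lemma H_lapp: "T \<in> commutant B \<Longrightarrow> H (lapp T v) = (\<lambda>w. H v (lapp (star T) w))"
  using kform_lapp[of \<mu> "star T"] Q.commute[OF _ Q.inB(2)] by (auto simp: H_def star_star)

lemma F_singleton: "F [(1, g + g')] = (\<lambda>w. F [(1, g)] w + F [(1, g')] w)" "F [(1, c *\<^sub>C g)] = (\<lambda>w. c * F [(1, g)] w)"
proof -
  have "kform \<kappa> [(1, g + g')] w = kform \<kappa> [(1, g)] w + kform \<kappa> [(1, g')] w" for w
    by (induction w) (auto simp: cinner_add_left)
  moreover have "kform \<kappa> [(1, c *\<^sub>C g)] w = cnj c * kform \<kappa> [(1, g)] w" for w
    by (induction w) (auto simp: cinner_scaleC_left distrib_left)
  ultimately show "F [(1, g + g')] = (\<lambda>w. F [(1, g)] w + F [(1, g')] w)" "F [(1, c *\<^sub>C g)] = (\<lambda>w. c * F [(1, g)] w)"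
    by (auto simp: F_def)
qed

lemma H_singleton:
  "H [(a, h + h')] = (\<lambda>w. H [(a, h)] w + H [(a, h')] w)" "H [(a, c *\<^sub>C h)] = (\<lambda>w. c * H [(a, h)] w)"
  "H [(a + a', h)] = (\<lambda>w. H [(a, h)] w + H [(a', h)] w)" "H [(c *\<^sub>C a, h)] = (\<lambda>w. c * H [(a, h)] w)"
  by (auto simp: H_def lfun_add lfun_scale distrib_left clinear_map_simps Q.lin lfun_add_fun scaleC_mult_right lfun_scale_fun)

definition \<nu> :: "'a \<Rightarrow> 'g bop" where
  "\<nu> a = (SOME T. \<forall>g h. cinner g (app T h) = S.dip (F [(1, g)]) (H [(a, h)]))"

lemma cinner_\<nu>: "cinner g (app (\<nu> a) h) = S.dip (F [(1, g)]) (H [(a, h)])"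
proof -
  have "\<exists>T. \<forall>g h. cinner g (app T h) = S.dip (F [(1, g)]) (H [(a, h)])"
  proof (rule bop_of_sesquilinear)
    fix g h
    have "S.dn (F [(1, g)]) \<le> sqrt (norm (\<phi>1 1)) * norm g"
      using dn_F_le[of "[(1, g)]"] real_sqrt_le_mono[OF Re_cinner_bop_le[of g "\<phi>1 1"]] by (simp add: real_sqrt_mult)
    moreover have "S.dn (H [(a, h)]) \<le> sqrt (norm (\<phi>3 (star a * a))) * norm h"
      using dn_H_le[of "[(a, h)]"] real_sqrt_le_mono[OF Re_cinner_bop_le[of h "\<phi>3 (star a * a)"]] by (simp add: real_sqrt_mult)
    ultimately have "S.dn (F [(1, g)]) * S.dn (H [(a, h)])
        \<le> (sqrt (norm (\<phi>1 1)) * norm g) * (sqrt (norm (\<phi>3 (star a * a))) * norm h)"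
      by (intro mult_mono) (auto simp: F_dual H_dual)
    then show "cmod (S.dip (F [(1, g)]) (H [(a, h)])) \<le> (sqrt (norm (\<phi>1 1)) * sqrt (norm (\<phi>3 (star a * a)))) * norm g * norm h"
      using S.dip_cauchy_schwarz[OF F_dual H_dual, of "[(1, g)]" "[(a, h)]"] by (simp add: mult_ac)
  qed (simp_all add: F_singleton H_singleton F_dual H_dual S.dip_add_left S.dip_add_right S.dip_scale_left S.dip_scale_right)
  then show ?thesis unfolding \<nu>_def by (rule someI2_ex) blast
qed

lemma dip_lmul: "S.dip (F u) (H (lmul (star a) v)) = S.dip (F (lmul a u)) (H v)"
  unfolding F_lmul H_lmul
proof (rule S.dip_compose[symmetric, where K = "norm (star a)"])
  show "(\<lambda>w. F u (lmul (star a) w)) \<in> S.dual" using F_dual[of "lmul a u"] by (simp add: F_lmul)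
  show "(\<lambda>w. H v (lmul (star (star a)) w)) \<in> S.dual" using H_dual[of "lmul (star a) v"] by (simp add: H_lmul)
  show "S.sn (lmul (star a) w) \<le> norm (star a) * S.sn w" for w by (rule S_sn_lmul_le)
qed (auto simp: F_dual H_dual kform_lmul)

text \<open>Projection respects the left action, so by \<open>dip_lmul\<close> the value of \<nu> at
  \<open>star a * b\<close> pairs the projections of a x_1 g and b y_3 h. The kernel of \<nu> is
  then additive in both lists.\<close>

lemma kform_\<nu>: "kform \<nu> u v = S.dip (F u) (H v)"
proof -
  have entry: "cinner g (app (\<nu> (star a * b)) h) = S.dip (F [(a, g)]) (H [(b, h)])" for a b g h
    using dip_lmul[of "[(1, g)]" a "[(b, h)]"] by (simp add: cinner_\<nu>)
  have row: "lfun (\<lambda>a. \<nu> (star a * b)) h u = S.dip (F u) (H [(b, h)])" for b h u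
  proof (induction u)
    case Nil
    have "F [] = (\<lambda>_. 0)" using F_append[of "[]" "[]"] by (auto simp: fun_eq_iff)
    then show ?case by (simp add: S.dip_zero H_dual)
  next
    case (Cons q u)
    obtain a g where q: "q = (a, g)" by (cases q)
    have "S.dip (F (q # u)) (H [(b, h)]) = S.dip (F [q]) (H [(b, h)]) + S.dip (F u) (H [(b, h)])"
      using S.dip_add_left[OF F_dual[of "[q]"] F_dual[of u] H_dual] F_append[of "[q]" u] by simp
    then show ?case using Cons by (simp add: q entry)
  qed
  show ?thesis
  proof (induction v)
    case Nil
    have "H [] = (\<lambda>_. 0)" by (simp add: fun_eq_iff H_def)
    then show ?case by (simp add: S.dip_zero F_dual)
  next
    case (Cons q v)
    obtain b h where q: "q = (b, h)" by (cases q)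
    have "S.dip (F u) (H (q # v)) = S.dip (F u) (H [q]) + S.dip (F u) (H v)"
      using S.dip_add_right[OF F_dual H_dual[of "[q]"] H_dual[of v]] H_append[of "[q]" v] by simp
    then show ?case using Cons by (simp add: q row)
  qed
qed

lemma \<nu>_in_B: "\<nu> a \<in> B"
proof (rule P.in_B, rule bop_eq_cinnerI)
  fix T g h assume T: "T \<in> commutant B"
  have "S.dip (F [(1, g)]) (H (lapp T [(a, h)])) = S.dip (F (lapp (star T) [(1, g)])) (H [(a, h)])"
    unfolding F_lapp[OF P.commutant_star[OF T]] H_lapp[OF T]
  proof (rule S.dip_compose[symmetric, where K = "norm T"])
    show "(\<lambda>w. F [(1, g)] (lapp (star (star T)) w)) \<in> S.dual"
      using F_dual[of "lapp (star T) [(1, g)]"] F_lapp[OF P.commutant_star[OF T]] by metis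
    show "(\<lambda>w. H [(a, h)] (lapp (star T) w)) \<in> S.dual"
      using H_dual[of "lapp T [(a, h)]"] H_lapp[OF T] by metis
    show "kform \<phi>2 (lapp (star (star T)) u) v = kform \<phi>2 u (lapp (star T) v)" for u v
      using kform_lapp[of \<phi>2 T] P.commute[OF P.commutant_star[OF T] P.inB(3)] by (simp add: star_star)
  qed (auto simp: F_dual H_dual S_sn_lapp_le T star_star)
  then show "cinner g (app (\<nu> a * T) h) = cinner g (app (T * \<nu> a) h)"
    by (simp add: cinner_\<nu>) (simp add: cinner_\<nu>[symmetric] cinner_star_left)
qed

text \<open>Each diagonal term dominates the squared norm of the projection, and the squared norm of
  the sum of the two projections is nonnegative.\<close>

lemma amalgam: "pair_kernel B \<phi>1 \<nu> \<phi>3"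
proof
  show "clinear_map \<nu>"
    unfolding clinear_map_def
    by (intro conjI allI bop_eq_cinnerI)
      (simp_all add: cinner_\<nu> H_singleton cinner_add_right cinner_scaleC_right S.dip_add_right S.dip_scale_right F_dual H_dual)
  show "0 \<le> Re (pair_form \<phi>1 \<nu> \<phi>3 v v)" for v
  proof -
    have F: "(S.dn (F (fst v)))\<^sup>2 \<le> Re (kform \<phi>1 (fst v) (fst v))"
      using power_mono[OF dn_F_le S.dn_nonneg[OF F_dual], of "fst v" 2] by (simp add: kform_nonneg)
    have H: "(S.dn (H (snd v)))\<^sup>2 \<le> Re (kform \<phi>3 (snd v) (snd v))"
      using power_mono[OF dn_H_le S.dn_nonneg[OF H_dual], of "snd v" 2] by (simp add: kform_nonneg)
    have "\<bar>Re (S.dip (F (fst v)) (H (snd v)))\<bar> \<le> S.dn (F (fst v)) * S.dn (H (snd v))"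
      using S.dip_cauchy_schwarz[OF F_dual H_dual] abs_Re_le_cmod order_trans by blast
    moreover have "0 \<le> (S.dn (F (fst v)) - S.dn (H (snd v)))\<^sup>2" by simp
    ultimately show ?thesis using F H
      by (simp add: pair_form_def kform_\<nu> power2_diff)
  qed
qed (auto simp: P.vN P.lin Q.lin P.inB Q.inB P.herm Q.herm \<nu>_in_B)

text \<open>\<open>X\<close> and \<open>Z\<close> are the projections of x_1 g and y_3 g, and
  \<open>Y\<close> is x_2 g. With \<open>p\<close> and \<open>q\<close> the squares of the lost
  components, Pythagoras gives p + r^2 \<le> \<alpha>^2 and q + t^2 \<le> \<beta>^2, while the new
  gap is at most p + q + (r + t)^2.\<close>

lemma gap_triangle:
  assumes "gap \<phi>1 \<kappa> \<phi>2 g \<le> \<alpha>\<^sup>2" "gap \<phi>2 \<mu> \<phi>3 g \<le> \<beta>\<^sup>2" "0 \<le> \<alpha>" "0 \<le> \<beta>"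
  shows "gap \<phi>1 \<nu> \<phi>3 g \<le> (\<alpha> + \<beta>)\<^sup>2"
proof -
  define X where "X = F [(1, g)]"
  define Y where "Y = (\<lambda>w. kform \<phi>2 w [(1, g)])"
  define Z where "Z = H [(1, g)]"
  have XYZ: "X \<in> S.dual" "Y \<in> S.dual" "Z \<in> S.dual"
    unfolding X_def Y_def Z_def by (rule F_dual S.dual_vector H_dual)+
  have XY: "S.dip X Y = cinner g (app (\<kappa> 1) g)"
    using S.dip_vector_right[OF XYZ(1), of "[(1, g)]"] by (simp add: Y_def X_def F_def)
  have YZ: "S.dip Y Z = cinner g (app (\<mu> 1) g)"
    using S.dip_vector_left[OF XYZ(3), of "[(1, g)]"] by (simp add: Y_def Z_def H_def)
  have YY: "(S.dn Y)\<^sup>2 = Re (cinner g (app (\<phi>2 1) g))"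
    unfolding S.dn_power2[OF XYZ(2)] using S.dip_vector_left[OF XYZ(2), of "[(1, g)]"] by (simp add: Y_def)
  have XZ: "S.dip X Z = cinner g (app (\<nu> 1) g)" by (simp add: X_def Z_def cinner_\<nu>)
  have X: "(S.dn X)\<^sup>2 \<le> Re (cinner g (app (\<phi>1 1) g))"
    using power_mono[OF dn_F_le S.dn_nonneg[OF F_dual], of "[(1, g)]" 2] kform_nonneg(1)[of "[(1, g)]"] by (simp add: X_def)
  have Z: "(S.dn Z)\<^sup>2 \<le> Re (cinner g (app (\<phi>3 1) g))"
    using power_mono[OF dn_H_le S.dn_nonneg[OF H_dual], of "[(1, g)]" 2] kform_nonneg(2)[of "[(1, g)]"] by (simp add: Z_def)
  define p where "p = Re (cinner g (app (\<phi>1 1) g)) - (S.dn X)\<^sup>2"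
  define q where "q = Re (cinner g (app (\<phi>3 1) g)) - (S.dn Z)\<^sup>2"
  define r where "r = S.dn (\<lambda>w. X w - Y w)"
  define t where "t = S.dn (\<lambda>w. Y w - Z w)"
  have rt: "0 \<le> r" "0 \<le> t" unfolding r_def t_def by (simp_all add: S.dual_diff XYZ)
  have pq: "0 \<le> p" "0 \<le> q" using X Z by (simp_all add: p_def q_def)
  have a: "p + r\<^sup>2 \<le> \<alpha>\<^sup>2" and b: "q + t\<^sup>2 \<le> \<beta>\<^sup>2"
    using assms(1,2) by (simp_all add: p_def q_def r_def t_def gap_def S.dn_diff_power2 XYZ XY YZ YY)
  have "r \<le> \<alpha>" "t \<le> \<beta>" using a b pq assms(3,4) by (auto intro: power2_le_imp_le)
  then have "r * t \<le> \<alpha> * \<beta>" using rt assms by (intro mult_mono) auto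
  moreover have "(S.dn (\<lambda>w. X w - Z w))\<^sup>2 \<le> (r + t)\<^sup>2"
    unfolding r_def t_def by (intro power_mono S.dn_diff_triangle S.dn_nonneg S.dual_diff XYZ)
  moreover have "gap \<phi>1 \<nu> \<phi>3 g = p + q + (S.dn (\<lambda>w. X w - Z w))\<^sup>2"
    by (simp add: p_def q_def gap_def S.dn_diff_power2 XYZ XZ)
  ultimately show ?thesis using a b by (simp add: power2_sum)
qed

end

section \<open>The Bures metric\<close>

lemma cinner_sum_right: "cinner x (sum f I) = (\<Sum>i\<in>I. cinner x (f i :: 'g::chilbert_space))"
  by (induction I rule: infinite_finite_induct) (auto simp: cinner_add_right)

lemma cinner_sum_left: "cinner (sum f I) x = (\<Sum>i\<in>I. cinner (f i :: 'g::chilbert_space) x)"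
  by (induction I rule: infinite_finite_induct) (auto simp: cinner_add_left)

lemma app_sum_left: "app (sum f I) x = (\<Sum>i\<in>I. app (f i) x)"
  by (induction I rule: infinite_finite_induct) auto

section \<open>From complete positivity to positive kernels\<close>

lemma kform_conv_sum:
  "kform \<kappa> u v = (\<Sum>j<length v. \<Sum>i<length u.
     cinner (snd (u ! i)) (app (\<kappa> (star (fst (u ! i)) * fst (v ! j))) (snd (v ! j))))"
  by (simp add: kform_def lfun_def sum_list_sum_nth case_prod_beta atLeast0LessThan)

lemma completely_positive_gram:
  fixes a :: "nat \<Rightarrow> 'a::unital_cstar_algebra"
  assumes "completely_positive B \<phi>" "0 < n"
  shows "\<exists>Y. \<forall>i<n. \<forall>j<n. \<phi> (star (a i) * a j) = (\<Sum>k<n. star (Y k i) * Y k j)"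
proof -
  \<comment> \<open>The matrix with entries \<open>star (a i) * a j\<close> is a square of the
    matrix whose row 0 is \<open>a\<close> and whose other rows vanish; row 0 exists because
    \<open>0 < n\<close>.\<close>
  define Y where "Y k j = (if k = 0 then a j else 0)" for k j :: nat
  have "(\<Sum>k<n. star (Y k i) * Y k j) = star (a i) * a j" for i j
  proof -
    have "(\<Sum>k<n. star (Y k i) * Y k j) = (\<Sum>k<n. if k = 0 then star (a i) * a j else 0)"
      by (intro sum.cong) (auto simp: Y_def)
    then show ?thesis using assms(2) by (simp add: sum.delta)
  qed
  then have "positive_matrix n UNIV (\<lambda>i j. star (a i) * a j)"
    unfolding positive_matrix_def by (intro exI[of _ Y]) simp
  then have "positive_matrix n B (\<lambda>i j. \<phi> (star (a i) * a j))"
    using assms(1) by (simp add: completely_positive_def)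
  then show ?thesis unfolding positive_matrix_def by blast
qed

text \<open>Hermiticity is not part of the definition; it follows from the positive 2 by 2 matrix of
  the family 1, a, whose off-diagonal entries are mapped to adjoints of each other.\<close>

lemma completely_positive_star:
  fixes \<phi> :: "'a::unital_cstar_algebra \<Rightarrow> 'b::unital_cstar_algebra"
  assumes "completely_positive B \<phi>"
  shows "\<phi> (star a) = star (\<phi> a)"
proof -
  obtain Y :: "nat \<Rightarrow> nat \<Rightarrow> 'b" where Y: "\<And>i j. i < 2 \<Longrightarrow> j < 2 \<Longrightarrow>
      \<phi> (star ([1, a] ! i) * [1, a] ! j) = (\<Sum>k<2. star (Y k i) * Y k j)"
    using completely_positive_gram[OF assms, of 2 "\<lambda>i. [1, a] ! i"] by auto
  have "\<phi> (star a) = (\<Sum>k<2. star (Y k 1) * Y k 0)" using Y[of 1 0] by simp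
  moreover have "\<phi> a = (\<Sum>k<2. star (Y k 0) * Y k 1)" using Y[of 0 1] by simp
  ultimately show ?thesis by (simp add: numeral_2_eq_2 star_add star_mult star_star)
qed

lemma completely_positive_kform_nonneg:
  fixes \<phi> :: "'a::unital_cstar_algebra \<Rightarrow> 'g::chilbert_space bop"
  assumes "completely_positive B \<phi>"
  shows "0 \<le> Re (kform \<phi> v v)"
proof (cases "v = []")
  case False
  define n where "n = length v"
  obtain Y :: "nat \<Rightarrow> nat \<Rightarrow> 'g bop" where Y: "\<And>i j. i < n \<Longrightarrow> j < n \<Longrightarrow>
      \<phi> (star (fst (v ! i)) * fst (v ! j)) = (\<Sum>k<n. star (Y k i) * Y k j)"
    using completely_positive_gram[OF assms, of n "\<lambda>i. fst (v ! i)"] False by (auto simp: n_def)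
  define z where "z k = (\<Sum>j<n. app (Y k j) (snd (v ! j)))" for k
  have "kform \<phi> v v = (\<Sum>j<n. \<Sum>i<n. \<Sum>k<n. cinner (app (Y k i) (snd (v ! i))) (app (Y k j) (snd (v ! j))))"
    unfolding kform_conv_sum n_def[symmetric]
    by (intro sum.cong refl) (simp add: Y app_sum_left cinner_sum_right cinner_star_right)
  also have "\<dots> = (\<Sum>j<n. \<Sum>k<n. \<Sum>i<n. cinner (app (Y k i) (snd (v ! i))) (app (Y k j) (snd (v ! j))))"
    by (intro sum.cong refl sum.swap)
  also have "\<dots> = (\<Sum>k<n. \<Sum>j<n. \<Sum>i<n. cinner (app (Y k i) (snd (v ! i))) (app (Y k j) (snd (v ! j))))"
    by (rule sum.swap)
  also have "\<dots> = (\<Sum>k<n. cinner (z k) (z k))"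
    by (simp add: z_def cinner_sum_left cinner_sum_right)
  finally show ?thesis by (simp add: cinner_self sum_nonneg)
qed simp

text \<open>The zero entry means orthogonal vectors, as in the direct sum of two GNS modules. It
  ensures that the infimum defining \<open>bures_dist\<close> is not over the empty set.\<close>

lemma CP_pair_kernel:
  fixes \<phi> \<psi> :: "'a::unital_cstar_algebra \<Rightarrow> 'g::chilbert_space bop"
  assumes B: "von_neumann_algebra B" and "\<phi> \<in> CP B" "\<psi> \<in> CP B"
  shows "pair_kernel B \<phi> (\<lambda>_. 0) \<psi>"
proof -
  have cp: "completely_positive B \<phi>" "completely_positive B \<psi>" using assms by (auto simp: CP_def)
  have z: "kform (\<lambda>_. 0) u v = 0" for u v :: "('a \<times> 'g) list"
  proof -
    have "lfun (\<lambda>_. 0) g u = 0" for g by (induction u) auto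
    then show ?thesis by (induction v) auto
  qed
  show ?thesis
  proof
    show "0 \<le> Re (pair_form \<phi> (\<lambda>_. 0) \<psi> v v)" for v
      using cp[THEN completely_positive_kform_nonneg] by (simp add: pair_form_def z)
    show "\<phi> (star a) = star (\<phi> a)" "\<psi> (star a) = star (\<psi> a)" for a
      using cp[THEN completely_positive_star] by auto
  qed (use B cp cstar_subalgebra_zero[OF von_neumann_algebra_cstar[OF B]] in
      \<open>auto simp: completely_positive_def clinear_map_def\<close>)
qed

section \<open>The infimum and its approximation\<close>

lemma common_rep_modules_nonempty:
  assumes "von_neumann_algebra B" "\<phi> \<in> CP B" "\<psi> \<in> CP B"
  shows "(common_rep_modules B \<phi> \<psi> :: ('a::unital_cstar_algebra, 'g::chilbert_space bop, 'a \<Rightarrow> 'g bop \<times> 'g bop) bimodule set) \<noteq> {}"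
  using pair_kernel.kmodule_common[OF CP_pair_kernel[OF assms]] by blast

lemma bures_dist_in_nonneg:
  assumes "E \<in> common_rep_modules B \<phi> \<psi>" shows "0 \<le> bures_dist_in E \<phi> \<psi>"
  using assms unfolding bures_dist_in_def common_rep_modules_def by (intro cInf_greatest) auto

lemma bures_dist_in_le:
  assumes "x \<in> rep_vectors E \<phi>" "y \<in> rep_vectors E \<psi>"
  shows "bures_dist_in E \<phi> \<psi> \<le> mnorm E (x \<ominus>\<^bsub>E\<^esub> y)"
  unfolding bures_dist_in_def using assms by (intro cInf_lower bdd_belowI[of _ 0]) auto

lemma bures_dist_le_mnorm:
  fixes E :: "('a::unital_cstar_algebra, 'g::chilbert_space bop, 'e) bimodule"
  assumes "hilbert_bimodule E B" "\<phi> \<in> CP B" "\<psi> \<in> CP B" "x \<in> rep_vectors E \<phi>" "y \<in> rep_vectors E \<psi>"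
  shows "bures_dist B \<phi> \<psi> \<le> mnorm E (x \<ominus>\<^bsub>E\<^esub> y)"
  using bures_dist_le[of E B \<phi> \<psi>] bures_dist_in_le[OF assms(4,5)] assms
  by (fastforce simp: common_rep_modules_def)

lemma bures_dist_approx:
  fixes \<phi> \<psi> :: "'a::unital_cstar_algebra \<Rightarrow> 'g::chilbert_space bop"
  assumes "von_neumann_algebra B" "\<phi> \<in> CP B" "\<psi> \<in> CP B" "0 < e"
  obtains E :: "('a, 'g bop, 'a \<Rightarrow> 'g bop \<times> 'g bop) bimodule" and x y
  where "hilbert_bimodule E B" "x \<in> rep_vectors E \<phi>" "y \<in> rep_vectors E \<psi>"
    "mnorm E (x \<ominus>\<^bsub>E\<^esub> y) < bures_dist B \<phi> \<psi> + e"
proof -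
  let ?C = "common_rep_modules B \<phi> \<psi> :: ('a, 'g bop, 'a \<Rightarrow> 'g bop \<times> 'g bop) bimodule set"
  have "(INF E\<in>?C. bures_dist_in E \<phi> \<psi>) < bures_dist B \<phi> \<psi> + e"
    using assms by (simp add: bures_dist_def)
  then obtain E where E: "E \<in> ?C" "bures_dist_in E \<phi> \<psi> < bures_dist B \<phi> \<psi> + e"
    using cInf_lessD[of "(\<lambda>E. bures_dist_in E \<phi> \<psi>) ` ?C"] common_rep_modules_nonempty[OF assms(1-3)] by auto
  have "{mnorm E (x \<ominus>\<^bsub>E\<^esub> y) | x y. x \<in> rep_vectors E \<phi> \<and> y \<in> rep_vectors E \<psi>} \<noteq> {}"
    using E(1) unfolding common_rep_modules_def by blast
  from cInf_lessD[OF this E(2)[unfolded bures_dist_in_def]] obtain x y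
    where "x \<in> rep_vectors E \<phi>" "y \<in> rep_vectors E \<psi>" "mnorm E (x \<ominus>\<^bsub>E\<^esub> y) < bures_dist B \<phi> \<psi> + e"
    by blast
  moreover have "hilbert_bimodule E B" using E(1) by (simp add: common_rep_modules_def)
  ultimately show ?thesis using that by blast
qed

section \<open>The metric axioms\<close>

lemma bures_dist_nonneg:
  assumes "von_neumann_algebra B"
  shows "0 \<le> bures_dist B \<phi> \<psi>"
proof (cases "\<phi> \<in> CP B \<and> \<psi> \<in> CP B")
  case True
  then show ?thesis
    unfolding bures_dist_def
    by (simp, intro cINF_greatest common_rep_modules_nonempty[OF assms] bures_dist_in_nonneg) simp_all
next
  case False
  then show ?thesis unfolding bures_dist_def by auto
qed

lemma (in hilbert_module) mnorm_minus_commute: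
  assumes "x \<in> carrier E" "y \<in> carrier E" shows "mnorm E (x \<ominus> y) = mnorm E (y \<ominus> x)"
  using assms by (simp add: mnorm_def ip_diff_left ip_diff_right algebra_simps)

lemma bures_dist_commute_le:
  fixes \<phi> \<psi> :: "'a::unital_cstar_algebra \<Rightarrow> 'g::chilbert_space bop"
  assumes B: "von_neumann_algebra B" and cp: "\<phi> \<in> CP B" "\<psi> \<in> CP B"
  shows "bures_dist B \<phi> \<psi> \<le> bures_dist B \<psi> \<phi>"
proof (rule field_le_epsilon)
  fix e :: real assume "0 < e"
  from bures_dist_approx[OF B cp(2,1) this] obtain E :: "('a, 'g bop, 'a \<Rightarrow> 'g bop \<times> 'g bop) bimodule" and x y
    where E: "hilbert_bimodule E B" "x \<in> rep_vectors E \<psi>" "y \<in> rep_vectors E \<phi>"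
      "mnorm E (x \<ominus>\<^bsub>E\<^esub> y) < bures_dist B \<psi> \<phi> + e" .
  interpret hilbert_bimodule E B by fact
  have "mnorm E (y \<ominus>\<^bsub>E\<^esub> x) = mnorm E (x \<ominus>\<^bsub>E\<^esub> y)"
    using E(2,3) by (intro mnorm_minus_commute) (auto simp: rep_vectors_def)
  then show "bures_dist B \<phi> \<psi> \<le> bures_dist B \<psi> \<phi> + e"
    using bures_dist_le_mnorm[OF E(1) cp E(3,2)] E(4) by simp
qed

text \<open>The difference \<phi> a - \<psi> a is <x - y, a x> + <(star a) y, x - y>. The norms of a
  x and (star a) y depend on \<phi> and \<psi> alone, so one constant \<open>K\<close> serves for
  all modules.\<close>

lemma bures_dist_zero_imp_eq:
  fixes \<phi> \<psi> :: "'a::unital_cstar_algebra \<Rightarrow> 'g::chilbert_space bop"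
  assumes B: "von_neumann_algebra B" and cp: "\<phi> \<in> CP B" "\<psi> \<in> CP B" and z: "bures_dist B \<phi> \<psi> = 0"
  shows "\<phi> = \<psi>"
proof
  fix a
  define K where "K = sqrt (norm (\<phi> (star a * a))) + sqrt (norm (\<psi> (a * star a)))"
  have "norm (\<phi> a - \<psi> a) \<le> e * K" if e: "0 < e" for e
  proof -
    from bures_dist_approx[OF B cp e] obtain E :: "('a, 'g bop, 'a \<Rightarrow> 'g bop \<times> 'g bop) bimodule" and x y
      where E: "hilbert_bimodule E B" "x \<in> rep_vectors E \<phi>" "y \<in> rep_vectors E \<psi>"
        "mnorm E (x \<ominus>\<^bsub>E\<^esub> y) < bures_dist B \<phi> \<psi> + e" .
    interpret hilbert_bimodule E B by fact
    have xy: "x \<in> carrier E" "y \<in> carrier E" and \<phi>: "\<And>a. ip E x (lact E a x) = \<phi> a"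
      and \<psi>: "\<And>a. ip E y (lact E a y) = \<psi> a" using E(2,3) by (auto simp: rep_vectors_def)
    let ?d = "x \<ominus>\<^bsub>E\<^esub> y"
    have d: "?d \<in> carrier E" using xy by simp
    have m: "mnorm E (lact E a x) = sqrt (norm (\<phi> (star a * a)))" "mnorm E (lact E (star a) y) = sqrt (norm (\<psi> (a * star a)))"
      using xy by (simp_all add: mnorm_def lact_star lact_closed lact_mult[symmetric] \<phi> \<psi> star_star)
    have "\<phi> a - \<psi> a = ip E ?d (lact E a x) + ip E (lact E (star a) y) ?d"
      using xy lact_star[OF xy(2,1), of "star a"] lact_star[OF xy(2,2), of "star a"]
      by (simp add: ip_diff_left ip_diff_right lact_closed star_star \<phi> \<psi>)
    then have "norm (\<phi> a - \<psi> a) \<le> norm (ip E ?d (lact E a x)) + norm (ip E (lact E (star a) y) ?d)"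
      by (simp add: norm_triangle_ineq)
    also have "\<dots> \<le> mnorm E (lact E a x) * mnorm E ?d + mnorm E ?d * mnorm E (lact E (star a) y)"
      by (intro add_mono bop_cauchy_schwarz[OF hilbert_module_axioms] d lact_closed xy)
    also have "\<dots> = mnorm E ?d * K" by (simp add: m K_def algebra_simps)
    also have "\<dots> \<le> e * K" using E(4) z by (intro mult_right_mono) (auto simp: K_def)
    finally show ?thesis .
  qed
  then have bound: "- (e * K) \<le> - norm (\<phi> a - \<psi> a)" if "0 < e" for e using that by simp
  have "0 \<le> - norm (\<phi> a - \<psi> a)"
    by (rule real_nonneg_epsilon[OF _ bound]) (simp add: K_def)
  then show "\<phi> a = \<psi> a" by simp
qed

lemma gap_module:
  fixes E :: "('a::unital_cstar_algebra, 'g::chilbert_space bop, 'e) bimodule"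
  assumes "hilbert_bimodule E B" and xy: "x \<in> carrier E" "y \<in> carrier E"
  shows "gap (\<lambda>a. ip E x (lact E a x)) (\<lambda>a. ip E x (lact E a y)) (\<lambda>a. ip E y (lact E a y)) g
      = Re (cinner g (app (ip E (x \<ominus>\<^bsub>E\<^esub> y) (x \<ominus>\<^bsub>E\<^esub> y)) g))"
proof -
  interpret hilbert_bimodule E B by fact
  have "cinner g (app (ip E y x) g) = cnj (cinner g (app (ip E x y) g))"
    unfolding ip_star[OF xy, symmetric] cinner_star_right by (rule cinner_commute)
  then have "Re (cinner g (app (ip E y x) g)) = Re (cinner g (app (ip E x y) g))" by simp
  then show ?thesis using xy
    by (simp add: gap_def lact_one ip_diff_left ip_diff_right cinner_diff_right)
qed

lemma bures_dist_triangle: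
  fixes \<phi>1 \<phi>2 \<phi>3 :: "'a::unital_cstar_algebra \<Rightarrow> 'g::chilbert_space bop"
  assumes B: "von_neumann_algebra B" and cp: "\<phi>1 \<in> CP B" "\<phi>2 \<in> CP B" "\<phi>3 \<in> CP B"
  shows "bures_dist B \<phi>1 \<phi>3 \<le> bures_dist B \<phi>1 \<phi>2 + bures_dist B \<phi>2 \<phi>3"
proof (rule field_le_epsilon)
  fix e :: real assume "0 < e"
  then have e2: "0 < e / 2" by simp
  from bures_dist_approx[OF B cp(1,2) e2] obtain E :: "('a, 'g bop, 'a \<Rightarrow> 'g bop \<times> 'g bop) bimodule" and x1 x2
    where E: "hilbert_bimodule E B" "x1 \<in> rep_vectors E \<phi>1" "x2 \<in> rep_vectors E \<phi>2"
      "mnorm E (x1 \<ominus>\<^bsub>E\<^esub> x2) < bures_dist B \<phi>1 \<phi>2 + e / 2" .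
  from bures_dist_approx[OF B cp(2,3) e2] obtain E' :: "('a, 'g bop, 'a \<Rightarrow> 'g bop \<times> 'g bop) bimodule" and y2 y3
    where E': "hilbert_bimodule E' B" "y2 \<in> rep_vectors E' \<phi>2" "y3 \<in> rep_vectors E' \<phi>3"
      "mnorm E' (y2 \<ominus>\<^bsub>E'\<^esub> y3) < bures_dist B \<phi>2 \<phi>3 + e / 2" .
  define \<alpha> where "\<alpha> = mnorm E (x1 \<ominus>\<^bsub>E\<^esub> x2)"
  define \<beta> where "\<beta> = mnorm E' (y2 \<ominus>\<^bsub>E'\<^esub> y3)"
  have \<alpha>\<beta>: "0 \<le> \<alpha>" "0 \<le> \<beta>" by (simp_all add: \<alpha>_def \<beta>_def)
  define \<kappa> where "\<kappa> a = ip E x1 (lact E a x2)" for a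
  define \<mu> where "\<mu> a = ip E' y2 (lact E' a y3)" for a
  have x: "x1 \<in> carrier E" "x2 \<in> carrier E" "(\<lambda>a. ip E x1 (lact E a x1)) = \<phi>1" "(\<lambda>a. ip E x2 (lact E a x2)) = \<phi>2"
    using E(2,3) by (auto simp: rep_vectors_def)
  have y: "y2 \<in> carrier E'" "y3 \<in> carrier E'" "(\<lambda>a. ip E' y2 (lact E' a y2)) = \<phi>2" "(\<lambda>a. ip E' y3 (lact E' a y3)) = \<phi>3"
    using E'(2,3) by (auto simp: rep_vectors_def)
  interpret T: two_kernels B \<phi>1 \<phi>2 \<phi>3 \<kappa> \<mu>
    using module_pair_kernel[OF E(1) B x(1,2)] module_pair_kernel[OF E'(1) B y(1,2)]
    unfolding x(3,4) y(3,4) \<kappa>_def[abs_def, symmetric] \<mu>_def[abs_def, symmetric] by (rule two_kernels.intro)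
  interpret K: pair_kernel B \<phi>1 T.\<nu> \<phi>3 by (rule T.amalgam)
  interpret M: hilbert_bimodule K.kmodule B by (rule K.kmodule_hilbert_bimodule)
  let ?d = "K.gen1 \<ominus>\<^bsub>K.kmodule\<^esub> K.gen2"
  have g: "K.gen1 \<in> carrier K.kmodule" "K.gen2 \<in> carrier K.kmodule" using K.gen_in_kmod by simp_all
  then have d: "?d \<in> carrier K.kmodule" by (rule M.minus_closed)
  \<comment> \<open>The triangle inequality is applied at each vector \<open>h\<close> separately;
    the factor \<open>norm h\<close> makes the result a quadratic form bound, which yields the
    operator norm.\<close>
  have gap: "gap \<phi>1 T.\<nu> \<phi>3 h \<le> (\<alpha> * norm h + \<beta> * norm h)\<^sup>2" for h
  proof (rule T.gap_triangle)
    show "gap \<phi>1 \<kappa> \<phi>2 h \<le> (\<alpha> * norm h)\<^sup>2"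
      using gap_module[OF E(1) x(1,2), of h] Re_cinner_bop_le[of h "ip E (x1 \<ominus>\<^bsub>E\<^esub> x2) (x1 \<ominus>\<^bsub>E\<^esub> x2)"]
      by (simp add: x(3,4) \<kappa>_def[abs_def, symmetric] \<alpha>_def power_mult_distrib mnorm_power2)
    show "gap \<phi>2 \<mu> \<phi>3 h \<le> (\<beta> * norm h)\<^sup>2"
      using gap_module[OF E'(1) y(1,2), of h] Re_cinner_bop_le[of h "ip E' (y2 \<ominus>\<^bsub>E'\<^esub> y3) (y2 \<ominus>\<^bsub>E'\<^esub> y3)"]
      by (simp add: y(3,4) \<mu>_def[abs_def, symmetric] \<beta>_def power_mult_distrib mnorm_power2)
  qed (use \<alpha>\<beta> in simp_all)
  have rep: "(\<lambda>a. ip K.kmodule K.gen1 (lact K.kmodule a K.gen1)) = \<phi>1" "(\<lambda>a. ip K.kmodule K.gen1 (lact K.kmodule a K.gen2)) = T.\<nu>"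
    "(\<lambda>a. ip K.kmodule K.gen2 (lact K.kmodule a K.gen2)) = \<phi>3"
    by (rule ext, rule K.ip_gen)+
  have "norm (ip K.kmodule ?d ?d) \<le> (\<alpha> + \<beta>)\<^sup>2"
  proof (rule norm_bop_le_quadratic)
    show "star (ip K.kmodule ?d ?d) = ip K.kmodule ?d ?d" by (rule M.ip_star[OF d d])
    obtain c where "ip K.kmodule ?d ?d = star c * c" using M.ip_positive[OF d] by (auto simp: positive_element_def)
    then show "0 \<le> Re (cinner h (app (ip K.kmodule ?d ?d) h))" for h
      by (simp only: app_mult cinner_star_right cinner_self) simp
    show "Re (cinner h (app (ip K.kmodule ?d ?d) h)) \<le> (\<alpha> + \<beta>)\<^sup>2 * (norm h)\<^sup>2" for h
      using gap[of h] unfolding gap_module[OF K.kmodule_hilbert_bimodule g, unfolded rep, symmetric]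
      by (simp add: power_mult_distrib[symmetric] distrib_right)
  qed simp
  then have "mnorm K.kmodule ?d \<le> \<alpha> + \<beta>"
    using real_sqrt_le_mono[of _ "(\<alpha> + \<beta>)\<^sup>2"] \<alpha>\<beta> by (fastforce simp: mnorm_def simp del: K.kmodule_simps)
  then show "bures_dist B \<phi>1 \<phi>3 \<le> bures_dist B \<phi>1 \<phi>2 + bures_dist B \<phi>2 \<phi>3 + e"
    using bures_dist_le_mnorm[OF K.kmodule_hilbert_bimodule cp(1,3) K.gen_rep_vectors] E(4) E'(4)
    unfolding \<alpha>_def \<beta>_def by linarith
qed

theorem theorem2p1p3:
  fixes B :: "'g::chilbert_space bop set"
  assumes "von_neumann_algebra B"
  shows "Metric_space (CP B :: ('a::unital_cstar_algebra \<Rightarrow> 'g bop) set) (bures_dist B)"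
proof
  \<comment> \<open>Nonnegativity and symmetry are demanded for arbitrary functions; outside
    \<open>CP B\<close> they hold by the default value \<open>0\<close>.\<close>
  fix \<phi> \<psi> :: "'a \<Rightarrow> 'g bop"
  show "0 \<le> bures_dist B \<phi> \<psi>" by (rule bures_dist_nonneg[OF assms])
  show "bures_dist B \<phi> \<psi> = bures_dist B \<psi> \<phi>"
  proof (cases "\<phi> \<in> CP B \<and> \<psi> \<in> CP B")
    case True
    then show ?thesis using bures_dist_commute_le[OF assms] by (intro order_antisym) auto
  next
    case False
    then show ?thesis unfolding bures_dist_def by auto
  qed
next
  fix \<phi> \<psi> :: "'a \<Rightarrow> 'g bop" assume cp: "\<phi> \<in> CP B" "\<psi> \<in> CP B"
  have "bures_dist B \<phi> \<phi> \<le> 0"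
  proof -
    obtain E :: "('a, 'g bop, 'a \<Rightarrow> 'g bop \<times> 'g bop) bimodule" and x
      where E: "hilbert_bimodule E B" "x \<in> rep_vectors E \<phi>"
      using common_rep_modules_nonempty[OF assms cp(1,1)] unfolding common_rep_modules_def by blast
    interpret hilbert_bimodule E B by fact
    have "x \<ominus>\<^bsub>E\<^esub> x = \<zero>\<^bsub>E\<^esub>" using E(2) by (simp add: rep_vectors_def a_minus_def r_neg)
    then show ?thesis using bures_dist_le_mnorm[OF E(1) cp(1,1) E(2,2)] by (simp add: mnorm_def ip_zero_left)
  qed
  then show "bures_dist B \<phi> \<psi> = 0 \<longleftrightarrow> \<phi> = \<psi>"
    using bures_dist_zero_imp_eq[OF assms cp] bures_dist_nonneg[OF assms, of \<phi> \<phi>] by auto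
next
  fix \<phi> \<psi> \<omega> :: "'a \<Rightarrow> 'g bop" assume "\<phi> \<in> CP B" "\<psi> \<in> CP B" "\<omega> \<in> CP B"
  then show "bures_dist B \<phi> \<omega> \<le> bures_dist B \<phi> \<psi> + bures_dist B \<psi> \<omega>"
    by (rule bures_dist_triangle[OF assms])
qed

end
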